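(* Let $w$ be a signed Gauss word on letters $a_1,\dots,a_n$ with minimal realization $(S_w,\gamma_w)$. For each $i$ write $w=a_iw_{a_i}a_i^{-1}\widetilde w_{a_i}$ (up to cyclic permutation), let $S_{a_i}(w)$ be the set of all symbols $a^p$ ($a\in\{a_1,\dots,a_n\}$, $p=\pm1$) that occur in $w_{a_i}$, and put $\overline S_{a_i}(w)=S_{a_i}(w)\cup\{a_i,a_i^{-1}\}$ and $S^{-1}_{a_i}(w)=\{a^{-p}\mid a^p\in S_{a_i}(w)\}$. Let $\beta_{a_ia_j}(w)=\langle\varphi_{a_j},\varphi_{a_i}\rangle$, where $\varphi_{a_i}\in H_1(S_w,\mathbb Z)$ is the homology class of the curve $\gamma_{a_i}$ obtained by splitting the crossing $a_i$ of $\gamma_w$. Then, for every $i,j=1,2,\dots,n$, $$\beta_{a_ia_j}(w)=\sum_{a^e\in\overline S_{a_i}(w)\cap S^{-1}_{a_j}(w)}e.$$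
   Context: Surfaces are compact, orientable, triangulated (PL) 2-manifolds, closed or with boundary, taken with an orientation. An oriented PL-normal curve (of one component) on a connected surface $\Sigma$ is an oriented closed trail in the 1-skeleton of $\Sigma$ whose only self-intersections are transverse double points (crossings). At a crossing one of the two strands travels the crossing positively and the other negatively: a strand travels it positively iff the other strand crosses it from its left to its right. A signed Gauss word on letters $a_1,\dots,a_n$ is a word, considered up to cyclic permutation, in which each of the symbols $a_1,\dots,a_n,a_1^{-1},\dots,a_n^{-1}$ occurs exactly once. $(\Sigma,\gamma)$ is a realization of $w$ if the crossings of $\gamma$ can be labelled $a_1,\dots,a_n$ so that following $\gamma$ and writing $a_i$ (resp. $a_i^{-1}$) each time $a_i$ is travelled positively (resp. negatively) gives $w$. A minimal realization of $w$ is a realization $(\Sigma,\gamma)$ where $\Sigma$ has the minimum genus among all the realizations of $w$. Splitting: splitting the crossing $a_i$ means smoothing it consistently with the orientation of $\gamma_w$ (in a barycentric subdivision of the surface). This yields an oriented PL-normal curve of two components $\gamma'_{a_i}\cup\gamma_{a_i}$ with signed Gauss paragraph $\{w_{a_i},\widetilde w_{a_i}\}$, where $\gamma'_{a_i}$ reads $w_{a_i}$ and $\gamma_{a_i}$ reads $\widetilde w_{a_i}$. The homology class of $\gamma_{a_i}$ does not depend on the subdivision used. Intersection number: for transverse oriented PL-normal curves $\gamma_1,\gamma_2$ on a surface, $\langle\gamma_1,\gamma_2\rangle=\sum_{c\in\gamma_1\cap\gamma_2}\epsilon_c$ with $\epsilon_c=+1$ if $\gamma_1$ travels $c$ positively and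 $\epsilon_c=-1$ if $\gamma_1$ travels $c$ negatively. For homology classes, $\langle\varphi_1,\varphi_2\rangle$ is the value on transverse representatives.
   Formalization: The formula as stated fails (w = a1 a3 a1^-1 a2 a2^-1 a3^-1, i=1, j=2 gives 1 = 0); proved instead with φ_{a_i} the class of the component γ'_{a_i} reading w_{a_i}, and with β_{a_i a_j} = ⟨φ_{a_i}, φ_{a_j}⟩, the order of the pairing exchanged. *)

theory Defs
  imports "HOL-Algebra.Coset" "HOL-Library.Nat_Bijection"
begin

section \<open>Oriented triangulated surfaces\<close>

text \<open>
  Vertices are natural numbers. Every finite complex can be labelled in this way, so that "all
  realizations" is a quantification over one type, and barycentric subdivision stays in this type
  (\<open>bary\<close> below). In \<open>pos\<close> a triple \<open>(a, b, c)\<close> means that the triangle \<open>abc\<close> is traversed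
  counterclockwise; equivalently, around \<open>a\<close> the neighbour \<open>c\<close> comes right after \<open>b\<close> in
  counterclockwise order.
\<close>

record surf =
  faces :: "nat set set"
  pos :: "(nat \<times> nat \<times> nat) set"

definition verts :: "surf \<Rightarrow> nat set" where
  "verts S = {v. {v} \<in> faces S}"

definition edges :: "surf \<Rightarrow> nat set set" where
  "edges S = {e \<in> faces S. card e = 2}"

definition triangles :: "surf \<Rightarrow> nat set set" where
  "triangles S = {t \<in> faces S. card t = 3}"

definition is_complex :: "nat set set \<Rightarrow> bool" where
  "is_complex K \<longleftrightarrow> finite K \<and> (\<forall>s\<in>K. finite s \<and> s \<noteq> {}) \<and>
     (\<forall>s\<in>K. \<forall>t. t \<subseteq> s \<and> t \<noteq> {} \<longrightarrow> t \<in> K)"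

text \<open>
  The last two conditions of \<open>two_manifold\<close> say that the link of every vertex is a connected graph
  all of whose vertices have degree 1 or 2, that is, a cycle (interior vertex) or a path
  (boundary vertex).
\<close>

definition two_manifold :: "surf \<Rightarrow> bool" where
  "two_manifold S \<longleftrightarrow> is_complex (faces S) \<and> faces S \<noteq> {} \<and>
     (\<forall>s\<in>faces S. card s \<le> 3 \<and> (\<exists>t\<in>triangles S. s \<subseteq> t)) \<and>
     (\<forall>e\<in>edges S. card {t \<in> triangles S. e \<subseteq> t} \<in> {1, 2}) \<and>
     (\<forall>v x y. {v, x} \<in> edges S \<and> {v, y} \<in> edges S \<longrightarrow>
        (x, y) \<in> {(a, b). {v, a, b} \<in> triangles S}\<^sup>*)"

text \<open>
  The last condition of \<open>orientation\<close> says that two triangles sharing an edge induce opposite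
  directions on it.
\<close>

definition orientation :: "surf \<Rightarrow> bool" where
  "orientation S \<longleftrightarrow>
     (\<forall>a b c. (a, b, c) \<in> pos S \<longrightarrow> {a, b, c} \<in> triangles S \<and> (b, c, a) \<in> pos S) \<and>
     (\<forall>a b c. {a, b, c} \<in> triangles S \<longrightarrow> ((a, b, c) \<in> pos S \<longleftrightarrow> (a, c, b) \<notin> pos S)) \<and>
     (\<forall>a b c d. (a, b, c) \<in> pos S \<and> (a, b, d) \<in> pos S \<longrightarrow> c = d)"

definition oriented_surface :: "surf \<Rightarrow> bool" where
  "oriented_surface S \<longleftrightarrow> two_manifold S \<and> orientation S"

definition connected_surface :: "surf \<Rightarrow> bool" where
  "connected_surface S \<longleftrightarrow> oriented_surface S \<and>
     (\<forall>u\<in>verts S. \<forall>v\<in>verts S. (u, v) \<in> {(a, b). {a, b} \<in> edges S}\<^sup>*)"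

definition boundary_edges :: "surf \<Rightarrow> (nat \<times> nat) set" where
  "boundary_edges S = {(a, b). {a, b} \<in> edges S \<and> card {t \<in> triangles S. {a, b} \<subseteq> t} = 1}"

definition interior_vertex :: "surf \<Rightarrow> nat \<Rightarrow> bool" where
  "interior_vertex S v \<longleftrightarrow> v \<in> verts S \<and> v \<notin> Field (boundary_edges S)"

definition boundary_components :: "surf \<Rightarrow> nat set set" where
  "boundary_components S = Field (boundary_edges S) // (boundary_edges S)\<^sup>*"

definition euler_char :: "surf \<Rightarrow> int" where
  "euler_char S = int (card (verts S)) - int (card (edges S)) + int (card (triangles S))"

text \<open>Genus of a connected surface: \<open>\<chi> = 2 - 2 g - b\<close>.\<close>

definition genus :: "surf \<Rightarrow> int" where
  "genus S = (2 - euler_char S - int (card (boundary_components S))) div 2"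


section \<open>Barycentric subdivision\<close>

text \<open>The barycentre of a simplex; \<open>set_encode\<close> is injective on finite sets.\<close>

abbreviation bary :: "nat set \<Rightarrow> nat" where
  "bary \<equiv> set_encode"

text \<open>
  If \<open>abc\<close> is counterclockwise then, with \<open>m\<close> the midpoint of \<open>ab\<close> and \<open>z\<close> the barycentre of
  \<open>abc\<close>, so are \<open>amz\<close> and \<open>bzm\<close>.
\<close>

definition sd :: "surf \<Rightarrow> surf" where
  "sd S = \<lparr>
     faces = {bary ` C | C. C \<subseteq> faces S \<and> C \<noteq> {} \<and> (\<forall>s\<in>C. \<forall>t\<in>C. s \<subseteq> t \<or> t \<subseteq> s)},
     pos = (\<Union>(a, b, c)\<in>pos S.
       let x = bary {a}; y = bary {b}; m = bary {a, b}; z = bary {a, b, c}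
       in {(x, m, z), (m, z, x), (z, x, m), (y, z, m), (z, m, y), (m, y, z)})\<rparr>"


section \<open>PL-normal curves\<close>

text \<open>
  A closed trail is the list of its vertices in cyclic order, the last one being joined to the
  first; a curve is a list of such components. A strand is a triple of consecutive vertices.
  Since edges are not repeated, the strands of a normal curve correspond to its passages
  through vertices.
\<close>

definition arcs :: "nat list \<Rightarrow> (nat \<times> nat) list" where
  "arcs c = zip c (rotate1 c)"

definition strand_list :: "nat list \<Rightarrow> (nat \<times> nat \<times> nat) list" where
  "strand_list c = zip (last c # butlast c) (zip c (rotate1 c))"

definition strands :: "nat list list \<Rightarrow> (nat \<times> nat \<times> nat) set" where
  "strands cs = (\<Union>c\<in>set cs. set (strand_list c))"

abbreviation mid :: "nat \<times> nat \<times> nat \<Rightarrow> nat" where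
  "mid s \<equiv> fst (snd s)"

definition ccw :: "surf \<Rightarrow> nat \<Rightarrow> nat \<Rightarrow> nat" where
  "ccw S v x = (THE y. (v, x, y) \<in> pos S)"

text \<open>
  For an interior vertex \<open>v\<close>, the neighbours of \<open>v\<close> met on the way counterclockwise around \<open>v\<close>
  from \<open>a\<close> to \<open>b\<close>, both included.
\<close>

definition ccw_arc :: "surf \<Rightarrow> nat \<Rightarrow> nat \<Rightarrow> nat \<Rightarrow> nat list" where
  "ccw_arc S v a b =
     map (\<lambda>k. (ccw S v ^^ k) a) [0..<Suc (LEAST k. (ccw S v ^^ k) a = b)]"

fun left_side :: "surf \<Rightarrow> nat \<times> nat \<times> nat \<Rightarrow> nat set" where
  "left_side S (x, v, y) = set (ccw_arc S v y x) - {x, y}"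

fun right_side :: "surf \<Rightarrow> nat \<times> nat \<times> nat \<Rightarrow> nat set" where
  "right_side S (x, v, y) = set (ccw_arc S v x y) - {x, y}"

text \<open>Strand \<open>t\<close> crosses strand \<open>s\<close> from the left of \<open>s\<close> to the right of \<open>s\<close>.\<close>

definition crossed_lr :: "surf \<Rightarrow> nat \<times> nat \<times> nat \<Rightarrow> nat \<times> nat \<times> nat \<Rightarrow> bool" where
  "crossed_lr S s t \<longleftrightarrow> fst t \<in> left_side S s \<and> snd (snd t) \<in> right_side S s"

text \<open>
  A curve may touch the boundary, but its double points, being transverse, are interior vertices.
\<close>

definition normal_curve :: "surf \<Rightarrow> nat list list \<Rightarrow> bool" where
  "normal_curve S cs \<longleftrightarrow> cs \<noteq> [] \<and> (\<forall>c\<in>set cs. c \<noteq> []) \<and>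
     (\<forall>c\<in>set cs. \<forall>(u, v)\<in>set (arcs c). {u, v} \<in> edges S) \<and>
     distinct (map (\<lambda>(u, v). {u, v}) (concat (map arcs cs))) \<and>
     (\<forall>v. card {s \<in> strands cs. mid s = v} \<le> 2) \<and>
     (\<forall>s\<in>strands cs. \<forall>t\<in>strands cs. s \<noteq> t \<and> mid s = mid t \<longrightarrow>
        interior_vertex S (mid s) \<and> (crossed_lr S s t \<or> crossed_lr S t s))"

definition crossings :: "nat list list \<Rightarrow> nat set" where
  "crossings cs = {v. \<exists>s\<in>strands cs. \<exists>t\<in>strands cs. s \<noteq> t \<and> mid s = v \<and> mid t = v}"

definition transverse :: "surf \<Rightarrow> nat list list \<Rightarrow> nat list list \<Rightarrow> bool" where
  "transverse S cs ds \<longleftrightarrow> normal_curve S cs \<and> normal_curve S ds \<and> normal_curve S (cs @ ds)"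

text \<open>
  For transverse curves each common vertex carries exactly one strand of either curve, so this is
  a sum over the common vertices; the sign is \<open>1\<close> if the first curve travels the crossing
  positively and \<open>-1\<close> if it travels it negatively.
\<close>

definition intersection_number :: "surf \<Rightarrow> nat list list \<Rightarrow> nat list list \<Rightarrow> int" where
  "intersection_number S cs ds =
     (\<Sum>(s, t)\<in>{(s, t). s \<in> strands cs \<and> t \<in> strands ds \<and> mid s = mid t}.
        if crossed_lr S s t then 1 else - 1)"


section \<open>Signed Gauss words and realizations\<close>

text \<open>The symbol \<open>(i, 1)\<close> stands for the letter with index \<open>i\<close>, and \<open>(i, -1)\<close> for its inverse.\<close>

definition signed_gauss_word :: "nat \<Rightarrow> (nat \<times> int) list \<Rightarrow> bool" where
  "signed_gauss_word n w \<longleftrightarrow> distinct w \<and> set w = {1..n} \<times> {1, - 1}"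

definition travel_sign :: "surf \<Rightarrow> nat list list \<Rightarrow> nat \<times> nat \<times> nat \<Rightarrow> int" where
  "travel_sign S cs s =
     (if \<exists>t\<in>strands cs. t \<noteq> s \<and> mid t = mid s \<and> crossed_lr S s t then 1 else - 1)"

definition gauss_code :: "surf \<Rightarrow> nat list \<Rightarrow> (nat \<times> int) list" where
  "gauss_code S c = map (\<lambda>s. (mid s, travel_sign S [c] s))
     (filter (\<lambda>s. mid s \<in> crossings [c]) (strand_list c))"

definition realizes_with ::
    "nat \<Rightarrow> (nat \<times> int) list \<Rightarrow> surf \<Rightarrow> nat list \<Rightarrow> (nat \<Rightarrow> nat) \<Rightarrow> bool" where
  "realizes_with n w S c lab \<longleftrightarrow> connected_surface S \<and> normal_curve S [c] \<and>
     bij_betw lab {1..n} (crossings [c]) \<and>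
     (\<exists>k. map (\<lambda>(i, p). (lab i, p)) (rotate k w) = gauss_code S c)"

definition realization :: "nat \<Rightarrow> (nat \<times> int) list \<Rightarrow> surf \<Rightarrow> nat list \<Rightarrow> bool" where
  "realization n w S c \<longleftrightarrow> (\<exists>lab. realizes_with n w S c lab)"

definition minimal_realization :: "nat \<Rightarrow> (nat \<times> int) list \<Rightarrow> surf \<Rightarrow> nat list \<Rightarrow> bool" where
  "minimal_realization n w S c \<longleftrightarrow> realization n w S c \<and>
     (\<forall>S' c'. realization n w S' c' \<longrightarrow> genus S \<le> genus S')"

text \<open>
  With \<open>w\<close> written cyclically as \<open>(i, 1) # u @ (i, -1) # v\<close>, the set of symbols of \<open>u\<close>.
\<close>

definition loop_symbols :: "(nat \<times> int) list \<Rightarrow> nat \<Rightarrow> (nat \<times> int) set" where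
  "loop_symbols w i =
     {s. \<exists>k u v. rotate k w = (i, 1) # u @ (i, - 1) # v \<and> s \<in> set u}"

definition loop_symbols_bar :: "(nat \<times> int) list \<Rightarrow> nat \<Rightarrow> (nat \<times> int) set" where
  "loop_symbols_bar w i = loop_symbols w i \<union> {(i, 1), (i, - 1)}"

definition loop_symbols_inv :: "(nat \<times> int) list \<Rightarrow> nat \<Rightarrow> (nat \<times> int) set" where
  "loop_symbols_inv w i = (\<lambda>(a, p). (a, - p)) ` loop_symbols w i"


section \<open>Splitting a crossing\<close>

fun sd_path :: "nat list \<Rightarrow> nat list" where
  "sd_path [] = []"
| "sd_path [a] = [bary {a}]"
| "sd_path (a # b # p) = bary {a} # bary {a, b} # sd_path (b # p)"

text \<open>
  Cyclically \<open>c = v # p @ v # q\<close>, where the first \<open>v\<close> is the positive passage through the crossing.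
  With the positive strand heading east, the negative strand comes from the north and leaves to the
  south. The two corners of the smoothing run in \<open>sd S\<close> along the link of \<open>v\<close>: from north clockwise
  to east, which closes up \<open>p\<close> to \<open>c1\<close>, and from west counterclockwise to south, which closes up
  \<open>q\<close> to \<open>c2\<close>. So \<open>c1\<close> follows \<open>c\<close> from the positive passage to the negative one, and \<open>c2\<close> from the
  negative passage to the positive one.
\<close>

definition splitting :: "surf \<Rightarrow> nat list \<Rightarrow> nat \<Rightarrow> nat list \<Rightarrow> nat list \<Rightarrow> bool" where
  "splitting S c v c1 c2 \<longleftrightarrow> v \<in> crossings [c] \<and>
     (\<exists>k p q. rotate k c = v # p @ v # q \<and>
        travel_sign S [c] (last q, v, hd p) = 1 \<and>
        c1 = sd_path p @ rev (ccw_arc (sd S) (bary {v}) (bary {v, hd p}) (bary {v, last p})) \<and>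
        c2 = sd_path q @ ccw_arc (sd S) (bary {v}) (bary {v, last q}) (bary {v, hd q}))"


section \<open>First homology and the intersection form\<close>

text \<open>
  A 1-chain is an antisymmetric function on ordered pairs of vertices that vanishes off the edges.
  The 2-chains are functions on triangles, each triangle being taken with its positive orientation.
\<close>

definition cycles1 :: "surf \<Rightarrow> (nat \<times> nat \<Rightarrow> int) set" where
  "cycles1 S = {z. (\<forall>a b. z (b, a) = - z (a, b)) \<and>
     (\<forall>a b. {a, b} \<notin> edges S \<longrightarrow> z (a, b) = 0) \<and>
     (\<forall>v\<in>verts S. (\<Sum>u\<in>verts S. z (u, v)) = 0)}"

definition boundary2 :: "surf \<Rightarrow> (nat set \<Rightarrow> int) \<Rightarrow> nat \<times> nat \<Rightarrow> int" where
  "boundary2 S f = (\<lambda>(a, b).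
     (\<Sum>c | (a, b, c) \<in> pos S. f {a, b, c}) - (\<Sum>c | (b, a, c) \<in> pos S. f {b, a, c}))"

definition cycle_group :: "surf \<Rightarrow> (nat \<times> nat \<Rightarrow> int) monoid" where
  "cycle_group S = \<lparr>carrier = cycles1 S, mult = (\<lambda>y z e. y e + z e), one = (\<lambda>e. 0)\<rparr>"

definition H1 :: "surf \<Rightarrow> (nat \<times> nat \<Rightarrow> int) set monoid" where
  "H1 S = cycle_group S Mod range (boundary2 S)"

definition hclass :: "surf \<Rightarrow> (nat \<times> nat \<Rightarrow> int) \<Rightarrow> (nat \<times> nat \<Rightarrow> int) set" where
  "hclass S z = range (boundary2 S) #>\<^bsub>cycle_group S\<^esub> z"

definition arc_chain :: "nat \<times> nat \<Rightarrow> nat \<times> nat \<Rightarrow> int" where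
  "arc_chain = (\<lambda>(u, v) e. of_bool (e = (u, v)) - of_bool (e = (v, u)))"

definition curve_chain :: "nat list list \<Rightarrow> nat \<times> nat \<Rightarrow> int" where
  "curve_chain cs e = (\<Sum>a\<leftarrow>concat (map arcs cs). arc_chain a e)"

definition sd_chain :: "surf \<Rightarrow> (nat \<times> nat \<Rightarrow> int) \<Rightarrow> nat \<times> nat \<Rightarrow> int" where
  "sd_chain S z e = (\<Sum>(a, b)\<in>{(a, b). a < b \<and> {a, b} \<in> edges S}.
     z (a, b) * (arc_chain (bary {a}, bary {a, b}) e + arc_chain (bary {a, b}, bary {b}) e))"

primrec sd_chain_iter :: "surf \<Rightarrow> nat \<Rightarrow> (nat \<times> nat \<Rightarrow> int) \<Rightarrow> nat \<times> nat \<Rightarrow> int" where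
  "sd_chain_iter S 0 z = z"
| "sd_chain_iter S (Suc m) z = sd_chain ((sd ^^ m) S) (sd_chain_iter S m z)"

text \<open>
  The curve \<open>cs\<close> on the \<open>m\<close>-th barycentric subdivision has homology class \<open>\<phi>\<close>, under the
  identification of the homology of \<open>S\<close> with that of its subdivisions.
\<close>

definition represents ::
    "surf \<Rightarrow> nat \<Rightarrow> nat list list \<Rightarrow> (nat \<times> nat \<Rightarrow> int) set \<Rightarrow> bool" where
  "represents S m cs \<phi> \<longleftrightarrow> (\<exists>z\<in>cycles1 S. \<phi> = hclass S z \<and>
     hclass ((sd ^^ m) S) (sd_chain_iter S m z) = hclass ((sd ^^ m) S) (curve_chain cs))"

definition intersection_form ::
    "surf \<Rightarrow> (nat \<times> nat \<Rightarrow> int) set \<Rightarrow> (nat \<times> nat \<Rightarrow> int) set \<Rightarrow> int" where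
  "intersection_form S \<phi> \<psi> = (THE k. \<exists>m cs ds.
     transverse ((sd ^^ m) S) cs ds \<and> represents S m cs \<phi> \<and> represents S m ds \<psi> \<and>
     k = intersection_number ((sd ^^ m) S) cs ds)"

end

theory Submission
  imports Defs
begin

text \<open>
  The intersection form is computed locally. A 1-cycle \<open>y\<close> is written with a potential \<open>F\<close>, a function on
  corners (vertex, triangle) whose jump at \<open>v\<close> across the edge \<open>vu\<close> is the flow of \<open>y\<close> from \<open>v\<close> to \<open>u\<close>.
  Summing the flow of \<open>x\<close> against the two corners of a potential of \<open>y\<close> at each edge gives a pairing that is
  antisymmetric at every vertex, vanishes on boundaries, is invariant under subdivision, and equals twice
  the intersection number of transverse curves. Hence the intersection number depends on the classes only.

  Transverse representatives exist because a potential turns a cycle into a Poincare dual 1-cocycle \<open>d\<close>;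
  subdividing halves \<open>max |d|\<close> until \<open>d\<close> takes values in \<open>{-1, 0, 1}\<close>. Such a cocycle is dual to disjoint simple
  closed curves in the trivalent dual graph, and these cross curves of the 1-skeleton at midpoints of edges only.

  Finally the smoothed curve is homologous to the part of \<open>\<gamma>\<close> between the two passages through the crossing.
  Pairing two such loops vertex by vertex, each common crossing contributes its sign, and the corners at
  \<open>a\<^sub>i\<close> and \<open>a\<^sub>j\<close> contribute one half each; these two halves agree because linking of chords is symmetric.
\<close>

section \<open>Oriented triangles\<close>

(* otherwise a barycentre is rewritten to a sum of powers of two *)
declare set_encode_insert [simp del]

locale tri_surf =
  fixes T :: surf
  assumes finite_pos: "finite (pos T)"
    and rot: "(a, b, c) \<in> pos T \<Longrightarrow> (b, c, a) \<in> pos T"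
    and uniq: "(a, b, c) \<in> pos T \<Longrightarrow> (a, b, d) \<in> pos T \<Longrightarrow> c = d"
    and anti: "(a, b, c) \<in> pos T \<Longrightarrow> (a, c, b) \<notin> pos T"
    and faces_pos: "faces T = {s. s \<noteq> {} \<and> (\<exists>a b c. (a, b, c) \<in> pos T \<and> s \<subseteq> {a, b, c})}"
begin

lemma rot2: "(a, b, c) \<in> pos T \<Longrightarrow> (c, a, b) \<in> pos T"
  by (rule rot[OF rot])

lemma uniq_prev: "(a, b, c) \<in> pos T \<Longrightarrow> (a, d, c) \<in> pos T \<Longrightarrow> b = d"
  using uniq[of c a b d] rot2[of a b c] rot2[of a d c] by blast

lemma anti2: "(a, b, c) \<in> pos T \<Longrightarrow> (b, a, c) \<notin> pos T"
  using anti[of b c a] rot[of a b c] by blast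

lemma pos_distinct:
  assumes "(a, b, c) \<in> pos T"
  shows "a \<noteq> b" "b \<noteq> c" "a \<noteq> c"
  using assms anti[of a b c] rot[of a b c] rot2[of a b c] anti[of b c a] anti[of c a b] by auto

lemma verts_pos: "verts T = {a. \<exists>b c. (a, b, c) \<in> pos T}"
proof (intro equalityI subsetI CollectI)
  fix a assume "a \<in> verts T"
  then obtain x y z where "(x, y, z) \<in> pos T" "a = x \<or> a = y \<or> a = z"
    unfolding verts_def faces_pos by auto
  then show "\<exists>b c. (a, b, c) \<in> pos T"
    using rot[of x y z] rot2[of x y z] by fast
next
  fix a assume "a \<in> {a. \<exists>b c. (a, b, c) \<in> pos T}"
  then show "a \<in> verts T"
    unfolding verts_def faces_pos by auto
qed

lemma edge_pos: "{a, b} \<in> edges T \<longleftrightarrow> (\<exists>c. (a, b, c) \<in> pos T \<or> (b, a, c) \<in> pos T)"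
proof
  assume "{a, b} \<in> edges T"
  then have "a \<noteq> b" and "{a, b} \<in> faces T"
    by (auto simp: edges_def card_insert_if split: if_splits)
  then obtain x y z where "(x, y, z) \<in> pos T" "{a, b} \<subseteq> {x, y, z}"
    unfolding faces_pos by blast
  with \<open>a \<noteq> b\<close> show "\<exists>c. (a, b, c) \<in> pos T \<or> (b, a, c) \<in> pos T"
    using rot[of x y z] rot2[of x y z] by auto
next
  assume "\<exists>c. (a, b, c) \<in> pos T \<or> (b, a, c) \<in> pos T"
  then obtain c where c: "(a, b, c) \<in> pos T \<or> (b, a, c) \<in> pos T" by blast
  then have "a \<noteq> b" using pos_distinct by blast
  with c show "{a, b} \<in> edges T"
    unfolding edges_def faces_pos by auto
qed

lemma triangle_pos: "{a, b, c} \<in> triangles T \<longleftrightarrow> (a, b, c) \<in> pos T \<or> (a, c, b) \<in> pos T"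
proof
  assume "{a, b, c} \<in> triangles T"
  then have d: "a \<noteq> b" "b \<noteq> c" "a \<noteq> c" and "{a, b, c} \<in> faces T"
    by (auto simp: triangles_def card_insert_if split: if_splits)
  then obtain x y z where *: "(x, y, z) \<in> pos T" "{a, b, c} \<subseteq> {x, y, z}"
    unfolding faces_pos by blast
  with d show "(a, b, c) \<in> pos T \<or> (a, c, b) \<in> pos T"
    using rot[OF *(1)] rot2[OF *(1)] by auto
next
  assume *: "(a, b, c) \<in> pos T \<or> (a, c, b) \<in> pos T"
  then have "a \<noteq> b" "b \<noteq> c" "a \<noteq> c" using pos_distinct by metis+
  with * show "{a, b, c} \<in> triangles T"
    unfolding triangles_def faces_pos by fastforce
qed

lemma triangles_eq: "triangles T = {{a, b, c} | a b c. (a, b, c) \<in> pos T}" (is "_ = ?R")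
proof
  show "triangles T \<subseteq> ?R"
  proof
    fix t assume t: "t \<in> triangles T"
    then obtain a b c where "t = {a, b, c}"
      unfolding triangles_def by (auto simp: card_3_iff)
    with t triangle_pos[of a b c] show "t \<in> ?R"
      by (auto simp: insert_commute)
  qed
qed (use triangle_pos in auto)

lemma finite_verts: "finite (verts T)"
proof -
  have "verts T = fst ` pos T"
    by (force simp: verts_pos)
  then show ?thesis using finite_pos by simp
qed

lemma pos_verts: "(a, b, c) \<in> pos T \<Longrightarrow> a \<in> verts T \<and> b \<in> verts T \<and> c \<in> verts T"
  unfolding verts_pos using rot[of a b c] rot2[of a b c] by blast

lemma edge_verts: "{a, b} \<in> edges T \<Longrightarrow> a \<in> verts T \<and> b \<in> verts T"
  using edge_pos pos_verts by blast

lemma edge_neq: "{a, b} \<in> edges T \<Longrightarrow> a \<noteq> b"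
  by (auto simp: edges_def)

lemma tri_edges: "(a, b, c) \<in> pos T \<Longrightarrow> {a, b} \<in> edges T \<and> {b, c} \<in> edges T \<and> {a, c} \<in> edges T"
  using edge_pos[of a b] edge_pos[of b c] edge_pos[of a c] rot[of a b c] rot2[of a b c] by blast

lemma finite_edge_pairs: "finite {(a, b). {a, b} \<in> edges T}"
  by (rule finite_subset[of _ "verts T \<times> verts T"]) (use edge_verts finite_verts in auto)

lemma sum_rot: "(\<Sum>(a, b, c)\<in>pos T. h b c a) = (\<Sum>(a, b, c)\<in>pos T. h a b c)"
  by (rule sum.reindex_bij_witness[of _ "\<lambda>(a, b, c). (c, a, b)" "\<lambda>(a, b, c). (b, c, a)"])
     (auto intro: rot rot2)

lemma pos_eq_of_set:
  assumes "(a, b, c) \<in> pos T" "(a', b', c') \<in> pos T" "{a, b, c} = {a', b', c'}"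
  shows "(a', b', c') = (a, b, c) \<or> (a', b', c') = (b, c, a) \<or> (a', b', c') = (c, a, b)"
proof -
  have d: "a \<noteq> b" "b \<noteq> c" "a \<noteq> c" "a' \<noteq> b'" "b' \<noteq> c'" "a' \<noteq> c'"
    using pos_distinct assms by metis+
  have "(a, c, b) \<notin> pos T" "(c, b, a) \<notin> pos T" "(b, a, c) \<notin> pos T"
    using anti[OF assms(1)] anti[OF rot[OF assms(1)]] anti[OF rot2[OF assms(1)]] by simp_all
  moreover have "a' \<in> {a, b, c}" "b' \<in> {a, b, c}" "c' \<in> {a, b, c}"
    using assms(3) by auto
  ultimately show ?thesis using d assms(2) by auto
qed

end

lemma tri_surf_of_oriented:
  assumes "oriented_surface S"
  shows "tri_surf S"
proof -
  have m: "two_manifold S" and o: "orientation S"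
    using assms by (auto simp: oriented_surface_def)
  have o1: "{a, b, c} \<in> triangles S" "(b, c, a) \<in> pos S" if "(a, b, c) \<in> pos S" for a b c
    using o that unfolding orientation_def by blast+
  have o2: "(a, b, c) \<in> pos S \<longleftrightarrow> (a, c, b) \<notin> pos S" if "{a, b, c} \<in> triangles S" for a b c
    using o that unfolding orientation_def by blast
  have o3: "c = d" if "(a, b, c) \<in> pos S" "(a, b, d) \<in> pos S" for a b c d
    using o that unfolding orientation_def by blast
  have k: "finite (faces S)" "\<And>s. s \<in> faces S \<Longrightarrow> finite s \<and> s \<noteq> {}"
    "\<And>s t. s \<in> faces S \<Longrightarrow> t \<subseteq> s \<Longrightarrow> t \<noteq> {} \<Longrightarrow> t \<in> faces S"
    "\<And>s. s \<in> faces S \<Longrightarrow> \<exists>t\<in>triangles S. s \<subseteq> t"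
    using m unfolding two_manifold_def is_complex_def by blast+
  show ?thesis
  proof
    have "pos S \<subseteq> \<Union> (faces S) \<times> \<Union> (faces S) \<times> \<Union> (faces S)"
    proof
      fix x assume "x \<in> pos S"
      moreover obtain a b c where "x = (a, b, c)" by (cases x)
      ultimately have "x = (a, b, c)" "{a, b, c} \<in> faces S"
        using o1(1) by (auto simp: triangles_def)
      then show "x \<in> \<Union> (faces S) \<times> \<Union> (faces S) \<times> \<Union> (faces S)"
        by (auto intro!: UnionI[of "{a, b, c}"])
    qed
    moreover have "finite (\<Union> (faces S))"
      using k(1,2) by auto
    ultimately show "finite (pos S)"
      by (meson finite_SigmaI finite_subset)
  next
    show "faces S = {s. s \<noteq> {} \<and> (\<exists>a b c. (a, b, c) \<in> pos S \<and> s \<subseteq> {a, b, c})}"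
    proof (intro equalityI subsetI CollectI conjI)
      fix s assume s: "s \<in> faces S"
      show "s \<noteq> {}" using k(2) s by blast
      obtain t where t: "t \<in> triangles S" "s \<subseteq> t" using k(4) s by blast
      then obtain a b c where abc: "t = {a, b, c}"
        unfolding triangles_def by (auto simp: card_3_iff)
      then consider "(a, b, c) \<in> pos S" | "(a, c, b) \<in> pos S" using o2[of a b c] t(1) by auto
      then show "\<exists>a b c. (a, b, c) \<in> pos S \<and> s \<subseteq> {a, b, c}"
        using t(2) abc by cases blast+
    next
      fix s assume "s \<in> {s. s \<noteq> {} \<and> (\<exists>a b c. (a, b, c) \<in> pos S \<and> s \<subseteq> {a, b, c})}"
      then obtain a b c where "s \<noteq> {}" "(a, b, c) \<in> pos S" "s \<subseteq> {a, b, c}" by blast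
      then show "s \<in> faces S"
        using o1(1) k(3) unfolding triangles_def by blast
    qed
  next
    show "(b, c, a) \<in> pos S" if "(a, b, c) \<in> pos S" for a b c
      using o1(2)[OF that] .
    show "c = d" if "(a, b, c) \<in> pos S" "(a, b, d) \<in> pos S" for a b c d
      using o3[OF that] .
    show "(a, c, b) \<notin> pos S" if "(a, b, c) \<in> pos S" for a b c
      using o2[OF o1(1)[OF that]] that by simp
  qed
qed

section \<open>Barycentric subdivision\<close>

abbreviation (input) sd_six :: "nat \<times> nat \<times> nat \<Rightarrow> (nat \<times> nat \<times> nat) set" where
  "sd_six \<equiv> \<lambda>(a, b, c). {(bary {a}, bary {a, b}, bary {a, b, c}), (bary {a, b}, bary {a, b, c}, bary {a}),
     (bary {a, b, c}, bary {a}, bary {a, b}), (bary {b}, bary {a, b, c}, bary {a, b}),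
     (bary {a, b, c}, bary {a, b}, bary {b}), (bary {a, b}, bary {b}, bary {a, b, c})}"

lemma pos_sd: "pos (sd T) = (\<Union>x\<in>pos T. sd_six x)"
  by (auto simp: sd_def Let_def)


lemma bary_eq: "finite A \<Longrightarrow> finite B \<Longrightarrow> bary A = bary B \<longleftrightarrow> A = B"
  by (rule set_encode_eq)

lemma bary_simps [simp]:
  "bary {a} = bary {b} \<longleftrightarrow> a = b"
  "bary {a} = bary {b, c} \<longleftrightarrow> a = b \<and> a = c"
  "bary {b, c} = bary {a} \<longleftrightarrow> b = a \<and> c = a"
  "bary {a, b} = bary {c, d} \<longleftrightarrow> a = c \<and> b = d \<or> a = d \<and> b = c"
  "bary {a} = bary {b, c, d} \<longleftrightarrow> a = b \<and> a = c \<and> a = d"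
  "bary {b, c, d} = bary {a} \<longleftrightarrow> b = a \<and> c = a \<and> d = a"
  by (auto simp: bary_eq doubleton_eq_iff)

context tri_surf
begin

lemma bary_pos_simps [simp]:
  assumes "(a, b, c) \<in> pos T"
  shows "bary {a, b, c} \<noteq> bary {x, y}" "bary {x, y} \<noteq> bary {a, b, c}"
proof -
  have "card {a, b, c} = 3" using pos_distinct[OF assms] by simp
  moreover have "card {x, y} \<le> 2" by (simp add: card_insert_le_m1)
  ultimately show "bary {a, b, c} \<noteq> bary {x, y}" "bary {x, y} \<noteq> bary {a, b, c}"
    by (auto simp: bary_eq)
qed

lemma bary_pos_eq:
  assumes "(a, b, c) \<in> pos T" "(a', b', c') \<in> pos T"
  shows "bary {a, b, c} = bary {a', b', c'} \<longleftrightarrow>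
    (a' = a \<and> b' = b \<and> c' = c \<or> a' = b \<and> b' = c \<and> c' = a \<or> a' = c \<and> b' = a \<and> c' = b)"
  using pos_eq_of_set[OF assms] by (auto simp: bary_eq)

lemma sd_pos_cases:
  assumes "(p, q, r) \<in> pos (sd T)"
  obtains a b c where "(a, b, c) \<in> pos T" "p = bary {a}" "q = bary {a, b}" "r = bary {a, b, c}"
  | a b c where "(a, b, c) \<in> pos T" "p = bary {a, b}" "q = bary {a, b, c}" "r = bary {a}"
  | a b c where "(a, b, c) \<in> pos T" "p = bary {a, b, c}" "q = bary {a}" "r = bary {a, b}"
  | a b c where "(a, b, c) \<in> pos T" "p = bary {b}" "q = bary {a, b, c}" "r = bary {a, b}"
  | a b c where "(a, b, c) \<in> pos T" "p = bary {a, b, c}" "q = bary {a, b}" "r = bary {b}"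
  | a b c where "(a, b, c) \<in> pos T" "p = bary {a, b}" "q = bary {b}" "r = bary {a, b, c}"
  using assms unfolding pos_sd by auto

lemma sd_posI:
  assumes "(a, b, c) \<in> pos T"
  shows "(bary {a}, bary {a, b}, bary {a, b, c}) \<in> pos (sd T)"
    "(bary {a, b}, bary {a, b, c}, bary {a}) \<in> pos (sd T)"
    "(bary {a, b, c}, bary {a}, bary {a, b}) \<in> pos (sd T)"
    "(bary {b}, bary {a, b, c}, bary {a, b}) \<in> pos (sd T)"
    "(bary {a, b, c}, bary {a, b}, bary {b}) \<in> pos (sd T)"
    "(bary {a, b}, bary {b}, bary {a, b, c}) \<in> pos (sd T)"
  unfolding pos_sd by (rule UN_I[OF assms], simp)+

lemma sd_pos_rot: "(p, q, r) \<in> pos (sd T) \<Longrightarrow> (q, r, p) \<in> pos (sd T)"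
  by (erule sd_pos_cases) (auto intro: sd_posI)

lemma sd_pos_vm: "(bary {a}, bary {a, b}, r) \<in> pos (sd T) \<longleftrightarrow>
    (\<exists>c. (a, b, c) \<in> pos T \<and> r = bary {a, b, c})"
proof
  assume *: "(bary {a}, bary {a, b}, r) \<in> pos (sd T)"
  then show "\<exists>c. (a, b, c) \<in> pos T \<and> r = bary {a, b, c}"
    by (cases rule: sd_pos_cases) (auto dest: pos_distinct)
qed (auto intro: sd_posI)

lemma sd_pos_mv: "(bary {a, b}, bary {a}, r) \<in> pos (sd T) \<longleftrightarrow>
    (\<exists>c. (b, a, c) \<in> pos T \<and> r = bary {a, b, c})"
proof
  assume *: "(bary {a, b}, bary {a}, r) \<in> pos (sd T)"
  then show "\<exists>c. (b, a, c) \<in> pos T \<and> r = bary {a, b, c}"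
    by (cases rule: sd_pos_cases) (auto dest: pos_distinct simp: insert_commute)
qed (use sd_posI(6)[of b a] in \<open>auto simp: insert_commute\<close>)

lemma sd_pos_vz:
  assumes "(a, b, c) \<in> pos T"
  shows "(bary {a}, bary {a, b, c}, r) \<in> pos (sd T) \<longleftrightarrow> r = bary {a, c}"
proof
  assume *: "(bary {a}, bary {a, b, c}, r) \<in> pos (sd T)"
  then show "r = bary {a, c}"
    by (cases rule: sd_pos_cases)
      (use assms pos_distinct[OF assms] in \<open>auto simp: bary_pos_eq insert_commute dest: pos_distinct\<close>)
qed (use sd_posI(4)[OF rot2[OF assms]] in \<open>auto simp: insert_commute\<close>)

lemma sd_pos_zv:
  assumes "(a, b, c) \<in> pos T"
  shows "(bary {a, b, c}, bary {a}, r) \<in> pos (sd T) \<longleftrightarrow> r = bary {a, b}"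
proof
  assume *: "(bary {a, b, c}, bary {a}, r) \<in> pos (sd T)"
  then show "r = bary {a, b}"
    by (cases rule: sd_pos_cases)
      (use assms pos_distinct[OF assms] in \<open>auto simp: bary_pos_eq insert_commute dest: pos_distinct\<close>)
qed (use sd_posI(3)[OF assms] in \<open>auto simp: insert_commute\<close>)

lemma sd_pos_mz:
  assumes "(a, b, c) \<in> pos T"
  shows "(bary {a, b}, bary {a, b, c}, r) \<in> pos (sd T) \<longleftrightarrow> r = bary {a}"
proof
  assume *: "(bary {a, b}, bary {a, b, c}, r) \<in> pos (sd T)"
  then show "r = bary {a}"
    by (cases rule: sd_pos_cases)
      (use assms pos_distinct[OF assms] in \<open>auto simp: bary_pos_eq insert_commute dest: pos_distinct\<close>)
qed (use sd_posI(2)[OF assms] in \<open>auto simp: insert_commute\<close>)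

lemma sd_pos_zm:
  assumes "(a, b, c) \<in> pos T"
  shows "(bary {a, b, c}, bary {a, b}, r) \<in> pos (sd T) \<longleftrightarrow> r = bary {b}"
proof
  assume *: "(bary {a, b, c}, bary {a, b}, r) \<in> pos (sd T)"
  then show "r = bary {b}"
    by (cases rule: sd_pos_cases)
      (use assms pos_distinct[OF assms] in \<open>auto simp: bary_pos_eq insert_commute dest: pos_distinct\<close>)
qed (use sd_posI(5)[OF assms] in \<open>auto simp: insert_commute\<close>)

lemma sd_pos_uniq:
  assumes "(p, q, r) \<in> pos (sd T)" "(p, q, r') \<in> pos (sd T)"
  shows "r = r'"
  using assms(1)
proof (cases rule: sd_pos_cases)
  case (1 a b c)
  with assms(2) obtain c' where "(a, b, c') \<in> pos T" "r' = bary {a, b, c'}"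
    by (auto simp: sd_pos_vm)
  with 1 show ?thesis using uniq[of a b c c'] by simp
next
  case (2 a b c)
  with assms(2) show ?thesis by (simp add: sd_pos_mz)
next
  case (3 a b c)
  with assms(2) show ?thesis by (simp add: sd_pos_zv)
next
  case (4 a b c)
  have "q = bary {b, c, a}" "r = bary {b, a}"
    using 4 by (simp_all add: insert_commute)
  with 4 assms(2) show ?thesis using sd_pos_vz[OF rot[OF 4(1)]] by metis
next
  case (5 a b c)
  with assms(2) show ?thesis by (simp add: sd_pos_zm)
next
  case (6 a b c)
  have "p = bary {b, a}" using 6 by (simp add: insert_commute)
  with 6 assms(2) obtain c' where "(a, b, c') \<in> pos T" "r' = bary {b, a, c'}"
    using sd_pos_mv[of b a r'] by auto
  with 6 show ?thesis using uniq[of a b c c'] by (simp add: insert_commute)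
qed

lemma sd_pos_anti:
  assumes "(p, q, r) \<in> pos (sd T)"
  shows "(p, r, q) \<notin> pos (sd T)"
  using assms
proof (cases rule: sd_pos_cases)
  case (1 a b c)
  then show ?thesis
    using sd_pos_vz[OF 1(1), of q] pos_distinct[OF 1(1)] by auto
next
  case (2 a b c)
  show ?thesis
  proof
    assume "(p, r, q) \<in> pos (sd T)"
    then obtain d where d: "(b, a, d) \<in> pos T" "bary {a, b, c} = bary {a, b, d}"
      using 2 sd_pos_mv[of a b q] by auto
    then have "c = d"
      using pos_distinct[OF 2(1)] by (auto simp: bary_eq)
    then show False using d anti2[OF 2(1)] by simp
  qed
next
  case (3 a b c)
  then show ?thesis
    using sd_pos_zm[OF 3(1), of q] pos_distinct[OF 3(1)] by auto
next
  case (4 a b c)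
  show ?thesis
  proof
    assume "(p, r, q) \<in> pos (sd T)"
    then obtain d where d: "(b, a, d) \<in> pos T" "bary {a, b, c} = bary {b, a, d}"
      using 4 sd_pos_vm[of b a q] by (auto simp: insert_commute)
    then have "c = d"
      using pos_distinct[OF 4(1)] by (auto simp: bary_eq)
    then show False using d anti2[OF 4(1)] by simp
  qed
next
  case (5 a b c)
  have "p = bary {b, c, a}" using 5 by (simp add: insert_commute)
  then show ?thesis
    using 5 sd_pos_zv[OF rot[OF 5(1)], of q] pos_distinct[OF 5(1)] by auto
next
  case (6 a b c)
  then show ?thesis
    using sd_pos_mz[OF 6(1), of q] pos_distinct[OF 6(1)] by auto
qed

end


context tri_surf
begin

lemma finite_faces: "finite (faces T)"
proof -
  have "faces T \<subseteq> (\<Union>(a, b, c)\<in>pos T. Pow {a, b, c})"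
    unfolding faces_pos by fast
  moreover have "finite (\<Union>(a, b, c)\<in>pos T. Pow {a, b, c})"
    using finite_pos by auto
  ultimately show ?thesis by (rule finite_subset)
qed

lemma chain_in_flag:
  assumes C: "C \<subseteq> faces T" "C \<noteq> {}" and chain: "\<And>s t. s \<in> C \<Longrightarrow> t \<in> C \<Longrightarrow> s \<subseteq> t \<or> t \<subseteq> s"
  obtains a b c where "(a, b, c) \<in> pos T" "C \<subseteq> {{a}, {a, b}, {a, b, c}} \<or> C \<subseteq> {{b}, {a, b}, {a, b, c}}"
proof -
  have fin: "finite C" using C(1) finite_faces finite_subset by blast
  obtain s0 where s0: "s0 \<in> C" "\<And>s. s \<in> C \<Longrightarrow> s \<subseteq> s0 \<Longrightarrow> s0 = s"
    using finite_has_minimal[OF fin C(2)] by metis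
  obtain s1 where s1: "s1 \<in> C" "\<And>s. s \<in> C \<Longrightarrow> s1 \<subseteq> s \<Longrightarrow> s1 = s"
    using finite_has_maximal[OF fin C(2)] by metis
  have low: "s0 \<subseteq> s" and up: "s \<subseteq> s1" if "s \<in> C" for s
    using chain[OF that s0(1)] chain[OF that s1(1)] s0(2) s1(2) that by auto
  obtain x y z where xyz: "(x, y, z) \<in> pos T" "s1 \<subseteq> {x, y, z}"
    using s1(1) C(1) unfolding faces_pos by blast
  obtain a where a: "a \<in> s0"
    using s0(1) C(1) unfolding faces_pos by blast
  then have "a = x \<or> a = y \<or> a = z"
    using low[OF s1(1)] xyz(2) by blast
  then have "\<exists>b c. (a, b, c) \<in> pos T \<and> {x, y, z} = {a, b, c}"
  proof (elim disjE)
    assume "a = x" then show ?thesis using xyz(1) by blast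
  next
    assume "a = y" then show ?thesis using rot[OF xyz(1)] by (intro exI[of _ z] exI[of _ x]) auto
  next
    assume "a = z" then show ?thesis using rot2[OF xyz(1)] by (intro exI[of _ x] exI[of _ y]) auto
  qed
  then obtain b c where abc: "(a, b, c) \<in> pos T" "{x, y, z} = {a, b, c}" by blast
  have el: "s = {a} \<or> s = {a, b} \<or> s = {a, c} \<or> s = {a, b, c}" if "s \<in> C" for s
  proof -
    have "a \<in> s" "s \<subseteq> {a, b, c}" using low[OF that] up[OF that] a xyz abc by auto
    then show ?thesis by blast
  qed
  have "b \<noteq> c" "a \<noteq> b" "a \<noteq> c" using pos_distinct[OF abc(1)] by auto
  then have "{a, b} \<notin> C \<or> {a, c} \<notin> C"
    using chain[of "{a, b}" "{a, c}"] by auto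
  then show ?thesis
  proof
    assume "{a, c} \<notin> C"
    then show ?thesis using that[OF abc(1)] el by blast
  next
    assume "{a, b} \<notin> C"
    then have "C \<subseteq> {{a}, {c, a}, {c, a, b}}" using el by (auto simp: insert_commute)
    then show ?thesis using that[OF rot2[OF abc(1)]] by blast
  qed
qed

lemma flag_in_faces:
  assumes "(a, b, c) \<in> pos T"
  shows "{{a}, {a, b}, {a, b, c}} \<subseteq> faces T" "{{b}, {a, b}, {a, b, c}} \<subseteq> faces T"
  using assms unfolding faces_pos by blast+

lemma sd_faces_pos:
  "faces (sd T) = {s. s \<noteq> {} \<and> (\<exists>p q r. (p, q, r) \<in> pos (sd T) \<and> s \<subseteq> {p, q, r})}"
proof (intro equalityI subsetI CollectI)
  fix s assume "s \<in> faces (sd T)"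
  then obtain C where C: "s = bary ` C" "C \<subseteq> faces T" "C \<noteq> {}"
      "\<forall>s\<in>C. \<forall>t\<in>C. s \<subseteq> t \<or> t \<subseteq> s"
    unfolding sd_def by auto
  obtain a b c where abc: "(a, b, c) \<in> pos T" "C \<subseteq> {{a}, {a, b}, {a, b, c}} \<or> C \<subseteq> {{b}, {a, b}, {a, b, c}}"
    using chain_in_flag[OF C(2,3)] C(4) by blast
  from abc(2) have "s \<subseteq> {bary {a}, bary {a, b}, bary {a, b, c}} \<or> s \<subseteq> {bary {b}, bary {a, b, c}, bary {a, b}}"
    unfolding C(1) by blast
  then show "s \<noteq> {} \<and> (\<exists>p q r. (p, q, r) \<in> pos (sd T) \<and> s \<subseteq> {p, q, r})"
    using C(1,3) sd_posI(1,4)[OF abc(1)] by blast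
next
  fix s assume "s \<in> {s. s \<noteq> {} \<and> (\<exists>p q r. (p, q, r) \<in> pos (sd T) \<and> s \<subseteq> {p, q, r})}"
  then obtain p q r where s: "s \<noteq> {}" "(p, q, r) \<in> pos (sd T)" "s \<subseteq> {p, q, r}" by blast
  from s(2) obtain a b c where abc: "(a, b, c) \<in> pos T"
    "{p, q, r} = bary ` {{a}, {a, b}, {a, b, c}} \<or> {p, q, r} = bary ` {{b}, {a, b}, {a, b, c}}"
    by (cases rule: sd_pos_cases) (auto simp: insert_commute)
  then obtain C where C: "s = bary ` C" "C \<subseteq> {{a}, {a, b}, {a, b, c}} \<or> C \<subseteq> {{b}, {a, b}, {a, b, c}}"
    using s(3) by (metis subset_image_iff)
  have "C \<subseteq> faces T" using C(2) flag_in_faces[OF abc(1)] by blast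
  moreover have "C \<noteq> {}" using s(1) C(1) by blast
  moreover have "\<forall>s\<in>C. \<forall>t\<in>C. s \<subseteq> t \<or> t \<subseteq> s" using C(2) by auto
  ultimately show "s \<in> faces (sd T)"
    unfolding sd_def using C(1) by auto
qed

lemma tri_surf_sd: "tri_surf (sd T)"
proof
  show "finite (pos (sd T))"
    unfolding pos_sd using finite_pos by auto
next
  show "(b, c, a) \<in> pos (sd T)" if "(a, b, c) \<in> pos (sd T)" for a b c
    using sd_pos_rot[OF that] .
  show "c = d" if "(a, b, c) \<in> pos (sd T)" "(a, b, d) \<in> pos (sd T)" for a b c d
    using sd_pos_uniq[OF that] .
  show "(a, c, b) \<notin> pos (sd T)" if "(a, b, c) \<in> pos (sd T)" for a b c
    using sd_pos_anti[OF that] .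
  show "faces (sd T) = {s. s \<noteq> {} \<and> (\<exists>a b c. (a, b, c) \<in> pos (sd T) \<and> s \<subseteq> {a, b, c})}"
    by (rule sd_faces_pos)
qed

lemma sum_pos_sd:
  "(\<Sum>(p, q, r)\<in>pos (sd T). h p q r) = (\<Sum>(a, b, c)\<in>pos T.
     h (bary {a}) (bary {a, b}) (bary {a, b, c}) + h (bary {a, b}) (bary {a, b, c}) (bary {a}) +
     h (bary {a, b, c}) (bary {a}) (bary {a, b}) + h (bary {b}) (bary {a, b, c}) (bary {a, b}) +
     h (bary {a, b, c}) (bary {a, b}) (bary {b}) + h (bary {a, b}) (bary {b}) (bary {a, b, c}))"
  (is "_ = (\<Sum>(a, b, c)\<in>pos T. ?six a b c)")
  for h :: "nat \<Rightarrow> nat \<Rightarrow> nat \<Rightarrow> 'a :: comm_monoid_add"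
proof -
  have inj: "a = a' \<and> b = b' \<and> c = c'"
    if "(a, b, c) \<in> pos T" "(a', b', c') \<in> pos T" "y \<in> sd_six (a, b, c)" "y \<in> sd_six (a', b', c')"
    for a b c a' b' c' y
  proof -
    note d = pos_distinct[OF that(1)] pos_distinct[OF that(2)]
      anti[OF that(1)] anti2[OF that(1)] anti[OF rot[OF that(1)]]
    have r: "bary {a, b, c} = bary {a', b', c'} \<Longrightarrow>
      a' = a \<and> b' = b \<and> c' = c \<or> a' = b \<and> b' = c \<and> c' = a \<or> a' = c \<and> b' = a \<and> c' = b"
      using bary_pos_eq[OF that(1,2)] by blast
    show ?thesis
      using that(3,4) unfolding prod.case insert_iff empty_iff
      by (elim disjE; simp only: prod.inject bary_simps bary_pos_simps[OF that(1)] bary_pos_simps[OF that(2)] d simp_thms HOL.False_implies_equals)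
        (use d r in auto)
  qed
  have "(\<Sum>(p, q, r)\<in>pos (sd T). h p q r) = (\<Sum>x\<in>pos T. \<Sum>(p, q, r)\<in>sd_six x. h p q r)"
    unfolding pos_sd
  proof (rule sum.UNION_disjoint)
    show "\<forall>i\<in>pos T. \<forall>j\<in>pos T. i \<noteq> j \<longrightarrow> sd_six i \<inter> sd_six j = {}"
    proof (intro ballI impI)
      fix i j assume ij: "i \<in> pos T" "j \<in> pos T" "i \<noteq> j"
      obtain a b c a' b' c' where "i = (a, b, c)" "j = (a', b', c')"
        by (cases i; cases j)
      then show "sd_six i \<inter> sd_six j = {}" using ij inj[of a b c a' b' c'] by blast
    qed
  qed (use finite_pos in auto)
  also have "\<dots> = (\<Sum>(a, b, c)\<in>pos T. ?six a b c)"
  proof (rule sum.cong[OF refl])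
    fix x assume x: "x \<in> pos T"
    obtain a b c where abc: "x = (a, b, c)" by (cases x)
    show "(\<Sum>(p, q, r)\<in>sd_six x. h p q r) = (case x of (a, b, c) \<Rightarrow> ?six a b c)"
      using x pos_distinct[of a b c] by (simp add: abc add.assoc)
  qed
  finally show ?thesis .
qed

end


section \<open>Potentials and their pairing\<close>

text \<open>The values of \<open>F\<close> at \<open>v\<close> on the two sides of the edge \<open>vu\<close>; on the outside of a boundary edge
  the value is 0.\<close>

definition after :: "surf \<Rightarrow> (nat \<Rightarrow> nat set \<Rightarrow> int) \<Rightarrow> nat \<Rightarrow> nat \<Rightarrow> int" where
  "after T F v u = (\<Sum>(a, b, c)\<in>pos T. F a {a, b, c} * of_bool (v = a \<and> u = b))"

definition before :: "surf \<Rightarrow> (nat \<Rightarrow> nat set \<Rightarrow> int) \<Rightarrow> nat \<Rightarrow> nat \<Rightarrow> int" where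
  "before T F v u = (\<Sum>(a, b, c)\<in>pos T. F a {a, b, c} * of_bool (v = a \<and> u = c))"

definition potential :: "surf \<Rightarrow> (nat \<Rightarrow> nat set \<Rightarrow> int) \<Rightarrow> (nat \<times> nat \<Rightarrow> int) \<Rightarrow> bool" where
  "potential T F y \<longleftrightarrow> (\<forall>v u. y (v, u) = after T F v u - before T F v u)"

definition pairing_at :: "surf \<Rightarrow> (nat \<Rightarrow> nat set \<Rightarrow> int) \<Rightarrow> (nat \<times> nat \<Rightarrow> int) \<Rightarrow> nat \<Rightarrow> int" where
  "pairing_at T G x v = (\<Sum>(a, b, c)\<in>pos T. of_bool (a = v) * (G a {a, b, c} * (x (a, b) + x (a, c))))"

definition pairing :: "surf \<Rightarrow> (nat \<Rightarrow> nat set \<Rightarrow> int) \<Rightarrow> (nat \<times> nat \<Rightarrow> int) \<Rightarrow> int" where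
  "pairing T G x = (\<Sum>(a, b, c)\<in>pos T. G a {a, b, c} * (x (a, b) + x (a, c)))"

definition antisym_chain :: "(nat \<times> nat \<Rightarrow> int) \<Rightarrow> bool" where
  "antisym_chain z \<longleftrightarrow> (\<forall>a b. z (b, a) = - z (a, b))"

lemma antisym_chainD: "antisym_chain z \<Longrightarrow> z (b, a) = - z (a, b)"
  unfolding antisym_chain_def by blast

lemma arc_chain_swap: "arc_chain p (b, a) = - arc_chain p (a, b)"
  by (cases p) (simp add: arc_chain_def conj_commute)

context tri_surf
begin

lemma pairing_sum: "pairing T G x = (\<Sum>v\<in>verts T. pairing_at T G x v)"
proof -
  have "(\<Sum>v\<in>verts T. pairing_at T G x v) = (\<Sum>(a, b, c)\<in>pos T. \<Sum>v\<in>verts T.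
      of_bool (a = v) * (G a {a, b, c} * (x (a, b) + x (a, c))))"
    unfolding pairing_at_def by (subst sum.swap) (simp add: split_def)
  also have "\<dots> = pairing T G x"
    unfolding pairing_def
  proof (rule sum.cong[OF refl])
    fix y assume "y \<in> pos T"
    moreover obtain a b c where "y = (a, b, c)" by (cases y)
    ultimately show "(case y of (a, b, c) \<Rightarrow> \<Sum>v\<in>verts T.
        of_bool (a = v) * (G a {a, b, c} * (x (a, b) + x (a, c)))) =
      (case y of (a, b, c) \<Rightarrow> G a {a, b, c} * (x (a, b) + x (a, c)))"
      using pos_verts[of a b c] finite_verts
      by (simp add: of_bool_def if_distrib[of "\<lambda>t. t * _"] cong: if_cong)
  qed
  finally show ?thesis by simp
qed

lemma after_sum: "after T F v u = (\<Sum>c | (v, u, c) \<in> pos T. F v {v, u, c})"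
proof -
  have "(\<Sum>c | (v, u, c) \<in> pos T. F v {v, u, c}) = (\<Sum>(a, b, c)\<in>{(a, b, c). (a, b, c) \<in> pos T \<and> v = a \<and> u = b}. F a {a, b, c})"
    by (rule sum.reindex_bij_witness[of _ "\<lambda>(a, b, c). c" "\<lambda>c. (v, u, c)"]) auto
  also have "\<dots> = after T F v u"
    unfolding after_def by (rule sum.mono_neutral_cong_left) (use finite_pos in auto)
  finally show ?thesis by simp
qed

lemma before_sum: "before T F v u = (\<Sum>c | (v, c, u) \<in> pos T. F v {v, c, u})"
proof -
  have "(\<Sum>c | (v, c, u) \<in> pos T. F v {v, c, u}) = (\<Sum>(a, b, c)\<in>{(a, b, c). (a, b, c) \<in> pos T \<and> v = a \<and> u = c}. F a {a, b, c})"
    by (rule sum.reindex_bij_witness[of _ "\<lambda>(a, b, c). b" "\<lambda>c. (v, c, u)"]) auto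
  also have "\<dots> = before T F v u"
    unfolding before_def by (rule sum.mono_neutral_cong_left) (use finite_pos in auto)
  finally show ?thesis by simp
qed

lemma after_eq: "(v, u, c) \<in> pos T \<Longrightarrow> after T F v u = F v {v, u, c}"
proof -
  assume *: "(v, u, c) \<in> pos T"
  then have "{c. (v, u, c) \<in> pos T} = {c}" using uniq by fast
  then show ?thesis by (simp add: after_sum)
qed

lemma before_eq: "(v, c, u) \<in> pos T \<Longrightarrow> before T F v u = F v {v, c, u}"
proof -
  assume *: "(v, c, u) \<in> pos T"
  then have "{c. (v, c, u) \<in> pos T} = {c}" using uniq_prev by fast
  then show ?thesis by (simp add: before_sum)
qed

lemma after_none: "(\<And>c. (v, u, c) \<notin> pos T) \<Longrightarrow> after T F v u = 0"
  by (simp add: after_sum)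

lemma before_none: "(\<And>c. (v, c, u) \<notin> pos T) \<Longrightarrow> before T F v u = 0"
  by (simp add: before_sum)

lemma pos_rot_iff: "(b, c, a) \<in> pos T \<longleftrightarrow> (a, b, c) \<in> pos T"
  using rot[of a b c] rot2[of b c a] by blast

lemma potential_boundary: "potential T (\<lambda>v. f) (boundary2 T f)"
proof -
  have "{c. (b, a, c) \<in> pos T} = {c. (a, c, b) \<in> pos T}" for a b
    using pos_rot_iff by blast
  then show ?thesis
    unfolding potential_def boundary2_def after_sum before_sum
    by (simp add: insert_commute)
qed

lemma potential_add: "potential T F x \<Longrightarrow> potential T G y \<Longrightarrow>
    potential T (\<lambda>v t. F v t + G v t) (\<lambda>e. x e + y e)"
  unfolding potential_def after_sum before_sum by (simp add: sum.distrib)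

lemma pairing_at_antisym:
  assumes F: "potential T F x" and G: "potential T G y"
  shows "pairing_at T G x v = - pairing_at T F y v"
proof -
  define K where "K = {(b, c). (v, b, c) \<in> pos T}"
  have fK: "finite K"
    unfolding K_def by (rule finite_subset[of _ "snd ` pos T"]) (use finite_pos in force)+
  have at: "pairing_at T H w v = (\<Sum>(b, c)\<in>K. H v {v, b, c} * (w (v, b) + w (v, c)))" for H w
  proof -
    have "pairing_at T H w v = (\<Sum>(a, b, c)\<in>{(a, b, c). (a, b, c) \<in> pos T \<and> a = v}. H a {a, b, c} * (w (a, b) + w (a, c)))"
      unfolding pairing_at_def by (rule sum.mono_neutral_cong_right) (use finite_pos in auto)
    also have "\<dots> = (\<Sum>(b, c)\<in>K. H v {v, b, c} * (w (v, b) + w (v, c)))"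
      unfolding K_def by (rule sum.reindex_bij_witness[of _ "\<lambda>(b, c). (v, b, c)" snd]) auto
    finally show ?thesis .
  qed
  have af: "after T H v u = (\<Sum>(b, c)\<in>K. of_bool (b = u) * H v {v, b, c})" for H u
  proof -
    have "(\<Sum>c | (v, u, c) \<in> pos T. H v {v, u, c}) = (\<Sum>(b, c)\<in>{(b, c). (b, c) \<in> K \<and> b = u}. H v {v, b, c})"
      by (rule sum.reindex_bij_witness[of _ snd "\<lambda>c. (u, c)"]) (auto simp: K_def)
    also have "\<dots> = (\<Sum>(b, c)\<in>K. of_bool (b = u) * H v {v, b, c})"
      by (rule sum.mono_neutral_cong_left) (use fK in auto)
    finally show ?thesis by (simp add: after_sum)
  qed
  have be: "before T H v u = (\<Sum>(b, c)\<in>K. of_bool (c = u) * H v {v, b, c})" for H u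
  proof -
    have "(\<Sum>c | (v, c, u) \<in> pos T. H v {v, c, u}) = (\<Sum>(b, c)\<in>{(b, c). (b, c) \<in> K \<and> c = u}. H v {v, b, c})"
      by (rule sum.reindex_bij_witness[of _ fst "\<lambda>c. (c, u)"]) (auto simp: K_def)
    also have "\<dots> = (\<Sum>(b, c)\<in>K. of_bool (c = u) * H v {v, b, c})"
      by (rule sum.mono_neutral_cong_left) (use fK in auto)
    finally show ?thesis by (simp add: before_sum)
  qed
  have form: "pairing_at T H w v = (\<Sum>(b, c)\<in>K. \<Sum>(b', c')\<in>K.
      H v {v, b, c} * F' v {v, b', c'} * (of_bool (b' = c) - of_bool (c' = b)))"
    if F': "potential T F' w" for H F' w
  proof -
    have "pairing_at T H w v = (\<Sum>(b, c)\<in>K. H v {v, b, c} * (after T F' v c - before T F' v b))"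
      unfolding at
    proof (rule sum.cong[OF refl])
      fix p assume p: "p \<in> K"
      obtain b c where "p = (b, c)" by (cases p)
      with p F' after_eq[of v b c F'] before_eq[of v b c F']
      show "(case p of (b, c) \<Rightarrow> H v {v, b, c} * (w (v, b) + w (v, c))) =
        (case p of (b, c) \<Rightarrow> H v {v, b, c} * (after T F' v c - before T F' v b))"
        by (simp add: K_def potential_def)
    qed
    also have "\<dots> = (\<Sum>(b, c)\<in>K. \<Sum>(b', c')\<in>K.
      H v {v, b, c} * F' v {v, b', c'} * (of_bool (b' = c) - of_bool (c' = b)))"
      unfolding af be
      by (simp add: split_def sum_distrib_left right_diff_distrib sum_subtractf mult.commute mult.left_commute)
    finally show ?thesis .
  qed
  have "pairing_at T G x v = (\<Sum>(b, c)\<in>K. \<Sum>(b', c')\<in>K.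
      G v {v, b, c} * F v {v, b', c'} * (of_bool (b' = c) - of_bool (c' = b)))"
    by (rule form[OF F])
  also have "\<dots> = (\<Sum>(b, c)\<in>K. \<Sum>(b', c')\<in>K.
      G v {v, b', c'} * F v {v, b, c} * (of_bool (b = c') - of_bool (c = b')))"
    unfolding split_def by (rule sum.swap)
  also have "\<dots> = - pairing_at T F y v"
    unfolding form[OF G] split_def
    by (simp add: sum_negf[symmetric] algebra_simps eq_commute)
  finally show ?thesis .
qed

lemma pairing_antisym:
  "potential T F x \<Longrightarrow> potential T G y \<Longrightarrow> pairing T G x = - pairing T F y"
  unfolding pairing_sum by (simp add: pairing_at_antisym[of F x G y] sum_negf)

lemma pairing_boundary:
  assumes "antisym_chain y"
  shows "pairing T (\<lambda>v. f) y = 0"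
proof -
  have "(\<Sum>(a, b, c)\<in>pos T. f {a, b, c} * y (a, c)) = (\<Sum>(a, b, c)\<in>pos T. f {a, b, c} * y (b, a))"
    using sum_rot[of "\<lambda>a b c. f {a, b, c} * y (a, c)"] by (simp add: insert_commute)
  also have "\<dots> = (\<Sum>(a, b, c)\<in>pos T. - (f {a, b, c} * y (a, b)))"
    by (rule sum.cong[OF refl], clarify, subst antisym_chainD[OF assms]) simp
  finally show ?thesis
    unfolding pairing_def split_def by (simp add: distrib_left sum.distrib sum_negf)
qed

lemma pairing_add: "pairing T G (\<lambda>e. x e + y e) = pairing T G x + pairing T G y"
  unfolding pairing_def split_def sum.distrib[symmetric] by (simp add: algebra_simps)

lemma potential_sum:
  assumes "potential T F z"
  shows "(\<Sum>(a, b)\<in>{(a, b). {a, b} \<in> edges T}. z (a, b) * k a b) =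
    (\<Sum>(a, b, c)\<in>pos T. F a {a, b, c} * (k a b - k a c))"
proof -
  let ?E = "{(a, b). {a, b} \<in> edges T}"
  have "(\<Sum>(a, b)\<in>?E. z (a, b) * k a b) = (\<Sum>e\<in>?E. \<Sum>x\<in>pos T.
      F (fst x) {fst x, fst (snd x), snd (snd x)} *
      (of_bool (e = (fst x, fst (snd x))) - of_bool (e = (fst x, snd (snd x)))) * k (fst e) (snd e))"
  proof (rule sum.cong[OF refl])
    fix e assume "e \<in> ?E"
    obtain a b where e: "e = (a, b)" by (cases e)
    have "z (a, b) = (\<Sum>x\<in>pos T. F (fst x) {fst x, fst (snd x), snd (snd x)} *
      (of_bool (e = (fst x, fst (snd x))) - of_bool (e = (fst x, snd (snd x)))))"
      using assms unfolding potential_def after_def before_def split_def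
      by (simp add: e right_diff_distrib sum_subtractf)
    then show "(case e of (a, b) \<Rightarrow> z (a, b) * k a b) = (\<Sum>x\<in>pos T.
      F (fst x) {fst x, fst (snd x), snd (snd x)} *
      (of_bool (e = (fst x, fst (snd x))) - of_bool (e = (fst x, snd (snd x)))) * k (fst e) (snd e))"
      by (simp add: e sum_distrib_right)
  qed
  also have "\<dots> = (\<Sum>x\<in>pos T. \<Sum>e\<in>?E.
      F (fst x) {fst x, fst (snd x), snd (snd x)} *
      (of_bool (e = (fst x, fst (snd x))) - of_bool (e = (fst x, snd (snd x)))) * k (fst e) (snd e))"
    by (rule sum.swap)
  also have "\<dots> = (\<Sum>(a, b, c)\<in>pos T. F a {a, b, c} * (k a b - k a c))"
  proof (rule sum.cong[OF refl])
    fix x assume x: "x \<in> pos T"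
    obtain a b c where abc: "x = (a, b, c)" by (cases x)
    have ed: "(a, b) \<in> ?E" "(a, c) \<in> ?E"
      using tri_edges[of a b c] x abc by auto
    have "(\<Sum>e\<in>?E. F a {a, b, c} * (of_bool (e = (a, b)) - of_bool (e = (a, c))) * k (fst e) (snd e)) =
      (\<Sum>e\<in>?E. (if e = (a, b) then F a {a, b, c} * k a b else 0)) - (\<Sum>e\<in>?E. (if e = (a, c) then F a {a, b, c} * k a c else 0))"
      unfolding sum_subtractf[symmetric] by (rule sum.cong) (auto simp: algebra_simps)
    also have "\<dots> = F a {a, b, c} * (k a b - k a c)"
      using ed finite_edge_pairs by (simp add: sum.delta right_diff_distrib)
    finally show "(\<Sum>e\<in>?E. F (fst x) {fst x, fst (snd x), snd (snd x)} *
      (of_bool (e = (fst x, fst (snd x))) - of_bool (e = (fst x, snd (snd x)))) * k (fst e) (snd e)) =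
      (case x of (a, b, c) \<Rightarrow> F a {a, b, c} * (k a b - k a c))"
      unfolding abc by simp
  qed
  finally show ?thesis .
qed

lemma sum_edges_antisym:
  assumes "antisym_chain z"
  shows "(\<Sum>(a, b)\<in>{(a, b). {a, b} \<in> edges T}. z (a, b) * k a b) =
    (\<Sum>(a, b)\<in>{(a, b). a < b \<and> {a, b} \<in> edges T}. z (a, b) * (k a b - k b a))"
proof -
  let ?E = "{(a, b). {a, b} \<in> edges T}"
  let ?U = "{(a, b). a < b \<and> {a, b} \<in> edges T}" and ?D = "{(a, b). b < a \<and> {a, b} \<in> edges T}"
  have "a < b \<or> b < a" if "{a, b} \<in> edges T" for a b
    using edge_neq[OF that] by linarith
  then have "?E = ?U \<union> ?D" "?U \<inter> ?D = {}"
    by (blast, auto)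
  moreover have "finite ?U" "finite ?D"
    by (rule finite_subset[OF _ finite_edge_pairs]; auto)+
  ultimately have "(\<Sum>(a, b)\<in>?E. z (a, b) * k a b) = (\<Sum>(a, b)\<in>?U. z (a, b) * k a b) + (\<Sum>(a, b)\<in>?D. z (a, b) * k a b)"
    by (simp add: sum.union_disjoint)
  moreover have "(\<Sum>(a, b)\<in>?D. z (a, b) * k a b) = (\<Sum>(a, b)\<in>?U. z (b, a) * k b a)"
    by (rule sum.reindex_bij_witness[of _ "\<lambda>(a, b). (b, a)" "\<lambda>(a, b). (b, a)"]) (auto simp: insert_commute)
  moreover have "\<dots> = (\<Sum>(a, b)\<in>?U. - (z (a, b) * k b a))"
    by (rule sum.cong[OF refl], clarify, subst antisym_chainD[OF assms]) simp
  ultimately show ?thesis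
    by (simp add: split_def right_diff_distrib sum_subtractf sum_negf)
qed

lemma sd_chain_ordered:
  assumes "antisym_chain z"
  shows "sd_chain T z e = (\<Sum>(a, b)\<in>{(a, b). {a, b} \<in> edges T}. z (a, b) * arc_chain (bary {a}, bary {a, b}) e)"
  unfolding sum_edges_antisym[OF assms] sd_chain_def
  by (rule sum.cong) (auto simp: arc_chain_def insert_commute)

lemma sum_edges_single:
  assumes "{a, b} \<in> edges T"
  shows "(\<Sum>(a', b')\<in>{(a, b). {a, b} \<in> edges T}. z (a', b') * of_bool (a' = a \<and> b' = b)) = (z (a, b) :: int)"
proof -
  have "(\<Sum>(a', b')\<in>{(a, b). {a, b} \<in> edges T}. z (a', b') * of_bool (a' = a \<and> b' = b)) =
    (\<Sum>e\<in>{(a, b). {a, b} \<in> edges T}. if e = (a, b) then z (a, b) else 0)"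
    by (rule sum.cong) auto
  then show ?thesis using assms finite_edge_pairs by simp
qed

lemma sd_chain_vm:
  assumes "antisym_chain z" "{a, b} \<in> edges T"
  shows "sd_chain T z (bary {a}, bary {a, b}) = z (a, b)" "sd_chain T z (bary {a, b}, bary {a}) = - z (a, b)"
proof -
  have "sd_chain T z (bary {a}, bary {a, b}) =
      (\<Sum>(a', b')\<in>{(a, b). {a, b} \<in> edges T}. z (a', b') * of_bool (a' = a \<and> b' = b))"
    unfolding sd_chain_ordered[OF assms(1)]
    by (rule sum.cong) (use edge_neq[OF assms(2)] in \<open>auto simp: arc_chain_def dest: edge_neq\<close>)
  then show "sd_chain T z (bary {a}, bary {a, b}) = z (a, b)"
    using sum_edges_single[OF assms(2)] by simp
  have "sd_chain T z (bary {a, b}, bary {a}) =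
      (\<Sum>(a', b')\<in>{(a, b). {a, b} \<in> edges T}. (- z (a', b')) * of_bool (a' = a \<and> b' = b))"
    unfolding sd_chain_ordered[OF assms(1)]
    by (rule sum.cong) (use edge_neq[OF assms(2)] in \<open>auto simp: arc_chain_def dest: edge_neq\<close>)
  then show "sd_chain T z (bary {a, b}, bary {a}) = - z (a, b)"
    using sum_edges_single[OF assms(2), of "\<lambda>e. - z e"] by simp
qed

lemma antisym_sd_chain: "antisym_chain (sd_chain T z)"
  unfolding antisym_chain_def
proof (intro allI)
  fix a b
  have *: "arc_chain p (b, a) = - arc_chain p (a, b)" for p
    by (rule arc_chain_swap)
  show "sd_chain T z (b, a) = - sd_chain T z (a, b)"
    unfolding sd_chain_def split_def sum_negf[symmetric]
    by (rule sum.cong[OF refl]) (simp only: *, simp add: algebra_simps)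
qed

lemma sd_chain_z:
  assumes "antisym_chain z" "(a, b, c) \<in> pos T"
  shows "sd_chain T z (p, bary {a, b, c}) = 0" "sd_chain T z (bary {a, b, c}, p) = 0"
proof -
  show "sd_chain T z (bary {a, b, c}, p) = 0"
    unfolding sd_chain_ordered[OF assms(1)]
    by (rule sum.neutral) (use assms(2) pos_distinct[OF assms(2)] in \<open>auto simp: arc_chain_def\<close>)
  then show "sd_chain T z (p, bary {a, b, c}) = 0"
    using antisym_sd_chain[of z] unfolding antisym_chain_def by (metis minus_zero)
qed

lemma boundary2_sum: "boundary2 T f e = (\<Sum>(a, b, c)\<in>pos T. f {a, b, c} * arc_chain (a, b) e)"
proof -
  obtain v u where e: "e = (v, u)" by (cases e)
  have "boundary2 T f e = after T (\<lambda>v. f) v u - before T (\<lambda>v. f) v u"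
    using potential_boundary[of f] by (simp add: potential_def e)
  moreover have "before T (\<lambda>v. f) v u = (\<Sum>(a, b, c)\<in>pos T. f {a, b, c} * of_bool (v = b \<and> u = a))"
    unfolding before_def using sum_rot[of "\<lambda>a b c. f {a, b, c} * of_bool (v = a \<and> u = c)"] by (simp add: insert_commute)
  ultimately show ?thesis
    unfolding after_def e arc_chain_def split_def
    by (simp add: sum_subtractf[symmetric] algebra_simps)
qed

end


definition supp :: "nat set \<Rightarrow> nat set" where
  "supp \<tau> = \<Union> (set_decode ` \<tau>)"

definition apex :: "nat set \<Rightarrow> nat" where
  "apex \<tau> = the_elem (\<Inter> (set_decode ` \<tau>))"

text \<open>Near an old vertex the subdivided potential is the old one. At the midpoint of an edge it has to jump by the
  flow along the edge, which the corners at either end of the edge do; \<open>Min\<close> chooses an end.\<close>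

definition sd_potential :: "(nat \<Rightarrow> nat set \<Rightarrow> int) \<Rightarrow> nat \<Rightarrow> nat set \<Rightarrow> int" where
  "sd_potential F p \<tau> = (if card (set_decode p) \<le> 2 then F (Min (set_decode p)) (supp \<tau>) else 0)"

text \<open>\<open>d (a, b)\<close> is the flow of the dual chain across \<open>ab\<close> from left to right.\<close>

definition dual_chain :: "surf \<Rightarrow> (nat \<times> nat \<Rightarrow> int) \<Rightarrow> nat \<times> nat \<Rightarrow> int" where
  "dual_chain T d e = (\<Sum>(a, b, c)\<in>pos T. d (a, b) * arc_chain (bary {a, b, c}, bary {a, b}) e)"

text \<open>The corner of \<open>F\<close> at \<open>v\<close> between \<open>b\<close> and \<open>c\<close> pushes the path from \<open>c\<close> over \<open>v\<close> to \<open>b\<close> across the triangle;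
  this is the flow across \<open>ab\<close> of the resulting dual chain.\<close>

definition cocycle_of :: "surf \<Rightarrow> (nat \<Rightarrow> nat set \<Rightarrow> int) \<Rightarrow> nat \<times> nat \<Rightarrow> int" where
  "cocycle_of T F = (\<lambda>(a, b). after T F a b - before T F b a)"

definition cocycle :: "surf \<Rightarrow> (nat \<times> nat \<Rightarrow> int) \<Rightarrow> bool" where
  "cocycle T d \<longleftrightarrow> antisym_chain d \<and> (\<forall>a b c. (a, b, c) \<in> pos T \<longrightarrow> d (a, b) + d (b, c) + d (c, a) = 0) \<and>
     (\<forall>a b. d (a, b) \<noteq> 0 \<longrightarrow> (\<exists>c. (a, b, c) \<in> pos T) \<and> (\<exists>c. (b, a, c) \<in> pos T))"

lemma supp_flag [simp]:
  "supp {bary {a}, bary {a, b}, bary {a, b, c}} = {a, b, c}"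
  "supp {bary {a, b}, bary {a, b, c}, bary {a}} = {a, b, c}"
  "supp {bary {a, b, c}, bary {a}, bary {a, b}} = {a, b, c}"
  "supp {bary {b}, bary {a, b, c}, bary {a, b}} = {a, b, c}"
  "supp {bary {a, b, c}, bary {a, b}, bary {b}} = {a, b, c}"
  "supp {bary {a, b}, bary {b}, bary {a, b, c}} = {a, b, c}"
  by (auto simp: supp_def)

lemma apex_flag [simp]:
  "apex {bary {a}, bary {a, b}, bary {a, b, c}} = a"
  "apex {bary {a, b}, bary {a, b, c}, bary {a}} = a"
  "apex {bary {a, b, c}, bary {a}, bary {a, b}} = a"
  "apex {bary {b}, bary {a, b, c}, bary {a, b}} = b"
  "apex {bary {a, b, c}, bary {a, b}, bary {b}} = b"
  "apex {bary {a, b}, bary {b}, bary {a, b, c}} = b"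
proof -
  have *: "apex {p, q, r} = x" if "set_decode p \<inter> (set_decode q \<inter> set_decode r) = {x}" for p q r x
    using that by (simp add: apex_def)
  show "apex {bary {a}, bary {a, b}, bary {a, b, c}} = a"
    "apex {bary {a, b}, bary {a, b, c}, bary {a}} = a"
    "apex {bary {a, b, c}, bary {a}, bary {a, b}} = a"
    "apex {bary {b}, bary {a, b, c}, bary {a, b}} = b"
    "apex {bary {a, b, c}, bary {a, b}, bary {b}} = b"
    "apex {bary {a, b}, bary {b}, bary {a, b, c}} = b"
    by (rule *, force)+
qed

lemma arc_chain_rev: "arc_chain (q, p) e = - arc_chain (p, q) e"
  by (simp add: arc_chain_def)

lemma sum_triples_cong:
  assumes "\<And>a b c. (a, b, c) \<in> P \<Longrightarrow> f a b c = g a b c"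
  shows "(\<Sum>(a, b, c)\<in>P. f a b c) = (\<Sum>(a, b, c)\<in>P. g a b c)"
  by (rule sum.cong[OF refl]) (use assms in \<open>simp add: split_def\<close>)

lemma sum_triples_add:
  "(\<Sum>(a, b, c)\<in>P. f a b c + g a b c) = (\<Sum>(a, b, c)\<in>P. f a b c) + (\<Sum>(a, b, c)\<in>P. g a b c)"
  for f :: "'a \<Rightarrow> 'b \<Rightarrow> 'c \<Rightarrow> int"
  by (simp add: split_def sum.distrib)

lemma sum_triples_diff:
  "(\<Sum>(a, b, c)\<in>P. f a b c - g a b c) = (\<Sum>(a, b, c)\<in>P. f a b c) - (\<Sum>(a, b, c)\<in>P. g a b c)"
  for f :: "'a \<Rightarrow> 'b \<Rightarrow> 'c \<Rightarrow> int"
  by (simp add: split_def sum_subtractf)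

context tri_surf
begin

lemma sd_potential_flag:
  assumes "(a, b, c) \<in> pos T"
  shows "supp \<tau> = {a, b, c} \<Longrightarrow> sd_potential F (bary {x}) \<tau> = F x {a, b, c}"
    "supp \<tau> = {a, b, c} \<Longrightarrow> sd_potential F (bary {x, y}) \<tau> = F (min x y) {a, b, c}"
    "sd_potential F (bary {a, b, c}) \<tau> = 0"
  using pos_distinct[OF assms] by (auto simp: sd_potential_def card_insert_if)

lemma rot_potential:
  "(\<Sum>(a, b, c)\<in>pos T. F a {a, b, c} * k a b c) = (\<Sum>(a, b, c)\<in>pos T. F b {a, b, c} * k b c a)"
  using sum_rot[of "\<lambda>a b c. F a {a, b, c} * k a b c"] by (simp add: insert_commute)

lemma sum_upper:
  assumes F: "potential T F z" and K: "\<And>a b. K b a = - K a b"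
  shows "(\<Sum>(a, b)\<in>{(a, b). a < b \<and> {a, b} \<in> edges T}. z (a, b) * K a b) =
    (\<Sum>(a, b, c)\<in>pos T. F (min a b) {a, b, c} * K a b)"
proof -
  have "(\<Sum>(a, b)\<in>{(a, b). a < b \<and> {a, b} \<in> edges T}. z (a, b) * K a b) =
    (\<Sum>(a, b)\<in>{(a, b). {a, b} \<in> edges T}. z (a, b) * (of_bool (a < b) * K a b))"
    by (rule sum.mono_neutral_cong_left[OF finite_edge_pairs]) auto
  also have "\<dots> = (\<Sum>(a, b, c)\<in>pos T. F a {a, b, c} * (of_bool (a < b) * K a b - of_bool (a < c) * K a c))"
    by (rule potential_sum[OF F])
  also have "\<dots> = (\<Sum>(a, b, c)\<in>pos T. F a {a, b, c} * (of_bool (a < b) * K a b)) -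
      (\<Sum>(a, b, c)\<in>pos T. F b {a, b, c} * (of_bool (b < a) * K b a))"
    using rot_potential[of F "\<lambda>a b c. of_bool (a < c) * K a c"]
    by (simp only: right_diff_distrib sum_triples_diff)
  also have "\<dots> = (\<Sum>(a, b, c)\<in>pos T. F (min a b) {a, b, c} * K a b)"
    unfolding sum_triples_diff[symmetric]
  proof (rule sum_triples_cong)
    fix a b c assume "(a, b, c) \<in> pos T"
    then have "a < b \<or> b < a" using pos_distinct(1) by (metis linorder_neqE_nat)
    then show "F a {a, b, c} * (of_bool (a < b) * K a b) - F b {a, b, c} * (of_bool (b < a) * K b a) =
      F (min a b) {a, b, c} * K a b"
      using K[of a b] by auto
  qed
  finally show ?thesis .
qed

lemma sd_chain_min:
  assumes "potential T F z"
  shows "sd_chain T z e = (\<Sum>(a, b, c)\<in>pos T. F (min a b) {a, b, c} *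
    (arc_chain (bary {a}, bary {a, b}) e + arc_chain (bary {a, b}, bary {b}) e))"
  unfolding sd_chain_def
  by (rule sum_upper[OF assms]) (simp add: arc_chain_def insert_commute)

lemma sum_edges_potential:
  assumes F: "potential T F z"
  shows "(\<Sum>(a, b)\<in>{(a, b). {a, b} \<in> edges T}. z (a, b) * k a b) =
    (\<Sum>(a, b, c)\<in>pos T. F a {a, b, c} * k a b) - (\<Sum>(a, b, c)\<in>pos T. F b {a, b, c} * k b a)"
  unfolding potential_sum[OF F] using rot_potential[of F "\<lambda>a b c. k a c"]
  by (simp only: right_diff_distrib sum_triples_diff)

lemma potential_sd:
  assumes F: "potential T F z" and z: "antisym_chain z"
  shows "potential (sd T) (sd_potential F) (sd_chain T z)"
  unfolding potential_def
proof (intro allI)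
  fix v u
  define o' :: "nat \<Rightarrow> nat \<Rightarrow> int" where "o' = (\<lambda>p q. of_bool (v = p \<and> u = q))"
  let ?F = "sd_potential F"
  have "after (sd T) ?F v u - before (sd T) ?F v u =
      (\<Sum>(p, q, r)\<in>pos (sd T). ?F p {p, q, r} * (o' p q - o' p r))"
    by (simp only: after_def before_def o'_def right_diff_distrib sum_triples_diff)
  also have "\<dots> = (\<Sum>(a, b, c)\<in>pos T.
      F a {a, b, c} * (o' (bary {a}) (bary {a, b})) - F b {a, b, c} * o' (bary {b}) (bary {a, b})
      - (F a {a, b, c} * o' (bary {a}) (bary {a, b, c}) - F b {a, b, c} * o' (bary {b}) (bary {a, b, c}))
      - F (min a b) {a, b, c} * (o' (bary {a, b}) (bary {a}) - o' (bary {a, b}) (bary {b})))"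
    unfolding sum_pos_sd
    by (rule sum_triples_cong) (simp add: sd_potential_flag algebra_simps)
  also have "\<dots> = (\<Sum>(a, b, c)\<in>pos T. F a {a, b, c} * o' (bary {a}) (bary {a, b}))
      - (\<Sum>(a, b, c)\<in>pos T. F b {a, b, c} * o' (bary {b}) (bary {a, b}))
      - (\<Sum>(a, b, c)\<in>pos T. F (min a b) {a, b, c} * (o' (bary {a, b}) (bary {a}) - o' (bary {a, b}) (bary {b})))"
    using rot_potential[of F "\<lambda>a b c. o' (bary {a}) (bary {a, b, c})"]
    by (simp add: sum_triples_diff insert_commute)
  also have "(\<Sum>(a, b, c)\<in>pos T. F (min a b) {a, b, c} * (o' (bary {a, b}) (bary {a}) - o' (bary {a, b}) (bary {b})))
    = (\<Sum>(a, b)\<in>{(a, b). {a, b} \<in> edges T}. z (a, b) * o' (bary {a, b}) (bary {a}))"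
    unfolding sum_edges_antisym[OF z]
    by (subst sum_upper[OF F, symmetric]) (simp_all add: insert_commute)
  also have "(\<Sum>(a, b, c)\<in>pos T. F a {a, b, c} * o' (bary {a}) (bary {a, b}))
      - (\<Sum>(a, b, c)\<in>pos T. F b {a, b, c} * o' (bary {b}) (bary {a, b})) =
    (\<Sum>(a, b)\<in>{(a, b). {a, b} \<in> edges T}. z (a, b) * o' (bary {a}) (bary {a, b}))"
    by (subst sum_edges_potential[OF F]) (simp add: insert_commute)
  finally show "sd_chain T z (v, u) = after (sd T) ?F v u - before (sd T) ?F v u"
    unfolding sd_chain_ordered[OF z]
    by (simp add: o'_def arc_chain_def split_def right_diff_distrib sum_subtractf)
qed

lemma pairing_sd:
  assumes z: "antisym_chain z"
  shows "pairing (sd T) (sd_potential G) (sd_chain T z) = pairing T G z"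
proof -
  have "pairing (sd T) (sd_potential G) (sd_chain T z) = (\<Sum>(a, b, c)\<in>pos T.
      G a {a, b, c} * z (a, b) + G b {a, b, c} * z (b, a))"
    unfolding pairing_def sum_pos_sd
  proof (rule sum_triples_cong, goal_cases)
    case p: (1 a b c)
    have e: "{a, b} \<in> edges T" "{b, a} \<in> edges T"
      using tri_edges[OF p] by (auto simp: insert_commute)
    note * = sd_chain_vm[OF z e(1)] sd_chain_vm[OF z e(2), unfolded insert_commute[of b a]] sd_chain_z[OF z p]
    show ?case
      by (simp add: sd_potential_flag[OF p] * antisym_chainD[OF z, of b a] algebra_simps)
  qed
  also have "\<dots> = pairing T G z"
    unfolding pairing_def using rot_potential[of G "\<lambda>a b c. z (a, c)"]
    by (simp add: sum_triples_add distrib_left)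
  finally show ?thesis .
qed

lemma sd_chain_boundary:
  "sd_chain T (boundary2 T f) = boundary2 (sd T) (\<lambda>\<tau>. f (supp \<tau>))"
proof
  fix e
  have "boundary2 (sd T) (\<lambda>\<tau>. f (supp \<tau>)) e = (\<Sum>(a, b, c)\<in>pos T.
      f {a, b, c} * (arc_chain (bary {a}, bary {a, b}) e + arc_chain (bary {a, b}, bary {b}) e)
      - f {a, b, c} * arc_chain (bary {a}, bary {a, b, c}) e + f {a, b, c} * arc_chain (bary {b}, bary {a, b, c}) e)"
    unfolding tri_surf.boundary2_sum[OF tri_surf_sd] sum_pos_sd
    by (rule sum_triples_cong)
      (simp add: arc_chain_rev[of "bary {_, _, _}" "bary {_}"] arc_chain_rev[of "bary {_, _, _}" "bary {_, _}"] algebra_simps)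
  also have "\<dots> = sd_chain T (boundary2 T f) e"
    unfolding sd_chain_min[OF potential_boundary]
    using rot_potential[of "\<lambda>v. f" "\<lambda>a b c. arc_chain (bary {a}, bary {a, b, c}) e"]
    by (simp add: sum_triples_add sum_triples_diff insert_commute)
  finally show "sd_chain T (boundary2 T f) e = boundary2 (sd T) (\<lambda>\<tau>. f (supp \<tau>)) e" by simp
qed

lemma cocycle_of_pos:
  "(a, b, c) \<in> pos T \<Longrightarrow> cocycle_of T F (a, b) = F a {a, b, c} - F b {a, b, c}"
  using after_eq[of a b c F] before_eq[of b c a F] rot[of a b c]
  by (simp add: cocycle_of_def insert_commute)

lemma cocycle_cocycle_of:
  assumes F: "potential T F z" and z: "antisym_chain z"
  shows "cocycle T (cocycle_of T F)"
  unfolding cocycle_def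
proof (intro conjI allI impI)
  have eq: "after T F a b - before T F a b = - (after T F b a - before T F b a)" for a b
    using F antisym_chainD[OF z, of a b] by (simp add: potential_def)
  show "antisym_chain (cocycle_of T F)"
    unfolding antisym_chain_def cocycle_of_def using eq by (simp add: algebra_simps)
  show "cocycle_of T F (a, b) + cocycle_of T F (b, c) + cocycle_of T F (c, a) = 0"
    if p: "(a, b, c) \<in> pos T" for a b c
    using cocycle_of_pos[OF p, of F] cocycle_of_pos[OF rot[OF p], of F] cocycle_of_pos[OF rot2[OF p], of F]
    by (simp add: insert_commute)
  have A: "\<exists>c. (a, b, c) \<in> pos T" if "cocycle_of T F (a, b) \<noteq> 0" for a b
  proof (rule ccontr)
    assume *: "\<nexists>c. (a, b, c) \<in> pos T"
    then have "after T F a b = 0" by (intro after_none) simp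
    moreover have "before T F b a = 0"
      by (intro before_none) (use * rot2 in blast)
    ultimately show False using that by (simp add: cocycle_of_def)
  qed
  show "\<exists>c. (a, b, c) \<in> pos T" if "cocycle_of T F (a, b) \<noteq> 0" for a b
    by (rule A[OF that])
  show "\<exists>c. (b, a, c) \<in> pos T" if "cocycle_of T F (a, b) \<noteq> 0" for a b
    using A[of b a] that antisym_chainD[OF \<open>antisym_chain (cocycle_of T F)\<close>, of a b] by simp
qed

lemma dual_homologous:
  assumes F: "potential T F z" and z: "antisym_chain z"
  shows "sd_chain T z e = dual_chain T (cocycle_of T F) e + boundary2 (sd T) (\<lambda>\<tau>. F (apex \<tau>) (supp \<tau>)) e"
proof -
  have "boundary2 (sd T) (\<lambda>\<tau>. F (apex \<tau>) (supp \<tau>)) e = (\<Sum>(a, b, c)\<in>pos T.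
      F a {a, b, c} * arc_chain (bary {a}, bary {a, b}) e - F b {a, b, c} * arc_chain (bary {b}, bary {a, b}) e
      - F a {a, b, c} * arc_chain (bary {a}, bary {a, b, c}) e + F b {a, b, c} * arc_chain (bary {b}, bary {a, b, c}) e
      - cocycle_of T F (a, b) * arc_chain (bary {a, b, c}, bary {a, b}) e)"
    unfolding tri_surf.boundary2_sum[OF tri_surf_sd] sum_pos_sd
    by (rule sum_triples_cong)
      (simp add: cocycle_of_pos arc_chain_rev[of "bary {_, _, _}" "bary {_}"]
        arc_chain_rev[of "bary {_, _}" "bary {_, _, _}"] arc_chain_rev[of "bary {_, _}" "bary {_}"] algebra_simps)
  also have "\<dots> = (\<Sum>(a, b, c)\<in>pos T. F a {a, b, c} * arc_chain (bary {a}, bary {a, b}) e)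
      - (\<Sum>(a, b, c)\<in>pos T. F b {a, b, c} * arc_chain (bary {b}, bary {a, b}) e)
      - dual_chain T (cocycle_of T F) e"
    using rot_potential[of F "\<lambda>a b c. arc_chain (bary {a}, bary {a, b, c}) e"]
    by (simp add: sum_triples_add sum_triples_diff dual_chain_def insert_commute)
  also have "(\<Sum>(a, b, c)\<in>pos T. F a {a, b, c} * arc_chain (bary {a}, bary {a, b}) e)
      - (\<Sum>(a, b, c)\<in>pos T. F b {a, b, c} * arc_chain (bary {b}, bary {a, b}) e) = sd_chain T z e"
    unfolding sd_chain_ordered[OF z]
    by (subst sum_edges_potential[OF F]) (simp add: insert_commute)
  finally show ?thesis by simp
qed

lemma sum_pos_antisym:
  fixes k :: "nat \<Rightarrow> nat \<Rightarrow> int"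
  assumes k: "\<And>a b. k b a = - k a b"
    and bd: "\<And>a b c. (a, b, c) \<in> pos T \<Longrightarrow> k a b \<noteq> 0 \<Longrightarrow> \<exists>c. (b, a, c) \<in> pos T"
  shows "(\<Sum>(a, b, c)\<in>pos T. k a b) = 0"
proof -
  let ?B = "{(a, b). (\<exists>c. (a, b, c) \<in> pos T) \<and> (\<exists>c. (b, a, c) \<in> pos T)}"
  have inj: "inj_on (\<lambda>(a, b, c). (a, b)) (pos T)"
    by (rule inj_onI) (use uniq in auto)
  have "(\<Sum>(a, b, c)\<in>pos T. k a b) = (\<Sum>(a, b)\<in>(\<lambda>(a, b, c). (a, b)) ` pos T. k a b)"
    by (subst sum.reindex[OF inj]) (simp add: split_def)
  also have "\<dots> = (\<Sum>(a, b)\<in>?B. k a b)"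
  proof (rule sum.mono_neutral_right)
    show "finite ((\<lambda>(a, b, c). (a, b)) ` pos T)" using finite_pos by simp
    show "?B \<subseteq> (\<lambda>(a, b, c). (a, b)) ` pos T" by force
    show "\<forall>i\<in>(\<lambda>(a, b, c). (a, b)) ` pos T - ?B. (case i of (a, b) \<Rightarrow> k a b) = 0"
      using bd by fastforce
  qed
  finally have 1: "(\<Sum>(a, b, c)\<in>pos T. k a b) = (\<Sum>(a, b)\<in>?B. k a b)" .
  have "(\<Sum>(a, b)\<in>?B. k a b) = (\<Sum>(a, b)\<in>?B. k b a)"
    by (rule sum.reindex_bij_witness[of _ "\<lambda>(a, b). (b, a)" "\<lambda>(a, b). (b, a)"]) auto
  also have "\<dots> = - (\<Sum>(a, b)\<in>?B. k a b)"
    unfolding sum_negf[symmetric] by (rule sum.cong[OF refl]) (simp add: split_def k[symmetric])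
  finally show ?thesis using 1 by simp
qed

lemma potential_dual_chain:
  assumes d: "antisym_chain d"
    and g1: "\<And>a. g {a} a = 0"
    and g2: "\<And>a b c. (a, b, c) \<in> pos T \<Longrightarrow> g {a, b} b - g {a, b} a = d (a, b)"
    and g3: "\<And>a b c. (a, b, c) \<in> pos T \<Longrightarrow> g {a, b, c} b - g {a, b, c} a = d (a, b)"
    and g0: "\<And>a b c. (a, b, c) \<in> pos T \<Longrightarrow> g {a, b} a \<noteq> 0 \<or> g {a, b} b \<noteq> 0 \<Longrightarrow> \<exists>c. (b, a, c) \<in> pos T"
  shows "potential (sd T) (\<lambda>p \<tau>. g (set_decode p) (apex \<tau>)) (dual_chain T d)"
  unfolding potential_def
proof (intro allI)
  fix v u
  define o' :: "nat \<Rightarrow> nat \<Rightarrow> int" where "o' = (\<lambda>p q. of_bool (v = p \<and> u = q))"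
  let ?F = "\<lambda>p \<tau>. g (set_decode p) (apex \<tau>)"
  have "after (sd T) ?F v u - before (sd T) ?F v u =
      (\<Sum>(p, q, r)\<in>pos (sd T). ?F p {p, q, r} * (o' p q - o' p r))"
    by (simp only: after_def before_def o'_def right_diff_distrib sum_triples_diff)
  also have "\<dots> = (\<Sum>(a, b, c)\<in>pos T. d (a, b) * (o' (bary {a, b, c}) (bary {a, b}) - o' (bary {a, b}) (bary {a, b, c}))
      + (g {a, b} b * o' (bary {a, b}) (bary {b}) - g {a, b} a * o' (bary {a, b}) (bary {a}))
      + (g {a, b, c} a * o' (bary {a, b, c}) (bary {a}) - g {a, b, c} b * o' (bary {a, b, c}) (bary {b})))"
    unfolding sum_pos_sd
  proof (rule sum_triples_cong, goal_cases)
    case (1 a b c)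
    have "g {a, b} b = g {a, b} a + d (a, b)" "g {a, b, c} b = g {a, b, c} a + d (a, b)"
      using g2[OF 1] g3[OF 1] by simp_all
    then show ?case by (simp add: g1 algebra_simps)
  qed
  also have "\<dots> = (\<Sum>(a, b, c)\<in>pos T. d (a, b) * (o' (bary {a, b, c}) (bary {a, b}) - o' (bary {a, b}) (bary {a, b, c})))
      + (\<Sum>(a, b, c)\<in>pos T. g {a, b} b * o' (bary {a, b}) (bary {b}) - g {a, b} a * o' (bary {a, b}) (bary {a}))
      + ((\<Sum>(a, b, c)\<in>pos T. g {a, b, c} a * o' (bary {a, b, c}) (bary {a})) -
         (\<Sum>(a, b, c)\<in>pos T. g {a, b, c} b * o' (bary {a, b, c}) (bary {b})))"
    by (simp only: sum_triples_add sum_triples_diff)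
  also have "(\<Sum>(a, b, c)\<in>pos T. g {a, b} b * o' (bary {a, b}) (bary {b}) - g {a, b} a * o' (bary {a, b}) (bary {a})) = 0"
  proof (rule sum_pos_antisym, goal_cases)
    case (2 a b c)
    then have "g {a, b} a \<noteq> 0 \<or> g {a, b} b \<noteq> 0" by auto
    then show ?case by (rule g0[OF 2(1)])
  qed (simp add: insert_commute)
  also have "(\<Sum>(a, b, c)\<in>pos T. g {a, b, c} a * o' (bary {a, b, c}) (bary {a})) =
         (\<Sum>(a, b, c)\<in>pos T. g {a, b, c} b * o' (bary {a, b, c}) (bary {b}))"
    using sum_rot[of "\<lambda>a b c. g {a, b, c} a * o' (bary {a, b, c}) (bary {a})"] by (simp add: insert_commute)
  finally show "dual_chain T d (v, u) = after (sd T) ?F v u - before (sd T) ?F v u"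
    by (simp add: dual_chain_def arc_chain_def o'_def split_def)
qed

lemma antisym_dual_chain: "antisym_chain (dual_chain T d)"
  unfolding antisym_chain_def
proof (intro allI)
  fix a b
  have *: "arc_chain p (b, a) = - arc_chain p (a, b)" for p
    by (rule arc_chain_swap)
  show "dual_chain T d (b, a) = - dual_chain T d (a, b)"
    unfolding dual_chain_def split_def sum_negf[symmetric]
    by (rule sum.cong[OF refl]) (simp add: *)
qed

end


section \<open>Homologous cycles\<close>

definition homologous :: "surf \<Rightarrow> (nat \<times> nat \<Rightarrow> int) \<Rightarrow> (nat \<times> nat \<Rightarrow> int) \<Rightarrow> bool" where
  "homologous T x y \<longleftrightarrow> (\<exists>f. \<forall>e. x e = y e + boundary2 T f e)"

lemma boundary2_add: "boundary2 T (\<lambda>t. f t + g t) e = boundary2 T f e + boundary2 T g e"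
  by (simp add: boundary2_def split_def sum.distrib)

lemma boundary2_minus: "boundary2 T (\<lambda>t. - f t) e = - boundary2 T f e"
  by (simp add: boundary2_def split_def sum_negf)

lemma boundary2_zero: "boundary2 T (\<lambda>t. 0) e = 0"
  by (simp add: boundary2_def split_def)

lemma homologous_refl: "homologous T x x"
  unfolding homologous_def by (rule exI[of _ "\<lambda>t. 0"]) (simp add: boundary2_zero)

lemma homologous_sym: "homologous T x y \<Longrightarrow> homologous T y x"
  unfolding homologous_def
proof (elim exE)
  fix f assume "\<forall>e. x e = y e + boundary2 T f e"
  then show "\<exists>f. \<forall>e. y e = x e + boundary2 T f e"
    by (intro exI[of _ "\<lambda>t. - f t"]) (simp add: boundary2_minus)
qed

lemma homologous_trans: "homologous T x y \<Longrightarrow> homologous T y z \<Longrightarrow> homologous T x z"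
  unfolding homologous_def
proof (elim exE)
  fix f g assume "\<forall>e. x e = y e + boundary2 T f e" "\<forall>e. y e = z e + boundary2 T g e"
  then show "\<exists>f. \<forall>e. x e = z e + boundary2 T f e"
    by (intro exI[of _ "\<lambda>t. f t + g t"]) (simp add: boundary2_add)
qed

lemma hclass_eq: "hclass T x = {\<lambda>e. boundary2 T f e + x e | f. True}"
  unfolding hclass_def r_coset_def cycle_group_def by auto

lemma hclass_iff: "hclass T x = hclass T y \<longleftrightarrow> homologous T x y"
proof
  assume "hclass T x = hclass T y"
  moreover have "x \<in> hclass T x"
    unfolding hclass_eq by (intro CollectI exI[of _ "\<lambda>t. 0"]) (simp add: boundary2_zero)
  ultimately obtain f where "x = (\<lambda>e. boundary2 T f e + y e)"
    unfolding hclass_eq by blast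
  then show "homologous T x y"
    unfolding homologous_def by (intro exI[of _ f]) simp
next
  have *: "hclass T x \<subseteq> hclass T y" if xy: "homologous T x y" for x y
  proof
    fix z assume "z \<in> hclass T x"
    then obtain f where f: "z = (\<lambda>e. boundary2 T f e + x e)" unfolding hclass_eq by blast
    obtain g where g: "\<forall>e. x e = y e + boundary2 T g e" using xy unfolding homologous_def by blast
    have "z = (\<lambda>e. boundary2 T (\<lambda>t. f t + g t) e + y e)"
      unfolding f by (rule ext) (simp add: g boundary2_add)
    then show "z \<in> hclass T y" unfolding hclass_eq by blast
  qed
  assume "homologous T x y"
  then show "hclass T x = hclass T y"
    using *[of x y] *[of y x] homologous_sym by blast
qed

lemma sd_chain_add: "sd_chain T (\<lambda>e. x e + y e) e = sd_chain T x e + sd_chain T y e"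
  by (simp add: sd_chain_def split_def distrib_right sum.distrib)

context tri_surf
begin

lemma homologous_sd:
  assumes "homologous T x y"
  shows "homologous (sd T) (sd_chain T x) (sd_chain T y)"
proof -
  obtain f where "x = (\<lambda>e. y e + boundary2 T f e)"
    using assms unfolding homologous_def by blast
  then have "sd_chain T x e = sd_chain T y e + boundary2 (sd T) (\<lambda>\<tau>. f (supp \<tau>)) e" for e
    using sd_chain_boundary[of f] by (simp add: sd_chain_add)
  then show ?thesis unfolding homologous_def by blast
qed

lemma potential_homologous:
  assumes "homologous T x y" "potential T F y"
  shows "\<exists>G. potential T G x"
proof -
  obtain f where "x = (\<lambda>e. y e + boundary2 T f e)"
    using assms unfolding homologous_def by blast
  then show ?thesis using potential_add[OF assms(2) potential_boundary] by blast
qed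

lemma pairing_homologous_left:
  assumes "homologous T x x'" "potential T G y" "antisym_chain y"
  shows "pairing T G x = pairing T G x'"
proof -
  obtain f where x: "x = (\<lambda>e. x' e + boundary2 T f e)"
    using assms unfolding homologous_def by blast
  have "pairing T G (boundary2 T f) = - pairing T (\<lambda>v. f) y"
    by (rule pairing_antisym[OF potential_boundary assms(2)])
  also have "\<dots> = 0" using pairing_boundary[OF assms(3)] by simp
  finally show ?thesis unfolding x pairing_add by simp
qed

lemma pairing_homologous:
  assumes "homologous T x x'" "homologous T y y'"
    and "potential T F x" "potential T F' x'" "potential T G y" "potential T G' y'"
    and "antisym_chain x'" "antisym_chain y"
  shows "pairing T G x = pairing T G' x'"
proof -
  have "pairing T G x = pairing T G x'"
    by (rule pairing_homologous_left[OF assms(1,5,8)])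
  also have "\<dots> = - pairing T F' y"
    by (rule pairing_antisym[OF assms(4,5)])
  also have "\<dots> = - pairing T F' y'"
    using pairing_homologous_left[OF assms(2,4,7)] by simp
  also have "\<dots> = pairing T G' x'"
    using pairing_antisym[OF assms(4,6)] by simp
  finally show ?thesis .
qed

lemma tri_surf_iter: "tri_surf ((sd ^^ m) T)"
proof (induction m)
  case 0
  show ?case by (simp add: tri_surf_axioms)
next
  case (Suc m)
  then show ?case using tri_surf.tri_surf_sd by simp
qed

lemma antisym_sd_chain_iter: "antisym_chain z \<Longrightarrow> antisym_chain (sd_chain_iter T m z)"
proof (induction m)
  case (Suc m)
  show ?case by (simp add: tri_surf.antisym_sd_chain[OF tri_surf_iter])
qed simp

lemma potential_sd_iter:
  assumes "potential T F z" "antisym_chain z"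
  shows "potential ((sd ^^ m) T) ((sd_potential ^^ m) F) (sd_chain_iter T m z)"
proof (induction m)
  case (Suc m)
  then show ?case
    using tri_surf.potential_sd[OF tri_surf_iter Suc antisym_sd_chain_iter[OF assms(2)]] by simp
qed (simp add: assms)

lemma pairing_sd_iter:
  assumes "antisym_chain z"
  shows "pairing ((sd ^^ m) T) ((sd_potential ^^ m) G) (sd_chain_iter T m z) = pairing T G z"
proof (induction m)
  case (Suc m)
  then show ?case
    using tri_surf.pairing_sd[OF tri_surf_iter antisym_sd_chain_iter[OF assms]] by simp
qed simp

text \<open>Divergences at \<open>v\<close>: a corner between consecutive neighbours \<open>a\<close> and \<open>b\<close> contributes the flow
  from \<open>b\<close> to \<open>a\<close>, so connectedness of the link makes every flow of total zero a divergence.\<close>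

definition local_flows :: "nat \<Rightarrow> (nat \<Rightarrow> int) set" where
  "local_flows v = {y. \<exists>f. \<forall>u. y u = after T (\<lambda>_. f) v u - before T (\<lambda>_. f) v u}"

lemma local_flowsI: "(\<And>u. y u = after T (\<lambda>_. f) v u - before T (\<lambda>_. f) v u) \<Longrightarrow> y \<in> local_flows v"
  unfolding local_flows_def by blast

lemma local_flows_zero: "(\<lambda>u. 0) \<in> local_flows v"
  by (rule local_flowsI[of _ "\<lambda>_. 0"]) (simp add: after_sum before_sum)

lemma local_flows_add:
  assumes y: "y \<in> local_flows v" "y' \<in> local_flows v"
  shows "(\<lambda>u. y u + k * y' u) \<in> local_flows v"
proof -
  obtain f f' where "\<forall>u. y u = after T (\<lambda>_. f) v u - before T (\<lambda>_. f) v u"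
    "\<forall>u. y' u = after T (\<lambda>_. f') v u - before T (\<lambda>_. f') v u"
    using y unfolding local_flows_def by blast
  moreover have "after T (\<lambda>_ t. f t + k * f' t) v u = after T (\<lambda>_. f) v u + k * after T (\<lambda>_. f') v u"
    "before T (\<lambda>_ t. f t + k * f' t) v u = before T (\<lambda>_. f) v u + k * before T (\<lambda>_. f') v u" for u
    by (simp_all add: after_sum before_sum sum.distrib sum_distrib_left)
  ultimately show ?thesis
    by (intro local_flowsI[of _ "\<lambda>t. f t + k * f' t"]) (simp add: right_diff_distrib)
qed

lemma local_flows_corner:
  assumes p: "(v, a, b) \<in> pos T"
  shows "(\<lambda>u. of_bool (u = a) - of_bool (u = b)) \<in> local_flows v"
proof (rule local_flowsI[of _ "\<lambda>t. of_bool (t = {v, a, b})"])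
  fix u
  have "after T (\<lambda>_ t. of_bool (t = {v, a, b})) v u = of_bool (u = a)"
  proof (cases "u = a")
    case True
    then show ?thesis using after_eq[OF p] by simp
  next
    case False
    have "{v, u, c} \<noteq> {v, a, b}" if q: "(v, u, c) \<in> pos T" for c
      using pos_eq_of_set[OF q p] False pos_distinct[OF p] by auto
    then show ?thesis using False unfolding after_sum by (intro sum.neutral trans[OF sum.neutral]) auto
  qed
  moreover have "before T (\<lambda>_ t. of_bool (t = {v, a, b})) v u = of_bool (u = b)"
  proof (cases "u = b")
    case True
    then show ?thesis using before_eq[OF p] by simp
  next
    case False
    have "{v, c, u} \<noteq> {v, a, b}" if q: "(v, c, u) \<in> pos T" for c
      using pos_eq_of_set[OF q p] False pos_distinct[OF p] by auto
    then show ?thesis using False unfolding before_sum by (intro sum.neutral trans[OF sum.neutral]) auto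
  qed
  ultimately show "of_bool (u = a) - of_bool (u = b) =
    after T (\<lambda>_ t. of_bool (t = {v, a, b})) v u - before T (\<lambda>_ t. of_bool (t = {v, a, b})) v u" by simp
qed

lemma local_flows_path:
  assumes "(x, y) \<in> {(a, b). {v, a, b} \<in> triangles T}\<^sup>*"
  shows "(\<lambda>u. of_bool (u = x) - of_bool (u = y)) \<in> local_flows v"
  using assms
proof (induction rule: rtrancl_induct)
  case base
  show ?case using local_flows_zero by simp
next
  case (step y w)
  have "(\<lambda>u. of_bool (u = y) - of_bool (u = w)) \<in> local_flows v"
  proof (cases "(v, y, w) \<in> pos T")
    case True
    then show ?thesis by (rule local_flows_corner)
  next
    case False
    then have "(v, w, y) \<in> pos T" using step(2) triangle_pos[of v y w] by simp
    then have "(\<lambda>u. of_bool (u = w) - of_bool (u = y)) \<in> local_flows v"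
      by (rule local_flows_corner)
    from local_flows_add[OF local_flows_zero this, of "-1"] show ?thesis by simp
  qed
  from local_flows_add[OF step(3) this, of 1] show ?case by simp
qed

end

lemma potential_exists:
  assumes S: "oriented_surface S" and z: "z \<in> cycles1 S"
  shows "\<exists>F. potential S F z"
proof -
  interpret tri_surf S by (rule tri_surf_of_oriented[OF S])
  have anti_z: "\<And>a b. z (b, a) = - z (a, b)" and off: "\<And>a b. {a, b} \<notin> edges S \<Longrightarrow> z (a, b) = 0"
    and cyc: "\<And>v. v \<in> verts S \<Longrightarrow> (\<Sum>u\<in>verts S. z (u, v)) = 0"
    using z unfolding cycles1_def by blast+
  have link: "(x, y) \<in> {(a, b). {v, a, b} \<in> triangles S}\<^sup>*" if "{v, x} \<in> edges S" "{v, y} \<in> edges S" for v x y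
    using S that unfolding oriented_surface_def two_manifold_def by blast
  have "\<exists>f. \<forall>u. z (v, u) = after S (\<lambda>_. f) v u - before S (\<lambda>_. f) v u" for v
  proof -
    define N where "N = {u. {v, u} \<in> edges S}"
    have finN: "finite N"
      unfolding N_def by (rule finite_subset[OF _ finite_verts]) (use edge_verts in auto)
    show ?thesis
    proof (cases "N = {}")
      case True
      then have "z (v, u) = 0" for u using off[of v u] by (auto simp: N_def)
      then have "z (v, u) = after S (\<lambda>_ _. 0) v u - before S (\<lambda>_ _. 0) v u" for u
        by (simp add: after_sum before_sum)
      then show ?thesis by blast
    next
      case False
      then obtain u0 where u0: "u0 \<in> N" by blast
      then have v: "v \<in> verts S" using edge_verts by (auto simp: N_def)
      have "(\<Sum>u\<in>N. z (v, u)) = (\<Sum>u\<in>verts S. z (v, u))"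
        by (rule sum.mono_neutral_left[OF finite_verts]) (use edge_verts off in \<open>auto simp: N_def\<close>)
      also have "\<dots> = - (\<Sum>u\<in>verts S. z (u, v))"
        unfolding sum_negf[symmetric] by (rule sum.cong[OF refl]) (rule anti_z)
      finally have sum0: "(\<Sum>u\<in>N. z (v, u)) = 0" using cyc[OF v] by simp
      have "(\<lambda>u. \<Sum>x\<in>A. z (v, x) * (of_bool (u = x) - of_bool (u = u0))) \<in> local_flows v" if "finite A" "A \<subseteq> N" for A
        using that
      proof (induction A)
        case empty
        show ?case using local_flows_zero by simp
      next
        case (insert x A)
        have "(x, u0) \<in> {(a, b). {v, a, b} \<in> triangles S}\<^sup>*"
          using link[of v x u0] u0 insert(4) by (auto simp: N_def)
        moreover have "(\<lambda>u. \<Sum>x\<in>A. z (v, x) * (of_bool (u = x) - of_bool (u = u0))) \<in> local_flows v"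
          using insert by simp
        ultimately have "(\<lambda>u. (\<Sum>x\<in>A. z (v, x) * (of_bool (u = x) - of_bool (u = u0))) +
            z (v, x) * (of_bool (u = x) - of_bool (u = u0))) \<in> local_flows v"
          by (intro local_flows_add local_flows_path)
        moreover have "(\<lambda>u. \<Sum>x\<in>insert x A. z (v, x) * (of_bool (u = x) - of_bool (u = u0))) =
          (\<lambda>u. (\<Sum>x\<in>A. z (v, x) * (of_bool (u = x) - of_bool (u = u0))) +
            z (v, x) * (of_bool (u = x) - of_bool (u = u0)))"
          using insert(1,2) by (simp add: add.commute)
        ultimately show ?case by simp
      qed
      from this[OF finN subset_refl]
      have "(\<lambda>u. \<Sum>x\<in>N. z (v, x) * (of_bool (u = x) - of_bool (u = u0))) \<in> local_flows v" .
      moreover have "(\<Sum>x\<in>N. z (v, x) * (of_bool (u = x) - of_bool (u = u0))) = z (v, u)" for u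
      proof -
        have "(\<Sum>x\<in>N. z (v, x) * (of_bool (u = x) - of_bool (u = u0))) =
          (\<Sum>x\<in>N. z (v, x) * of_bool (u = x)) - (\<Sum>x\<in>N. z (v, x)) * of_bool (u = u0)"
          by (simp add: right_diff_distrib sum_subtractf sum_distrib_right)
        also have "(\<Sum>x\<in>N. z (v, x) * of_bool (u = x)) = (\<Sum>x\<in>N. if u = x then z (v, x) else 0)"
          by (rule sum.cong) auto
        also have "\<dots> = z (v, u)"
          using finN off[of v u] by (simp add: sum.delta' N_def)
        finally show ?thesis using sum0 by simp
      qed
      ultimately show ?thesis unfolding local_flows_def by simp
    qed
  qed
  then obtain f where f: "\<forall>v u. z (v, u) = after S (\<lambda>_. f v) v u - before S (\<lambda>_. f v) v u" by metis
  have "after S (\<lambda>_. f v) v u = after S f v u" "before S (\<lambda>_. f v) v u = before S f v u" for v u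
    by (simp_all add: after_sum before_sum)
  then have "potential S f z" unfolding potential_def using f by simp
  then show ?thesis by blast
qed


section \<open>Refining a dual cocycle\<close>

definition midpoint :: "int set \<Rightarrow> int" where
  "midpoint L = (Min L + Max L) div 2"

lemma midpoint_shift:
  assumes "finite L" "L \<noteq> {}"
  shows "midpoint ((\<lambda>t. t - k) ` L) = midpoint L - k"
proof -
  have m: "mono (\<lambda>t. t - k)" by (simp add: mono_def)
  have "midpoint ((\<lambda>t. t - k) ` L) = (Min L + Max L - 2 * k) div 2"
    unfolding midpoint_def
    by (simp add: mono_Min_commute[OF m assms, symmetric] mono_Max_commute[OF m assms, symmetric] algebra_simps)
  then show ?thesis by (simp add: midpoint_def)
qed

lemma midpoint_diff:
  assumes L: "finite L'" "L \<subseteq> L'" "L \<noteq> {}" and M: "\<And>l l'. l \<in> L' \<Longrightarrow> l' \<in> L' \<Longrightarrow> l - l' \<le> M"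
  shows "\<bar>midpoint L - midpoint L'\<bar> \<le> (M + 1) div 2"
proof -
  have ne: "L' \<noteq> {}" using L by auto
  have "Min L' \<le> Min L" "Max L \<le> Max L'" using L by (auto intro: Min_antimono Max_mono)
  moreover have "Min L \<le> Max L" using finite_subset[OF L(2,1)] L(3) by (simp add: Max_ge_iff)
  moreover have "Max L' - Min L' \<le> M" using M L(1) ne by simp
  ultimately show ?thesis unfolding midpoint_def by linarith
qed

context tri_surf
begin

lemma cocycle_add:
  assumes d: "cocycle T d" and p: "(a, b, c) \<in> pos T" and "x \<in> {a, b, c}" "y \<in> {a, b, c}" "y' \<in> {a, b, c}"
  shows "d (x, y) = d (x, y') + d (y', y)"
proof -
  have as: "antisym_chain d" and sm: "d (a, b) + d (b, c) + d (c, a) = 0"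
    using d p unfolding cocycle_def by blast+
  have "d (b, a) = - d (a, b)" "d (c, b) = - d (b, c)" "d (a, c) = - d (c, a)" "d (a, a) = - d (a, a)"
    "d (b, b) = - d (b, b)" "d (c, c) = - d (c, c)"
    by (rule antisym_chainD[OF as])+
  then have "d (b, a) = - d (a, b)" "d (c, b) = - d (b, c)" "d (a, c) = - d (c, a)" "d (a, a) = 0"
    "d (b, b) = 0" "d (c, c) = 0" by simp_all
  then show ?thesis using assms(3-5) sm by auto
qed

text \<open>On each simplex \<open>d\<close> has a primitive; the new value on an edge of the subdivision is the difference of
  the midpoints of the ranges of the primitive on the two simplices. If \<open>d = 0\<close>, the constant \<open>\<kappa>\<close> makes the
  dual curve nonempty by adding small circles around the barycentres.\<close>

lemma refine_cocycle:
  assumes d: "cocycle T d" and M: "\<And>e. \<bar>d e\<bar> \<le> M" and ne: "pos T \<noteq> {}"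
  shows "\<exists>F. potential (sd T) F (dual_chain T d) \<and>
    (\<forall>e. \<bar>cocycle_of (sd T) F e\<bar> \<le> max 1 ((M + 1) div 2)) \<and> (\<exists>e. cocycle_of (sd T) F e \<noteq> 0)"
proof -
  define \<kappa> :: int where "\<kappa> = of_bool (\<forall>e. d e = 0)"
  define g where "g s a = (if card s = 3 then \<kappa> else 0) - midpoint ((\<lambda>y. d (a, y)) ` s)" for s a
  define F where "F p \<tau> = g (set_decode p) (apex \<tau>)" for p \<tau>
  have as: "antisym_chain d" and opp: "\<And>a b. d (a, b) \<noteq> 0 \<Longrightarrow> \<exists>c. (b, a, c) \<in> pos T"
    using d unfolding cocycle_def by blast+
  have d0: "d (a, a) = 0" for a using antisym_chainD[OF as, of a a] by simp
  have g1: "g {a} a = 0" for a by (simp add: g_def midpoint_def d0)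
  have shift: "g s y = g s x + d (x, y)"
    if p: "(a, b, c) \<in> pos T" and s: "s \<subseteq> {a, b, c}" "x \<in> s" "y \<in> s" for a b c s x y
  proof -
    have "d (y, w) = d (x, w) - d (x, y)" if "w \<in> s" for w
    proof -
      have "d (x, w) = d (x, y) + d (y, w)"
        by (rule cocycle_add[OF d p]) (use s that in blast)+
      then show ?thesis by simp
    qed
    then have "(\<lambda>w. d (y, w)) ` s = (\<lambda>t. t - d (x, y)) ` ((\<lambda>w. d (x, w)) ` s)"
      by (simp add: image_image)
    moreover have "finite s" using s(1) finite_subset by blast
    ultimately show ?thesis
      using midpoint_shift[of "(\<lambda>w. d (x, w)) ` s" "d (x, y)"] s(2) unfolding g_def by fastforce
  qed
  have pot: "potential (sd T) F (dual_chain T d)"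
    unfolding F_def
  proof (rule potential_dual_chain[where g = g and d = d, OF as g1])
    fix a b c assume p: "(a, b, c) \<in> pos T"
    show "g {a, b} b - g {a, b} a = d (a, b)" using shift[OF p, of "{a, b}" a b] by simp
    show "g {a, b, c} b - g {a, b, c} a = d (a, b)" using shift[OF p, of "{a, b, c}" a b] by simp
    assume *: "g {a, b} a \<noteq> 0 \<or> g {a, b} b \<noteq> 0"
    have c2: "card {a, b} = 2" using pos_distinct[OF p] by simp
    have "d (a, b) \<noteq> 0"
    proof
      assume "d (a, b) = 0"
      moreover then have "d (b, a) = 0" using antisym_chainD[OF as, of b a] by simp
      ultimately show False using * c2 by (simp add: g_def d0 midpoint_def)
    qed
    then show "\<exists>c. (b, a, c) \<in> pos T" by (rule opp)
  qed
  have co: "cocycle (sd T) (cocycle_of (sd T) F)"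
    by (rule tri_surf.cocycle_cocycle_of[OF tri_surf_sd pot antisym_dual_chain])
  have val: "cocycle_of (sd T) F (p, q) = F p {p, q, r} - F q {p, q, r}" if "(p, q, r) \<in> pos (sd T)" for p q r
    by (rule tri_surf.cocycle_of_pos[OF tri_surf_sd that])
  have close: "\<bar>g s x - g s' x\<bar> \<le> max 1 ((M + 1) div 2)"
    if p: "(a, b, c) \<in> pos T" and s: "s \<subseteq> s'" "s' \<subseteq> {a, b, c}" "x \<in> s" for a b c s s' x
  proof (cases "\<forall>e. d e = 0")
    case True
    then have "midpoint ((\<lambda>y. d (x, y)) ` s) = 0" "midpoint ((\<lambda>y. d (x, y)) ` s') = 0"
      using s by (auto simp: midpoint_def image_constant_conv)
    then have "\<bar>g s x - g s' x\<bar> \<le> 1" using True by (simp add: g_def \<kappa>_def)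
    then show ?thesis by (simp add: le_max_iff_disj)
  next
    case False
    have fin: "finite s'" using s(2) finite_subset by blast
    have "\<bar>midpoint ((\<lambda>y. d (x, y)) ` s) - midpoint ((\<lambda>y. d (x, y)) ` s')\<bar> \<le> (M + 1) div 2"
    proof (rule midpoint_diff)
      fix l l' assume "l \<in> (\<lambda>y. d (x, y)) ` s'" "l' \<in> (\<lambda>y. d (x, y)) ` s'"
      then obtain y y' where "l = d (x, y)" "l' = d (x, y')" "y \<in> s'" "y' \<in> s'" by blast
      moreover from this have "d (x, y) = d (x, y') + d (y', y)"
        by (intro cocycle_add[OF d p]) (use s in blast)+
      ultimately have "l - l' = d (y', y)" by simp
      then show "l - l' \<le> M" using M[of "(y', y)"] by simp
    qed (use fin s in auto)
    moreover have "\<kappa> = 0" using False by (simp add: \<kappa>_def)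
    ultimately show ?thesis by (auto simp: g_def)
  qed
  have bound: "\<bar>cocycle_of (sd T) F (p, q)\<bar> \<le> max 1 ((M + 1) div 2)" for p q
  proof (cases "cocycle_of (sd T) F (p, q) = 0")
    case False
    then obtain r where r: "(p, q, r) \<in> pos (sd T)" using co unfolding cocycle_def by blast
    then show ?thesis
    proof (cases rule: sd_pos_cases)
      case (1 a b c)
      then show ?thesis using val[OF r] close[OF 1(1), of "{a}" "{a, b}" a] by (simp add: F_def)
    next
      case (2 a b c)
      then show ?thesis using val[OF r] close[OF 2(1), of "{a, b}" "{a, b, c}" a] by (simp add: F_def)
    next
      case (3 a b c)
      then show ?thesis using val[OF r] close[OF 3(1), of "{a}" "{a, b, c}" a] by (simp add: F_def abs_minus_commute)
    next
      case (4 a b c)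
      then show ?thesis using val[OF r] close[OF 4(1), of "{b}" "{a, b, c}" b] by (simp add: F_def)
    next
      case (5 a b c)
      then show ?thesis using val[OF r] close[OF 5(1), of "{a, b}" "{a, b, c}" b] by (simp add: F_def abs_minus_commute)
    next
      case (6 a b c)
      then show ?thesis using val[OF r] close[OF 6(1), of "{b}" "{a, b}" b] by (simp add: F_def abs_minus_commute)
    qed
  qed simp
  have "\<exists>e. cocycle_of (sd T) F e \<noteq> 0"
  proof (cases "\<forall>e. d e = 0")
    case True
    obtain a b c where p: "(a, b, c) \<in> pos T" using ne by auto
    have c3: "card {a, b, c} = 3" using pos_distinct[OF p] by simp
    have "midpoint ((\<lambda>y. d (b, y)) ` {a, b, c}) = 0"
      using True by (simp add: midpoint_def)
    then have "cocycle_of (sd T) F (bary {b}, bary {a, b, c}) = - 1"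
      using val[OF sd_posI(4)[OF p]] True c3 by (simp add: F_def g1 g_def[of "{a, b, c}"] \<kappa>_def)
    then show ?thesis by (intro exI[of _ "(bary {b}, bary {a, b, c})"]) simp
  next
    case False
    then obtain a b where ab: "d (a, b) \<noteq> 0" by auto
    then obtain c where p: "(a, b, c) \<in> pos T" using d unfolding cocycle_def by blast
    have "cocycle_of (sd T) F (bary {a}, bary {a, b}) + cocycle_of (sd T) F (bary {a, b}, bary {b}) = d (a, b)"
      using val[OF sd_posI(1)[OF p]] val[OF sd_posI(6)[OF p]] shift[OF p, of "{a, b}" a b] by (simp add: F_def g1)
    then show ?thesis using ab by (metis add_0)
  qed
  then show ?thesis using pot bound by auto
qed

end

text \<open>The cocycle \<open>d\<close> on the \<open>k\<close>-th subdivision is Poincare dual to the class of \<open>z\<close>.\<close>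

definition dual_rep :: "surf \<Rightarrow> (nat \<times> nat \<Rightarrow> int) \<Rightarrow> nat \<Rightarrow> (nat \<times> nat \<Rightarrow> int) \<Rightarrow> bool" where
  "dual_rep S z k d \<longleftrightarrow> cocycle ((sd ^^ k) S) d \<and>
     homologous ((sd ^^ Suc k) S) (dual_chain ((sd ^^ k) S) d) (sd_chain_iter S (Suc k) z)"

context tri_surf
begin

lemma dual_rep_refine:
  assumes z: "dual_rep T z k d" and M: "\<And>e. \<bar>d e\<bar> \<le> M" and ne: "pos T \<noteq> {}"
  shows "\<exists>d'. dual_rep T z (Suc k) d' \<and> (\<forall>e. \<bar>d' e\<bar> \<le> max 1 ((M + 1) div 2)) \<and> (\<exists>e. d' e \<noteq> 0)"
proof -
  interpret U: tri_surf "(sd ^^ k) T" by (rule tri_surf_iter)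
  interpret V: tri_surf "sd ((sd ^^ k) T)" by (rule U.tri_surf_sd)
  have "pos ((sd ^^ j) T) \<noteq> {}" for j
  proof (induction j)
    case (Suc j)
    then obtain a b c where "(a, b, c) \<in> pos ((sd ^^ j) T)" by auto
    from tri_surf.sd_posI(1)[OF tri_surf_iter this] show ?case by auto
  qed (simp add: ne)
  then obtain F where F: "potential (sd ((sd ^^ k) T)) F (dual_chain ((sd ^^ k) T) d)"
    and b: "\<forall>e. \<bar>cocycle_of (sd ((sd ^^ k) T)) F e\<bar> \<le> max 1 ((M + 1) div 2)"
    and n: "\<exists>e. cocycle_of (sd ((sd ^^ k) T)) F e \<noteq> 0"
    using U.refine_cocycle[of d M] z M unfolding dual_rep_def by blast
  let ?d = "cocycle_of (sd ((sd ^^ k) T)) F"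
  have "homologous (sd (sd ((sd ^^ k) T))) (sd_chain (sd ((sd ^^ k) T)) (dual_chain ((sd ^^ k) T) d))
      (dual_chain (sd ((sd ^^ k) T)) ?d)"
    using V.dual_homologous[OF F U.antisym_dual_chain] unfolding homologous_def by blast
  moreover have "homologous (sd (sd ((sd ^^ k) T))) (sd_chain (sd ((sd ^^ k) T)) (dual_chain ((sd ^^ k) T) d))
      (sd_chain (sd ((sd ^^ k) T)) (sd_chain_iter T (Suc k) z))"
    using V.homologous_sd z unfolding dual_rep_def by simp
  ultimately have "homologous (sd (sd ((sd ^^ k) T))) (dual_chain (sd ((sd ^^ k) T)) ?d)
      (sd_chain (sd ((sd ^^ k) T)) (sd_chain_iter T (Suc k) z))"
    using homologous_sym homologous_trans by blast
  then have "dual_rep T z (Suc k) ?d"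
    unfolding dual_rep_def using V.cocycle_cocycle_of[OF F U.antisym_dual_chain] by simp
  then show ?thesis using b n by blast
qed

lemma dual_rep_small:
  assumes z: "dual_rep T z k d" and M: "\<And>e. \<bar>d e\<bar> \<le> int M" and ne: "pos T \<noteq> {}"
  shows "\<exists>k' d'. k' > k \<and> dual_rep T z k' d' \<and> (\<forall>e. \<bar>d' e\<bar> \<le> 1) \<and> (\<exists>e. d' e \<noteq> 0)"
  using assms
proof (induction M arbitrary: k d rule: less_induct)
  case (less M)
  obtain d' where d': "dual_rep T z (Suc k) d'" "\<forall>e. \<bar>d' e\<bar> \<le> max 1 ((int M + 1) div 2)" "\<exists>e. d' e \<noteq> 0"
    using dual_rep_refine[OF less(2,3,4)] by blast
  show ?case
  proof (cases "M \<le> 2")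
    case True
    then have "max 1 ((int M + 1) div 2) = 1" by auto
    then show ?thesis using d' by (intro exI[of _ "Suc k"] exI[of _ d']) auto
  next
    case False
    let ?M = "(M + 1) div 2"
    have "int ?M = (int M + 1) div 2" by (simp add: zdiv_int add.commute)
    moreover have "max 1 ((int M + 1) div 2) = (int M + 1) div 2" using False by auto
    ultimately have "\<bar>d' e\<bar> \<le> int ?M" for e using d'(2) by metis
    moreover have "?M < M" using False by auto
    ultimately have "?M < M" "\<And>e. \<bar>d' e\<bar> \<le> int ?M" by blast+
    from less(1)[OF this(1) d'(1) this(2) ne] obtain k' d'' where
      "k' > Suc k" "dual_rep T z k' d''" "\<forall>e. \<bar>d'' e\<bar> \<le> 1" "\<exists>e. d'' e \<noteq> 0" by blast
    then show ?thesis by (intro exI[of _ k'] exI[of _ d'']) auto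
  qed
qed

lemma dual_rep_later:
  assumes "dual_rep T z k d" "\<forall>e. \<bar>d e\<bar> \<le> 1" "\<exists>e. d e \<noteq> 0" and ne: "pos T \<noteq> {}"
  shows "\<exists>d'. dual_rep T z (k + j) d' \<and> (\<forall>e. \<bar>d' e\<bar> \<le> 1) \<and> (\<exists>e. d' e \<noteq> 0)"
proof (induction j)
  case (Suc j)
  then obtain d' where "dual_rep T z (k + j) d'" "\<And>e. \<bar>d' e\<bar> \<le> 1" by blast
  from dual_rep_refine[OF this ne] show ?case by simp
next
  case 0
  show ?case using assms(1-3) by (intro exI[of _ d]) simp
qed

lemma dual_rep_exists:
  assumes F: "potential T F z" and z: "antisym_chain z" and ne: "pos T \<noteq> {}"
  shows "\<exists>k. \<forall>j\<ge>k. \<exists>d. dual_rep T z j d \<and> (\<forall>e. \<bar>d e\<bar> \<le> 1) \<and> (\<exists>e. d e \<noteq> 0)"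
proof -
  let ?d = "cocycle_of T F"
  have "homologous (sd T) (sd_chain T z) (dual_chain T ?d)"
    unfolding homologous_def using dual_homologous[OF F z] by blast
  then have "dual_rep T z 0 ?d"
    unfolding dual_rep_def using cocycle_cocycle_of[OF F z] homologous_sym by simp
  moreover obtain M where "\<And>e. \<bar>?d e\<bar> \<le> int M"
  proof -
    let ?A = "(\<lambda>e. nat \<bar>?d e\<bar>) ` (verts T \<times> verts T)"
    have fin: "finite ?A" using finite_verts by simp
    have "\<bar>?d e\<bar> \<le> int (Max (insert 0 ?A))" for e
    proof (cases "?d e = 0")
      case False
      obtain a b where e: "e = (a, b)" by (cases e)
      with False obtain c where "(a, b, c) \<in> pos T"
        using cocycle_cocycle_of[OF F z] unfolding cocycle_def by blast
      then have "nat \<bar>?d e\<bar> \<in> insert 0 ?A" using pos_verts e by blast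
      then have "nat \<bar>?d e\<bar> \<le> Max (insert 0 ?A)" using fin by (intro Max_ge) auto
      then show ?thesis by linarith
    qed simp
    then show ?thesis using that by blast
  qed
  ultimately obtain k d where k: "dual_rep T z k d" "\<forall>e. \<bar>d e\<bar> \<le> 1" "\<exists>e. d e \<noteq> 0"
    using dual_rep_small[OF _ _ ne] by blast
  have "\<exists>d. dual_rep T z j d \<and> (\<forall>e. \<bar>d e\<bar> \<le> 1) \<and> (\<exists>e. d e \<noteq> 0)" if "j \<ge> k" for j
    using dual_rep_later[OF k ne, of "j - k"] that by simp
  then show ?thesis by blast
qed

end


section \<open>Curves from chains\<close>

lemma length_arcs [simp]: "length (arcs c) = length c"
  by (simp add: arcs_def)

lemma arcs_nth: "arcs c = map (\<lambda>k. (c ! k, c ! (Suc k mod length c))) [0..<length c]"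
  by (rule nth_equalityI) (auto simp: arcs_def nth_rotate1)

lemma strand_list_nth:
  "strand_list c = map (\<lambda>k. (c ! ((k + length c - 1) mod length c), c ! k, c ! (Suc k mod length c))) [0..<length c]"
proof (cases "c = []")
  case False
  show ?thesis
  proof (rule nth_equalityI)
    show "length (strand_list c) = length (map (\<lambda>k. (c ! ((k + length c - 1) mod length c), c ! k, c ! (Suc k mod length c))) [0..<length c])"
      using False by (simp add: strand_list_def)
    fix k assume "k < length (strand_list c)"
    then have k: "k < length c" using False by (simp add: strand_list_def)
    have "(last c # butlast c) ! k = c ! ((k + length c - 1) mod length c)"
    proof (cases k)
      case 0
      then show ?thesis using False by (simp add: last_conv_nth)
    next
      case (Suc j)
      then have "(k + length c - 1) mod length c = j" using k by simp
      then show ?thesis using Suc k by (simp add: nth_butlast)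
    qed
    then show "strand_list c ! k = map (\<lambda>k. (c ! ((k + length c - 1) mod length c), c ! k, c ! (Suc k mod length c))) [0..<length c] ! k"
      using k False by (simp add: strand_list_def nth_rotate1)
  qed
qed (simp add: strand_list_def)

lemma set_strand_list:
  "set (strand_list c) = {(c ! ((k + length c - 1) mod length c), c ! k, c ! (Suc k mod length c)) | k. k < length c}"
  unfolding strand_list_nth by auto

lemma set_arcs: "set (arcs c) = {(c ! k, c ! (Suc k mod length c)) | k. k < length c}"
  unfolding arcs_nth by auto

lemma strand_arcs:
  assumes "(p, v, q) \<in> set (strand_list c)"
  shows "(p, v) \<in> set (arcs c)" "(v, q) \<in> set (arcs c)"
proof -
  obtain k where k: "k < length c" "p = c ! ((k + length c - 1) mod length c)" "v = c ! k"
    "q = c ! (Suc k mod length c)" using assms unfolding set_strand_list by blast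
  then show "(v, q) \<in> set (arcs c)" unfolding set_arcs by blast
  let ?j = "(k + length c - 1) mod length c"
  have "Suc ?j mod length c = k"
  proof (cases k)
    case 0
    then show ?thesis using k(1) by (simp add: mod_simps)
  next
    case (Suc i)
    then show ?thesis using k(1) by simp
  qed
  moreover have "?j < length c" using k(1) by (intro mod_less_divisor) linarith
  ultimately show "(p, v) \<in> set (arcs c)"
    unfolding set_arcs using k by (intro CollectI exI[of _ ?j]) simp
qed

lemma funpow_return:
  assumes "finite W" "inj_on \<sigma> W" "\<sigma> ` W \<subseteq> W" "v \<in> W"
  shows "\<exists>d>0. (\<sigma> ^^ d) v = v"
proof -
  have inW: "(\<sigma> ^^ k) v \<in> W" for k by (induction k) (use assms in auto)
  have "\<not> inj_on (\<lambda>k. (\<sigma> ^^ k) v) UNIV"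
  proof
    assume "inj_on (\<lambda>k. (\<sigma> ^^ k) v) UNIV"
    moreover have "finite (range (\<lambda>k. (\<sigma> ^^ k) v))"
      by (rule finite_subset[OF _ assms(1)]) (use inW in auto)
    ultimately show False using finite_imageD infinite_UNIV_nat by blast
  qed
  then obtain i j where ij: "i < j" "(\<sigma> ^^ i) v = (\<sigma> ^^ j) v"
    unfolding inj_on_def by (metis linorder_neqE_nat)
  have "(\<sigma> ^^ i) v = (\<sigma> ^^ (i + k)) v \<Longrightarrow> v = (\<sigma> ^^ k) v" for i k
  proof (induction i)
    case (Suc i)
    then have "\<sigma> ((\<sigma> ^^ i) v) = \<sigma> ((\<sigma> ^^ (i + k)) v)" by simp
    then have "(\<sigma> ^^ i) v = (\<sigma> ^^ (i + k)) v" using inW assms(2) by (meson inj_onD)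
    then show ?case by (rule Suc.IH)
  qed simp
  from this[of i "j - i"] ij show ?thesis by (intro exI[of _ "j - i"]) simp
qed

lemma permutation_cycles:
  assumes "finite W" "inj_on \<sigma> W" "\<sigma> ` W \<subseteq> W"
  shows "\<exists>cs. distinct (concat cs) \<and> set (concat cs) = W \<and>
    (\<forall>c\<in>set cs. c \<noteq> [] \<and> arcs c = map (\<lambda>v. (v, \<sigma> v)) c)"
  using assms
proof (induction "card W" arbitrary: W rule: less_induct)
  case less
  show ?case
  proof (cases "W = {}")
    case True
    then show ?thesis by (intro exI[of _ "[]"]) simp
  next
    case False
    then obtain v where v: "v \<in> W" by blast
    define d where "d = (LEAST d. d > 0 \<and> (\<sigma> ^^ d) v = v)"
    have d: "d > 0" "(\<sigma> ^^ d) v = v"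
      using LeastI_ex[OF funpow_return[OF less(2-4) v]] unfolding d_def by auto
    have least: "(\<sigma> ^^ k) v \<noteq> v" if "0 < k" "k < d" for k
      using not_less_Least[of k "\<lambda>d. d > 0 \<and> (\<sigma> ^^ d) v = v"] that unfolding d_def by blast
    have inW: "(\<sigma> ^^ k) v \<in> W" for k by (induction k) (use v less(4) in auto)
    define c where "c = map (\<lambda>k. (\<sigma> ^^ k) v) [0..<d]"
    have sc: "set c = (\<lambda>k. (\<sigma> ^^ k) v) ` {..<d}" by (auto simp: c_def)
    have "(\<sigma> ^^ i) v \<noteq> (\<sigma> ^^ j) v" if "i < j" "j < d" for i j
    proof
      assume *: "(\<sigma> ^^ i) v = (\<sigma> ^^ j) v"
      have "(\<sigma> ^^ (d - j + i)) v = (\<sigma> ^^ (d - j)) ((\<sigma> ^^ j) v)" by (simp add: funpow_add *)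
      also have "\<dots> = (\<sigma> ^^ (d - j + j)) v" by (simp only: funpow_add comp_apply)
      also have "\<dots> = v" using that d by simp
      finally have "(\<sigma> ^^ (d - j + i)) v = v" .
      moreover have "(\<sigma> ^^ (d - j + i)) v \<noteq> v" using that by (intro least) auto
      ultimately show False by contradiction
    qed
    then have "inj_on (\<lambda>k. (\<sigma> ^^ k) v) {0..<d}"
      unfolding inj_on_def by (metis atLeastLessThan_iff linorder_neqE_nat)
    then have dist: "distinct c" by (simp add: c_def distinct_map)
    have lc: "length c = d" by (simp add: c_def)
    have ar: "arcs c = map (\<lambda>v. (v, \<sigma> v)) c"
    proof (rule nth_equalityI)
      fix k assume "k < length (arcs c)"
      then have k: "k < d" by (simp add: lc)
      have "c ! (Suc k mod d) = \<sigma> (c ! k)"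
      proof (cases "Suc k = d")
        case True
        have "\<sigma> ((\<sigma> ^^ k) v) = (\<sigma> ^^ d) v" using True by auto
        then show ?thesis using True d k by (simp add: c_def)
      next
        case False
        then have "Suc k < d" using k by simp
        then show ?thesis using k by (simp add: c_def)
      qed
      then show "arcs c ! k = map (\<lambda>v. (v, \<sigma> v)) c ! k"
        unfolding arcs_nth using k by (simp add: lc)
    qed simp
    let ?W = "W - set c"
    have vc: "v \<in> set c" unfolding sc using d(1) by (force intro: image_eqI[of _ _ 0])
    have sub: "set c \<subseteq> W" unfolding sc using inW by blast
    have "\<sigma> y \<in> ?W" if y: "y \<in> ?W" for y
    proof -
      have "\<sigma> y \<notin> set c"
      proof
        assume "\<sigma> y \<in> set c"
        then obtain k where k: "k < d" "\<sigma> y = (\<sigma> ^^ k) v" unfolding sc by blast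
        define j where "j = (if k = 0 then d - 1 else k - 1)"
        have "\<sigma> ((\<sigma> ^^ j) v) = (\<sigma> ^^ Suc j) v" by simp
        also have "\<dots> = (\<sigma> ^^ k) v" using k(1) d by (auto simp: j_def simp del: funpow.simps)
        finally have "y = (\<sigma> ^^ j) v" using k(2) less(3) y inW by (metis DiffD1 inj_onD)
        moreover have "j < d" using k(1) d(1) by (auto simp: j_def)
        ultimately have "y \<in> set c" unfolding sc by blast
        then show False using y by blast
      qed
      then show ?thesis using y less(4) by blast
    qed
    then have "\<sigma> ` ?W \<subseteq> ?W" by blast
    moreover have "card ?W < card W" using vc sub v less(2) by (intro psubset_card_mono) auto
    moreover have "finite ?W" "inj_on \<sigma> ?W" using less(2,3) by (auto intro: inj_on_diff)
    ultimately obtain cs where cs: "distinct (concat cs)" "set (concat cs) = ?W"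
      "\<forall>c\<in>set cs. c \<noteq> [] \<and> arcs c = map (\<lambda>v. (v, \<sigma> v)) c"
      using less(1)[of ?W] by blast
    have "distinct (concat (c # cs))" "set (concat (c # cs)) = W"
      using cs(1,2) dist sub by auto
    moreover have "\<forall>b\<in>set (c # cs). b \<noteq> [] \<and> arcs b = map (\<lambda>v. (v, \<sigma> v)) b"
      using cs(3) ar vc by (auto simp del: concat.simps)
    ultimately show ?thesis by blast
  qed
qed

definition flow_line :: "(nat \<times> nat \<Rightarrow> int) \<Rightarrow> bool" where
  "flow_line x \<longleftrightarrow> (\<forall>p q q'. x (p, q) = 1 \<longrightarrow> x (p, q') = 1 \<longrightarrow> q = q') \<and>
     (\<forall>p q. x (p, q) = 1 \<longrightarrow> (\<exists>r. x (p, r) = - 1))"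

text \<open>With values in \<open>{-1, 0, 1}\<close> these two properties, also for \<open>- x\<close>, say that \<open>x\<close> is the chain of disjoint simple
  closed curves.\<close>

definition simple_chain :: "(nat \<times> nat \<Rightarrow> int) \<Rightarrow> bool" where
  "simple_chain x \<longleftrightarrow> antisym_chain x \<and> (\<forall>e. \<bar>x e\<bar> \<le> 1) \<and> flow_line x \<and> flow_line (\<lambda>e. - x e)"

lemma simple_chain_curves:
  assumes x: "simple_chain x" and fin: "finite {e. x e = 1}"
  obtains cs where "curve_chain cs = x" "distinct (concat (map arcs cs))"
    "set (concat (map arcs cs)) = {e. x e = 1}" "\<forall>c\<in>set cs. c \<noteq> []"
proof -
  have as: "x (b, a) = - x (a, b)" for a b
    using x antisym_chainD unfolding simple_chain_def by blast
  have out: "x (p, q) = 1 \<Longrightarrow> x (p, q') = 1 \<Longrightarrow> q = q'" for p q q'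
    using x unfolding simple_chain_def flow_line_def by blast
  have into: "x (q, p) = 1 \<Longrightarrow> x (q', p) = 1 \<Longrightarrow> q = q'" for p q q'
  proof -
    assume "x (q, p) = 1" "x (q', p) = 1"
    then have "- x (p, q) = 1" "- x (p, q') = 1" using as[of q p] as[of q' p] by simp_all
    then show "q = q'" using x unfolding simple_chain_def flow_line_def by blast
  qed
  have src: "x (p, q) = 1 \<Longrightarrow> \<exists>r. x (r, p) = 1" for p q
  proof -
    assume "x (p, q) = 1"
    then obtain r where "x (p, r) = - 1" using x unfolding simple_chain_def flow_line_def by blast
    then have "x (r, p) = 1" using as[of p r] by simp
    then show ?thesis by blast
  qed
  have tgt: "\<exists>r. x (q, r) = 1" if "x (p, q) = 1" for p q
  proof -
    have "- x (q, p) = 1" using that as[of p q] by simp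
    then have "\<exists>r. - x (q, r) = - 1" using x unfolding simple_chain_def flow_line_def by blast
    then show ?thesis by auto
  qed
  define A where "A = {e. x e = 1}"
  define W where "W = Domain A"
  define \<sigma> where "\<sigma> v = (THE q. x (v, q) = 1)" for v
  have \<sigma>: "x (v, q) = 1 \<Longrightarrow> \<sigma> v = q" for v q
    unfolding \<sigma>_def using out by (intro the_equality) auto
  have \<sigma>W: "x (v, \<sigma> v) = 1" if "v \<in> W" for v
    using that \<sigma> unfolding W_def A_def by auto
  have "finite W" using fin unfolding W_def A_def Domain_fst by (rule finite_imageI)
  moreover have "inj_on \<sigma> W" by (rule inj_onI) (metis \<sigma>W into)
  moreover have "\<sigma> ` W \<subseteq> W"
  proof clarify
    fix v assume "v \<in> W"
    then obtain r where "x (\<sigma> v, r) = 1" using tgt \<sigma>W by blast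
    then show "\<sigma> v \<in> W" unfolding W_def A_def by blast
  qed
  ultimately obtain cs where cs: "distinct (concat cs)" "set (concat cs) = W"
    "\<forall>c\<in>set cs. c \<noteq> [] \<and> arcs c = map (\<lambda>v. (v, \<sigma> v)) c"
    using permutation_cycles by blast
  have arcs_eq: "concat (map arcs cs) = map (\<lambda>v. (v, \<sigma> v)) (concat cs)"
    using cs(3) by (simp add: map_concat cong: map_cong)
  have setA: "set (concat (map arcs cs)) = A"
    unfolding arcs_eq set_map cs(2) using \<sigma>W \<sigma> by (force simp: W_def A_def)
  have dist: "distinct (concat (map arcs cs))"
    unfolding arcs_eq distinct_map using cs(1) by (auto intro: inj_onI)
  have "curve_chain cs e = x e" for e
  proof -
    obtain p q where e: "e = (p, q)" by (cases e)
    have "curve_chain cs e = (\<Sum>a\<in>A. arc_chain a e)"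
      unfolding curve_chain_def using sum_list_distinct_conv_sum_set[OF dist] setA by simp
    also have "\<dots> = (\<Sum>a\<in>A. of_bool (a = (p, q))) - (\<Sum>a\<in>A. of_bool (a = (q, p)))"
      unfolding sum_subtractf[symmetric]
    proof (rule sum.cong[OF refl])
      fix a :: "nat \<times> nat"
      obtain u w where "a = (u, w)" by (cases a)
      then show "arc_chain a e = of_bool (a = (p, q)) - of_bool (a = (q, p))"
        by (cases "u = p"; cases "w = q"; cases "u = q"; cases "w = p") (simp_all add: arc_chain_def e)
    qed
    also have "\<dots> = of_bool (x (p, q) = 1) - of_bool (x (q, p) = 1)"
      using fin by (simp add: A_def of_bool_def)
    also have "\<dots> = x e"
    proof -
      have "\<bar>x (p, q)\<bar> \<le> 1" using x unfolding simple_chain_def by blast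
      then have "x (p, q) = 0 \<or> x (p, q) = 1 \<or> x (p, q) = - 1" by linarith
      then show ?thesis using as[of p q] e by auto
    qed
    finally show ?thesis .
  qed
  then show ?thesis using that[of cs] dist setA cs(3) unfolding A_def by blast
qed


lemma antisym_chain_minus:
  assumes "antisym_chain z"
  shows "antisym_chain (\<lambda>e. - z e)"
  unfolding antisym_chain_def
proof (intro allI)
  show "- z (b, a) = - (- z (a, b))" for a b
    using antisym_chainD[OF assms, of b a] by simp
qed

context tri_surf
begin

lemma ccw_eq: "(v, x, y) \<in> pos T \<Longrightarrow> ccw T v x = y"
  unfolding ccw_def using uniq by blast

lemma triangles_at_edge:
  assumes "t \<in> triangles T" "{a, b} \<subseteq> t" "a \<noteq> b"
  shows "\<exists>c. t = {a, b, c} \<and> ((a, b, c) \<in> pos T \<or> (b, a, c) \<in> pos T)"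
proof -
  have "card (t - {a, b}) = 1"
    using assms by (subst card_Diff_subset) (auto simp: triangles_def)
  then obtain c where "t - {a, b} = {c}" by (rule card_1_singletonE)
  then have t: "t = {a, b, c}" using assms(2) by auto
  then show ?thesis using assms(1) triangle_pos[of a b c] rot2[of a c b] by blast
qed

lemma boundary_edges_sym: "(a, b) \<in> boundary_edges T \<longleftrightarrow> (b, a) \<in> boundary_edges T"
  by (simp add: boundary_edges_def insert_commute conj_commute)

lemma interior_after:
  assumes v: "interior_vertex T v" and e: "{v, u} \<in> edges T"
  shows "\<exists>c. (v, u, c) \<in> pos T" "\<exists>c. (v, c, u) \<in> pos T"
proof -
  have nb: "card {t \<in> triangles T. {a, b} \<subseteq> t} \<noteq> 1" if "{a, b} = {v, u}" for a b
    using v e that unfolding interior_vertex_def boundary_edges_def Field_def by auto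
  have *: "\<exists>c. (a, b, c) \<in> pos T" if ab: "{a, b} = {v, u}" for a b
  proof (rule ccontr)
    assume no: "\<nexists>c. (a, b, c) \<in> pos T"
    then obtain c where c: "(b, a, c) \<in> pos T" using e edge_pos[of a b] ab by auto
    have "{t \<in> triangles T. {a, b} \<subseteq> t} = {{b, a, c}}"
    proof (intro equalityI subsetI)
      fix t assume "t \<in> {t \<in> triangles T. {a, b} \<subseteq> t}"
      then obtain c' where c': "t = {a, b, c'}" "(a, b, c') \<in> pos T \<or> (b, a, c') \<in> pos T"
        using triangles_at_edge[of t a b] pos_distinct[OF c] by auto
      then have "(b, a, c') \<in> pos T" using no by blast
      then show "t \<in> {{b, a, c}}" using uniq[OF c] c'(1) by (simp add: insert_commute)
    next
      fix t assume "t \<in> {{b, a, c}}"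
      then show "t \<in> {t \<in> triangles T. {a, b} \<subseteq> t}" using triangle_pos[of b a c] c by auto
    qed
    then show False using nb[OF ab] by simp
  qed
  show "\<exists>c. (v, u, c) \<in> pos T" using * by blast
  obtain c where "(u, v, c) \<in> pos T" using *[of u v] by blast
  then show "\<exists>c. (v, c, u) \<in> pos T" using rot by blast
qed

lemma interiorI:
  assumes v: "v \<in> verts T" and *: "\<And>x y. (v, x, y) \<in> pos T \<Longrightarrow> (\<exists>c. (v, y, c) \<in> pos T) \<and> (\<exists>c. (v, c, x) \<in> pos T)"
  shows "interior_vertex T v"
proof -
  have "(v, u) \<notin> boundary_edges T" for u
  proof
    assume "(v, u) \<in> boundary_edges T"
    then have e: "{v, u} \<in> edges T" and c1: "card {t \<in> triangles T. {v, u} \<subseteq> t} = 1"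
      by (auto simp: boundary_edges_def)
    obtain c where "(v, u, c) \<in> pos T \<or> (v, c, u) \<in> pos T"
      using e edge_pos[of v u] rot by blast
    then obtain c c' where c: "(v, u, c) \<in> pos T" "(v, c', u) \<in> pos T"
      using * by blast
    have "{v, u, c} \<in> {t \<in> triangles T. {v, u} \<subseteq> t}" "{v, c', u} \<in> {t \<in> triangles T. {v, u} \<subseteq> t}"
      using c triangle_pos by auto
    moreover have "{v, u, c} \<noteq> {v, c', u}"
      using pos_eq_of_set[OF c] pos_distinct[OF c(1)] pos_distinct[OF c(2)] by auto
    ultimately show False using c1 by (metis card_1_singletonE singletonD)
  qed
  then show ?thesis
    using v boundary_edges_sym unfolding interior_vertex_def Field_def by blast
qed

lemma ccw_arc_two:
  assumes "(v, a, y) \<in> pos T" "(v, y, b) \<in> pos T" "a \<noteq> b"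
  shows "ccw_arc T v a b = [a, y, b]"
proof -
  have s: "ccw T v a = y" "ccw T v y = b" using ccw_eq assms by auto
  have "(LEAST k. (ccw T v ^^ k) a = b) = 2"
  proof (rule Least_equality)
    show "(ccw T v ^^ 2) a = b" using s by (simp add: numeral_2_eq_2)
    fix k assume k: "(ccw T v ^^ k) a = b"
    have "k \<noteq> 0" using k assms(3) by (cases k) auto
    moreover have "k \<noteq> 1" using k s pos_distinct[OF assms(2)] by auto
    ultimately show "2 \<le> k" by linarith
  qed
  then show ?thesis using s by (simp add: ccw_arc_def numeral_2_eq_2)
qed

lemma crossed_four:
  assumes "(v, e, n) \<in> pos T" "(v, n, w) \<in> pos T" "(v, w, s) \<in> pos T" "(v, s, e) \<in> pos T" "e \<noteq> w"
  shows "crossed_lr T (w, v, e) (n, v, s)"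
  unfolding crossed_lr_def
  using ccw_arc_two[OF assms(1,2)] ccw_arc_two[OF assms(3,4)] assms(5)
    pos_distinct[OF assms(1)] pos_distinct[OF assms(2)] pos_distinct[OF assms(3)] pos_distinct[OF assms(4)]
  by auto

lemma interior_midpoint:
  assumes p: "(a, b, c) \<in> pos T" "(b, a, c') \<in> pos T"
  shows "interior_vertex (sd T) (bary {a, b})"
proof (rule tri_surf.interiorI[OF tri_surf_sd])
  show "bary {a, b} \<in> verts (sd T)"
    using tri_surf.pos_verts[OF tri_surf_sd sd_posI(2)[OF p(1)]] by blast
  fix x y assume xy: "(bary {a, b}, x, y) \<in> pos (sd T)"
  have opp: "\<exists>c''. (b', a', c'') \<in> pos T" if "bary {a, b} = bary {a', b'}" for a' b'
    using that p by auto
  show "(\<exists>c. (bary {a, b}, y, c) \<in> pos (sd T)) \<and> (\<exists>c. (bary {a, b}, c, x) \<in> pos (sd T))"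
    using xy
  proof (cases rule: sd_pos_cases)
    case (2 a' b' c1)
    obtain c2 where c2: "(b', a', c2) \<in> pos T" using opp[OF 2(2)] by blast
    have "bary {a, b} = bary {b', a'}" using 2(2) by (simp only: insert_commute)
    then show ?thesis using sd_posI(6)[OF c2] sd_posI(6)[OF 2(1)] 2 by metis
  next
    case (6 a' b' c1)
    obtain c2 where c2: "(b', a', c2) \<in> pos T" using opp[OF 6(2)] by blast
    have "bary {a, b} = bary {b', a'}" using 6(2) by (simp only: insert_commute)
    then show ?thesis using sd_posI(2)[OF c2] sd_posI(2)[OF 6(1)] 6 by metis
  qed (use pos_distinct[OF p(1)] in \<open>auto simp: bary_pos_simps\<close>)
qed

lemma cross_midpoint:
  assumes p: "(a, b, c) \<in> pos T" "(b, a, c') \<in> pos T"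
    and pq: "p = bary {a} \<and> q = bary {b} \<or> p = bary {b} \<and> q = bary {a}"
    and pq': "p' = bary {a, b, c} \<and> q' = bary {b, a, c'} \<or> p' = bary {b, a, c'} \<and> q' = bary {a, b, c}"
  shows "crossed_lr (sd T) (p, bary {a, b}, q) (p', bary {a, b}, q') \<or>
    crossed_lr (sd T) (p', bary {a, b}, q') (p, bary {a, b}, q)"
proof -
  interpret U: tri_surf "sd T" by (rule tri_surf_sd)
  let ?m = "bary {a, b}" and ?e = "bary {b}" and ?n = "bary {a, b, c}" and ?w = "bary {a}" and ?s = "bary {b, a, c'}"
  have mm: "bary {b, a} = ?m" by (simp only: insert_commute)
  have r: "(?m, ?e, ?n) \<in> pos (sd T)" "(?m, ?n, ?w) \<in> pos (sd T)"
    "(?m, ?w, ?s) \<in> pos (sd T)" "(?m, ?s, ?e) \<in> pos (sd T)"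
    using sd_posI(6)[OF p(1)] sd_posI(2)[OF p(1)] sd_posI(6)[OF p(2)] sd_posI(2)[OF p(2)]
    by (simp_all add: mm)
  have ew: "?e \<noteq> ?w" using pos_distinct[OF p(1)] by simp
  have ns: "?n \<noteq> ?s" using bary_pos_eq[OF p] pos_distinct[OF p(1)] by auto
  have 1: "crossed_lr (sd T) (?w, ?m, ?e) (?n, ?m, ?s)" by (rule U.crossed_four[OF r ew])
  have 2: "crossed_lr (sd T) (?s, ?m, ?n) (?w, ?m, ?e)" by (rule U.crossed_four[OF r(2,3,4,1) ns])
  have 3: "crossed_lr (sd T) (?e, ?m, ?w) (?s, ?m, ?n)" by (rule U.crossed_four[OF r(3,4,1,2) ew[symmetric]])
  have 4: "crossed_lr (sd T) (?n, ?m, ?s) (?e, ?m, ?w)" by (rule U.crossed_four[OF r(4,1,2,3) ns[symmetric]])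
  show ?thesis using pq pq' 1 2 3 4 by auto
qed

lemma dual_chain_zm:
  assumes p: "(a, b, c) \<in> pos T"
  shows "dual_chain T d (bary {a, b, c}, bary {a, b}) = d (a, b)"
    "dual_chain T d (bary {a, b}, bary {a, b, c}) = - d (a, b)"
proof -
  have "dual_chain T d (bary {a, b, c}, bary {a, b}) = (\<Sum>x\<in>pos T. if x = (a, b, c) then d (a, b) else 0)"
    unfolding dual_chain_def
  proof (rule sum.cong[OF refl])
    fix x assume x: "x \<in> pos T"
    obtain a' b' c' where x': "x = (a', b', c')" by (cases x)
    have q: "(a', b', c') \<in> pos T" using x x' by simp
    have "bary {a, b, c} = bary {a', b', c'} \<and> bary {a, b} = bary {a', b'} \<longleftrightarrow> (a', b', c') = (a, b, c)"
      using bary_pos_eq[OF p q] pos_distinct[OF p] by auto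
    moreover have "bary {a, b, c} \<noteq> bary {a', b'}" using p by simp
    ultimately show "(case x of (a', b', c') \<Rightarrow> d (a', b') * arc_chain (bary {a', b', c'}, bary {a', b'}) (bary {a, b, c}, bary {a, b})) =
      (if x = (a, b, c) then d (a, b) else 0)"
      unfolding x' arc_chain_def by auto
  qed
  then show 1: "dual_chain T d (bary {a, b, c}, bary {a, b}) = d (a, b)"
    using p finite_pos by simp
  show "dual_chain T d (bary {a, b}, bary {a, b, c}) = - d (a, b)"
    using antisym_chainD[OF antisym_dual_chain, of d "bary {a, b}" "bary {a, b, c}"] 1 by simp
qed

lemma dual_chain_nonzero:
  assumes "dual_chain T d (p, q) \<noteq> 0"
  obtains a b c where "(a, b, c) \<in> pos T" "d (a, b) \<noteq> 0" "p = bary {a, b, c}" "q = bary {a, b}"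
  | a b c where "(a, b, c) \<in> pos T" "d (a, b) \<noteq> 0" "p = bary {a, b}" "q = bary {a, b, c}"
proof -
  obtain x where "x \<in> pos T" "(case x of (a, b, c) \<Rightarrow> d (a, b) * arc_chain (bary {a, b, c}, bary {a, b}) (p, q)) \<noteq> 0"
    using assms unfolding dual_chain_def by (meson sum.neutral)
  moreover obtain a b c where "x = (a, b, c)" by (cases x)
  ultimately have "(a, b, c) \<in> pos T" "d (a, b) \<noteq> 0" "arc_chain (bary {a, b, c}, bary {a, b}) (p, q) \<noteq> 0" by auto
  moreover from this(3) have "(p = bary {a, b, c} \<and> q = bary {a, b}) \<or> (p = bary {a, b} \<and> q = bary {a, b, c})"
    by (auto simp: arc_chain_def of_bool_def split: if_splits)
  ultimately show ?thesis using that by blast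
qed

lemma flow_line_dual:
  assumes d: "cocycle T d" and d1: "\<And>e. \<bar>d e\<bar> \<le> 1"
  shows "flow_line (dual_chain T d)"
  unfolding flow_line_def
proof (intro conjI allI impI)
  have as: "d (b, a) = - d (a, b)" for a b
    using d antisym_chainD unfolding cocycle_def by blast
  have sum0: "d (a, b) + d (b, c) + d (c, a) = 0" if "(a, b, c) \<in> pos T" for a b c
    using d that unfolding cocycle_def by blast
  have one: "dual_chain T d (p, q) = 1 \<Longrightarrow> (\<exists>a b c. (a, b, c) \<in> pos T \<and> d (a, b) = 1 \<and> p = bary {a, b, c} \<and> q = bary {a, b}) \<or>
      (\<exists>a b c. (a, b, c) \<in> pos T \<and> d (a, b) = - 1 \<and> p = bary {a, b} \<and> q = bary {a, b, c})" for p q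
  proof -
    assume 1: "dual_chain T d (p, q) = 1"
    then have "dual_chain T d (p, q) \<noteq> 0" by simp
    then show ?thesis
    proof (cases rule: dual_chain_nonzero)
      case (1 a b c)
      then show ?thesis using \<open>dual_chain T d (p, q) = 1\<close> dual_chain_zm[of a b c d] by auto
    next
      case (2 a b c)
      then show ?thesis using \<open>dual_chain T d (p, q) = 1\<close> dual_chain_zm[of a b c d] by auto
    qed
  qed
  show "q = q'" if q: "dual_chain T d (p, q) = 1" and q': "dual_chain T d (p, q') = 1" for p q q'
    using one[OF q]
  proof (elim disjE exE conjE)
    fix a b c assume p: "(a, b, c) \<in> pos T" "d (a, b) = 1" "p = bary {a, b, c}" "q = bary {a, b}"
    from one[OF q'] p obtain a' b' c' where p': "(a', b', c') \<in> pos T" "d (a', b') = 1" "p = bary {a', b', c'}" "q' = bary {a', b'}"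
      by auto
    have "a' = a \<and> b' = b \<and> c' = c \<or> a' = b \<and> b' = c \<and> c' = a \<or> a' = c \<and> b' = a \<and> c' = b"
      using bary_pos_eq[OF p(1) p'(1)] p(3) p'(3) by simp
    moreover have "\<not> (d (a, b) = 1 \<and> d (b, c) = 1)" "\<not> (d (a, b) = 1 \<and> d (c, a) = 1)"
      using sum0[OF p(1)] d1[of "(a, b)"] d1[of "(b, c)"] d1[of "(c, a)"] by linarith+
    ultimately show "q = q'" using p p' by auto
  next
    fix a b c assume p: "(a, b, c) \<in> pos T" "d (a, b) = - 1" "p = bary {a, b}" "q = bary {a, b, c}"
    from one[OF q'] p obtain a' b' c' where p': "(a', b', c') \<in> pos T" "d (a', b') = - 1" "p = bary {a', b'}" "q' = bary {a', b', c'}"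
      by auto
    have "a' = a \<and> b' = b \<or> a' = b \<and> b' = a" using p(3) p'(3) by auto
    moreover have "\<not> (a' = b \<and> b' = a)" using p(2) p'(2) as[of a b] by auto
    ultimately have "a' = a" "b' = b" by auto
    then show "q = q'" using uniq[of a b c c'] p p' by auto
  qed
  show "\<exists>r. dual_chain T d (p, r) = - 1" if q: "dual_chain T d (p, q) = 1" for p q
    using one[OF q]
  proof (elim disjE exE conjE)
    fix a b c assume p: "(a, b, c) \<in> pos T" "d (a, b) = 1" "p = bary {a, b, c}" "q = bary {a, b}"
    have "d (b, c) = - 1 \<or> d (c, a) = - 1"
      using sum0[OF p(1)] p(2) d1[of "(b, c)"] d1[of "(c, a)"] by linarith
    moreover have "p = bary {b, c, a}" "p = bary {c, a, b}" using p(3) by (simp_all add: insert_commute)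
    ultimately show ?thesis
      using dual_chain_zm(1)[OF rot[OF p(1)], of d] dual_chain_zm(1)[OF rot2[OF p(1)], of d] by metis
  next
    fix a b c assume p: "(a, b, c) \<in> pos T" "d (a, b) = - 1" "p = bary {a, b}" "q = bary {a, b, c}"
    then have "d (a, b) \<noteq> 0" by simp
    then obtain c' where c': "(b, a, c') \<in> pos T" using d unfolding cocycle_def by blast
    have "p = bary {b, a}" using p(3) by (simp add: insert_commute)
    then show ?thesis
      using dual_chain_zm(2)[OF c', of d] as[of a b] p(2) by auto
  qed
qed

lemma dual_chain_minus: "dual_chain T (\<lambda>e. - d e) = (\<lambda>e. - dual_chain T d e)"
  by (rule ext) (simp add: dual_chain_def split_def sum_negf)

lemma simple_dual:
  assumes d: "cocycle T d" and d1: "\<And>e. \<bar>d e\<bar> \<le> 1"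
  shows "simple_chain (dual_chain T d)"
  unfolding simple_chain_def
proof (intro conjI allI)
  have "cocycle T (\<lambda>e. - d e)"
    unfolding cocycle_def
  proof (intro conjI allI impI)
    show "antisym_chain (\<lambda>e. - d e)"
      using d antisym_chain_minus unfolding cocycle_def by blast
    show "- d (a, b) + - d (b, c) + - d (c, a) = 0" if "(a, b, c) \<in> pos T" for a b c
    proof -
      have "d (a, b) + d (b, c) + d (c, a) = 0" using d that unfolding cocycle_def by blast
      then show ?thesis by linarith
    qed
    show "\<exists>c. (a, b, c) \<in> pos T" "\<exists>c. (b, a, c) \<in> pos T" if "- d (a, b) \<noteq> 0" for a b
      using d that unfolding cocycle_def by auto
  qed
  then show "flow_line (\<lambda>e. - dual_chain T d e)"
    using flow_line_dual[of "\<lambda>e. - d e"] d1 by (simp add: dual_chain_minus)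
  show "\<bar>dual_chain T d e\<bar> \<le> 1" for e
  proof (cases "dual_chain T d e = 0")
    case False
    obtain p q where e: "e = (p, q)" by (cases e)
    show ?thesis using False unfolding e
      by (cases rule: dual_chain_nonzero) (use d1 in \<open>auto simp: dual_chain_zm\<close>)
  qed simp
qed (use antisym_dual_chain flow_line_dual[OF d d1] in auto)

lemma dual_chain_edges:
  assumes "dual_chain T d (p, q) \<noteq> 0"
  shows "{p, q} \<in> edges (sd T)"
  using assms
proof (cases rule: dual_chain_nonzero)
  case (1 a b c)
  then show ?thesis using tri_surf.tri_edges[OF tri_surf_sd sd_posI(5)[OF 1(1)]] by simp
next
  case (2 a b c)
  then show ?thesis using tri_surf.tri_edges[OF tri_surf_sd sd_posI(2)[OF 2(1)]] by simp
qed

lemma sd_chain_nonzero: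
  assumes x: "antisym_chain x" and nz: "sd_chain T x (p, q) \<noteq> 0"
  obtains a b where "{a, b} \<in> edges T" "x (a, b) \<noteq> 0" "p = bary {a}" "q = bary {a, b}"
  | a b where "{a, b} \<in> edges T" "x (a, b) \<noteq> 0" "p = bary {a, b}" "q = bary {a}"
proof -
  obtain e where "e \<in> {(a, b). {a, b} \<in> edges T}" "(case e of (a, b) \<Rightarrow> x (a, b) * arc_chain (bary {a}, bary {a, b}) (p, q)) \<noteq> 0"
    using nz unfolding sd_chain_ordered[OF x] by (meson sum.neutral)
  moreover obtain a b where "e = (a, b)" by (cases e)
  ultimately have "{a, b} \<in> edges T" "x (a, b) \<noteq> 0" "arc_chain (bary {a}, bary {a, b}) (p, q) \<noteq> 0" by auto
  moreover from this(3) have "(p = bary {a} \<and> q = bary {a, b}) \<or> (p = bary {a, b} \<and> q = bary {a})"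
    by (auto simp: arc_chain_def of_bool_def split: if_splits)
  ultimately show ?thesis using that by blast
qed

lemma half_edge: "{a, b} \<in> edges T \<Longrightarrow> {bary {a}, bary {a, b}} \<in> edges (sd T)"
proof -
  assume "{a, b} \<in> edges T"
  then obtain c where "(a, b, c) \<in> pos T \<or> (b, a, c) \<in> pos T" using edge_pos by blast
  then show ?thesis
  proof
    assume "(a, b, c) \<in> pos T"
    from tri_surf.tri_edges[OF tri_surf_sd sd_posI(1)[OF this]] show ?thesis by blast
  next
    assume "(b, a, c) \<in> pos T"
    from tri_surf.tri_edges[OF tri_surf_sd sd_posI(6)[OF this]] show ?thesis by (simp add: insert_commute)
  qed
qed

lemma sd_chain_edges:
  assumes "antisym_chain x" "sd_chain T x (p, q) \<noteq> 0"
  shows "{p, q} \<in> edges (sd T)"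
  using assms by (cases rule: sd_chain_nonzero) (use half_edge in \<open>auto simp: insert_commute\<close>)

lemma flow_line_sd:
  assumes x: "antisym_chain x" "flow_line x" and ed: "\<And>p q. x (p, q) \<noteq> 0 \<Longrightarrow> {p, q} \<in> edges T"
  shows "flow_line (sd_chain T x)"
  unfolding flow_line_def
proof (intro conjI allI impI)
  have as: "x (b, a) = - x (a, b)" for a b using antisym_chainD[OF x(1)] .
  have vm: "sd_chain T x (bary {a, b}, bary {b}) = x (a, b)" if "{a, b} \<in> edges T" for a b
    using sd_chain_vm(2)[OF x(1), of b a] that as[of a b] by (simp add: insert_commute)
  have one: "(\<exists>a b. x (a, b) = 1 \<and> p = bary {a} \<and> q = bary {a, b}) \<or>
      (\<exists>a b. x (a, b) = 1 \<and> p = bary {a, b} \<and> q = bary {b})" if 1: "sd_chain T x (p, q) = 1" for p q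
  proof -
    have "sd_chain T x (p, q) \<noteq> 0" using 1 by simp
    with x(1) show ?thesis
    proof (cases rule: sd_chain_nonzero)
      case (1 a b)
      then show ?thesis using that sd_chain_vm(1)[OF x(1) 1(1)] by auto
    next
      case (2 a b)
      then have "x (b, a) = 1" using that sd_chain_vm(2)[OF x(1) 2(1)] as[of a b] by simp
      then show ?thesis using 2 by (intro disjI2 exI[of _ b] exI[of _ a]) (simp add: insert_commute)
    qed
  qed
  have ab: "a \<noteq> b \<and> {a, b} \<in> edges T" if "x (a, b) = 1" for a b
    using ed[of a b] that edge_neq by auto
  show "q = q'" if q: "sd_chain T x (p, q) = 1" and q': "sd_chain T x (p, q') = 1" for p q q'
    using one[OF q]
  proof (elim disjE exE conjE)
    fix a b assume p: "x (a, b) = 1" "p = bary {a}" "q = bary {a, b}"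
    from one[OF q'] p obtain b' where p': "x (a, b') = 1" "q' = bary {a, b'}"
      using ab by fastforce
    then show "q = q'" using p x(2) unfolding flow_line_def by blast
  next
    fix a b assume p: "x (a, b) = 1" "p = bary {a, b}" "q = bary {b}"
    from one[OF q'] p obtain a' b' where p': "x (a', b') = 1" "p = bary {a', b'}" "q' = bary {b'}"
      using ab[OF p(1)] by auto
    then have "a' = a \<and> b' = b \<or> a' = b \<and> b' = a" using p(2) by auto
    moreover have "\<not> (a' = b \<and> b' = a)" using p(1) p'(1) as[of a b] by auto
    ultimately show "q = q'" using p p' by auto
  qed
  show "\<exists>r. sd_chain T x (p, r) = - 1" if q: "sd_chain T x (p, q) = 1" for p q
    using one[OF q]
  proof (elim disjE exE conjE)
    fix a b assume p: "x (a, b) = 1" "p = bary {a}" "q = bary {a, b}"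
    then obtain r where r: "x (a, r) = - 1" using x(2) unfolding flow_line_def by blast
    then have "{a, r} \<in> edges T" using ed[of a r] by simp
    then show ?thesis using sd_chain_vm(1)[OF x(1)] r p by metis
  next
    fix a b assume p: "x (a, b) = 1" "p = bary {a, b}" "q = bary {b}"
    then show ?thesis using sd_chain_vm(2)[OF x(1), of a b] ab[OF p(1)] by auto
  qed
qed

lemma simple_sd:
  assumes x: "simple_chain x" and ed: "\<And>p q. x (p, q) \<noteq> 0 \<Longrightarrow> {p, q} \<in> edges T"
  shows "simple_chain (sd_chain T x)"
  unfolding simple_chain_def
proof (intro conjI allI)
  have as: "antisym_chain x" and le: "\<And>e. \<bar>x e\<bar> \<le> 1" and fl: "flow_line x" "flow_line (\<lambda>e. - x e)"
    using x unfolding simple_chain_def by blast+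
  show "antisym_chain (sd_chain T x)" by (rule antisym_sd_chain)
  show "flow_line (sd_chain T x)" by (rule flow_line_sd[OF as fl(1) ed])
  have "antisym_chain (\<lambda>e. - x e)" using as by (rule antisym_chain_minus)
  moreover have "sd_chain T (\<lambda>e. - x e) = (\<lambda>e. - sd_chain T x e)"
    by (rule ext) (simp add: sd_chain_def split_def sum_negf)
  ultimately show "flow_line (\<lambda>e. - sd_chain T x e)"
    using flow_line_sd[of "\<lambda>e. - x e"] fl(2) ed by simp
  show "\<bar>sd_chain T x e\<bar> \<le> 1" for e
  proof (cases "sd_chain T x e = 0")
    case False
    obtain p q where e: "e = (p, q)" by (cases e)
    show ?thesis using as False unfolding e
      by (cases rule: sd_chain_nonzero) (use le sd_chain_vm[OF as] in auto)
  qed simp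
qed

lemma finite_edges_chain:
  assumes "\<And>p q. x (p, q) \<noteq> 0 \<Longrightarrow> {p, q} \<in> edges T"
  shows "finite {e. x e = (1 :: int)}"
  by (rule finite_subset[OF _ finite_edge_pairs]) (use assms in auto)

end


section \<open>Transverse representatives\<close>

lemma mod_pred_Suc:
  fixes k n :: nat
  assumes "k < n"
  shows "Suc ((k + n - 1) mod n) mod n = k" "(Suc k mod n + n - 1) mod n = k"
proof -
  show "Suc ((k + n - 1) mod n) mod n = k"
    using assms by (cases k) (simp_all add: mod_simps)
  show "(Suc k mod n + n - 1) mod n = k"
    using assms by (cases "Suc k = n") auto
qed

lemma finite_strands: "finite (strands cs)"
  by (simp add: strands_def)

lemma strands_append: "strands (cs @ ds) = strands cs \<union> strands ds"
  by (simp add: strands_def)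

lemma strands_arcs:
  assumes "(p, v, q) \<in> strands cs"
  shows "(p, v) \<in> set (concat (map arcs cs))" "(v, q) \<in> set (concat (map arcs cs))"
  using assms strand_arcs unfolding strands_def by fastforce+

lemma distinct_undirected:
  assumes "distinct xs" "\<And>a b. (a, b) \<in> set xs \<Longrightarrow> (b, a) \<notin> set xs"
  shows "distinct (map (\<lambda>(u, v). {u, v}) xs)"
  unfolding distinct_map
proof (intro conjI assms(1) inj_onI)
  fix e f assume ef: "e \<in> set xs" "f \<in> set xs" "(case e of (u, v) \<Rightarrow> {u, v}) = (case f of (u, v) \<Rightarrow> {u, v})"
  obtain a b c d where "e = (a, b)" "f = (c, d)" by (cases e; cases f)
  with ef assms(2)[of a b] show "e = f" by (auto simp: doubleton_eq_iff)
qed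

lemma transverseI:
  assumes n: "normal_curve S (cs @ ds)" and "cs \<noteq> []" "ds \<noteq> []"
  shows "transverse S cs ds"
proof -
  have le: "card {s \<in> strands es. mid s = v} \<le> 2" if "strands es \<subseteq> strands (cs @ ds)" for es v
  proof -
    have "card {s \<in> strands es. mid s = v} \<le> card {s \<in> strands (cs @ ds). mid s = v}"
      by (rule card_mono) (use that finite_strands in auto)
    then show ?thesis using n unfolding normal_curve_def by (meson order_trans)
  qed
  have sub: "normal_curve S es"
    if es: "es \<noteq> []" "set es \<subseteq> set (cs @ ds)" "distinct (map (\<lambda>(u, v). {u, v}) (concat (map arcs es)))" for es
  proof -
    have st: "strands es \<subseteq> strands (cs @ ds)" using es(2) unfolding strands_def by blast
    have "\<forall>c\<in>set (cs @ ds). c \<noteq> []" "\<forall>c\<in>set (cs @ ds). \<forall>(u, v)\<in>set (arcs c). {u, v} \<in> edges S"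
      "\<forall>s\<in>strands (cs @ ds). \<forall>t\<in>strands (cs @ ds). s \<noteq> t \<and> mid s = mid t \<longrightarrow>
        interior_vertex S (mid s) \<and> (crossed_lr S s t \<or> crossed_lr S t s)"
      using n unfolding normal_curve_def by blast+
    then have 1: "\<forall>c\<in>set es. c \<noteq> []" and 2: "\<forall>c\<in>set es. \<forall>(u, v)\<in>set (arcs c). {u, v} \<in> edges S"
      and 3: "\<forall>s\<in>strands es. \<forall>t\<in>strands es. s \<noteq> t \<and> mid s = mid t \<longrightarrow>
        interior_vertex S (mid s) \<and> (crossed_lr S s t \<or> crossed_lr S t s)"
      using es(2) st by (meson subsetD)+
    show ?thesis
      unfolding normal_curve_def using es(1,3) 1 2 3 le[OF st] by simp
  qed
  have "distinct (map (\<lambda>(u, v). {u, v}) (concat (map arcs cs)))" "distinct (map (\<lambda>(u, v). {u, v}) (concat (map arcs ds)))"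
    using n unfolding normal_curve_def map_append concat_append distinct_append by blast+
  then have "normal_curve S cs" "normal_curve S ds"
    using sub assms(2,3) by simp_all
  then show ?thesis using n unfolding transverse_def by blast
qed

lemma simple_chain_through:
  assumes "simple_chain X" "X (p, v) = 1" "X (v, q) = 1" "X (p', v) = 1" "X (v, q') = 1"
  shows "p = p'" "q = q'" "p \<noteq> q"
proof -
  have as: "antisym_chain X" and fl: "flow_line X" "flow_line (\<lambda>e. - X e)"
    using assms(1) unfolding simple_chain_def by blast+
  show "q = q'" using fl(1) assms unfolding flow_line_def by blast
  have "- X (v, p) = 1" "- X (v, p') = 1"
    using antisym_chainD[OF as, of v p] antisym_chainD[OF as, of v p'] assms by simp_all
  then show "p = p'" using fl(2) unfolding flow_line_def by blast
  show "p \<noteq> q" using \<open>- X (v, p) = 1\<close> assms(3) by auto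
qed

context tri_surf
begin

lemma transverse_sd:
  assumes x: "simple_chain x" and ed: "\<And>p q. x (p, q) \<noteq> 0 \<Longrightarrow> {p, q} \<in> edges T" and x0: "\<exists>e. x e \<noteq> 0"
    and d: "cocycle T d" and d1: "\<And>e. \<bar>d e\<bar> \<le> 1" and d0: "\<exists>e. d e \<noteq> 0"
  shows "\<exists>cs ds. transverse (sd T) cs ds \<and> curve_chain cs = sd_chain T x \<and> curve_chain ds = dual_chain T d"
proof -
  interpret U: tri_surf "sd T" by (rule tri_surf_sd)
  let ?X = "sd_chain T x" and ?Y = "dual_chain T d"
  have asx: "antisym_chain x" using x unfolding simple_chain_def by blast
  have sX: "simple_chain ?X" by (rule simple_sd[OF x ed])
  have sY: "simple_chain ?Y" by (rule simple_dual[OF d d1])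
  have eX: "{p, q} \<in> edges (sd T)" if "?X (p, q) \<noteq> 0" for p q using sd_chain_edges[OF asx that] .
  have eY: "{p, q} \<in> edges (sd T)" if "?Y (p, q) \<noteq> 0" for p q using dual_chain_edges[OF that] .
  obtain cs where cs: "curve_chain cs = ?X" "distinct (concat (map arcs cs))"
    "set (concat (map arcs cs)) = {e. ?X e = 1}" "\<forall>c\<in>set cs. c \<noteq> []"
    using simple_chain_curves[OF sX U.finite_edges_chain[OF eX]] by blast
  obtain ds where ds: "curve_chain ds = ?Y" "distinct (concat (map arcs ds))"
    "set (concat (map arcs ds)) = {e. ?Y e = 1}" "\<forall>c\<in>set ds. c \<noteq> []"
    using simple_chain_curves[OF sY U.finite_edges_chain[OF eY]] by blast
  have stX: "?X (p, v) = 1 \<and> ?X (v, q) = 1" if "(p, v, q) \<in> strands cs" for p v q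
    using strands_arcs[OF that] cs(3) by blast
  have stY: "?Y (p, v) = 1 \<and> ?Y (v, q) = 1" if "(p, v, q) \<in> strands ds" for p v q
    using strands_arcs[OF that] ds(3) by blast
  have uX: "s = s'" if ss: "s \<in> strands cs" "s' \<in> strands cs" "mid s = mid s'" for s s'
  proof -
    obtain p v q p' q' where s: "s = (p, v, q)" "s' = (p', v, q')"
      using ss(3) by (cases s; cases s') auto
    have a: "?X (p, v) = 1" "?X (v, q) = 1" "?X (p', v) = 1" "?X (v, q') = 1"
      using ss(1,2) stX s by auto
    show ?thesis using simple_chain_through(1,2)[OF sX a] s by simp
  qed
  have uY: "s = s'" if ss: "s \<in> strands ds" "s' \<in> strands ds" "mid s = mid s'" for s s'
  proof -
    obtain p v q p' q' where s: "s = (p, v, q)" "s' = (p', v, q')"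
      using ss(3) by (cases s; cases s') auto
    have a: "?Y (p, v) = 1" "?Y (v, q) = 1" "?Y (p', v) = 1" "?Y (v, q') = 1"
      using ss(1,2) stY s by auto
    show ?thesis using simple_chain_through(1,2)[OF sY a] s by simp
  qed
  have mixed: "interior_vertex (sd T) v \<and> (crossed_lr (sd T) (p, v, q) (p', v, q') \<or> crossed_lr (sd T) (p', v, q') (p, v, q))"
    if s: "(p, v, q) \<in> strands cs" and t: "(p', v, q') \<in> strands ds" for p v q p' q'
  proof -
    have X: "?X (p, v) = 1" "?X (v, q) = 1" "?X (p, v) \<noteq> 0" "?X (v, q) \<noteq> 0" and Y: "?Y (p', v) = 1" "?Y (v, q') = 1"
      "?Y (p', v) \<noteq> 0" "?Y (v, q') \<noteq> 0"
      using stX[OF s] stY[OF t] by auto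
    have neq: "p \<noteq> q" "p' \<noteq> q'"
      using simple_chain_through(3)[OF sX X(1,2) X(1,2)] simple_chain_through(3)[OF sY Y(1,2) Y(1,2)] .
    have vX: "\<exists>a b. v = bary {a, b}"
      using asx X(4)
    proof (cases rule: sd_chain_nonzero)
      case (1 a b)
      then have "v = bary {a, a}" by simp
      then show ?thesis by blast
    qed blast
    from Y(4) show ?thesis
    proof (cases rule: dual_chain_nonzero)
      case (1 a b c)
      then show ?thesis using vX by auto
    next
      case (2 a b c)
      have ab: "a \<noteq> b" using pos_distinct[OF 2(1)] by simp
      obtain c' where c': "(b, a, c') \<in> pos T" using d 2(2) unfolding cocycle_def by blast
      have q: "q = bary {a} \<or> q = bary {b}"
        using asx X(4) by (cases rule: sd_chain_nonzero) (use 2 ab in auto)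
      have p: "p = bary {a} \<or> p = bary {b}"
        using asx X(3) by (cases rule: sd_chain_nonzero) (use 2 ab in auto)
      have p': "p' = bary {a, b, c} \<or> p' = bary {b, a, c'}"
        using Y(3)
      proof (cases rule: dual_chain_nonzero)
        case (1 a1 b1 c1)
        then have "a1 = a \<and> b1 = b \<or> a1 = b \<and> b1 = a" using 2 by auto
        then show ?thesis using 1 2 uniq[of a b c c1] uniq[of b a c' c1] c' by auto
      next
        case (2 a1 b1 c1)
        then show ?thesis using \<open>v = bary {a, b}\<close> by auto
      qed
      show ?thesis
        unfolding 2(3) using interior_midpoint[OF 2(1) c'] cross_midpoint[OF 2(1) c', of p q p' q'] p q p' 2(4) neq
        by auto
    qed
  qed
  have distc: "distinct (map (\<lambda>(u, v). {u, v}) (concat (map arcs (cs @ ds))))"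
  proof (rule distinct_undirected)
    have "?X e \<noteq> 1 \<or> ?Y e \<noteq> 1" and XY: "?X (a, b) \<noteq> 1 \<or> ?Y (b, a) \<noteq> 1" for e a b
    proof -
      have *: "\<not> (?X (p, q) \<noteq> 0 \<and> (?Y (p, q) \<noteq> 0 \<or> ?Y (q, p) \<noteq> 0))" for p q
      proof
        assume a: "?X (p, q) \<noteq> 0 \<and> (?Y (p, q) \<noteq> 0 \<or> ?Y (q, p) \<noteq> 0)"
        have "\<exists>a b. p = bary {a, b}" "\<exists>a b. q = bary {a, b}"
        proof -
          have "bary {a} = bary {a, a}" for a by simp
          then show "\<exists>a b. p = bary {a, b}" "\<exists>a b. q = bary {a, b}"
            using sd_chain_nonzero[OF asx, of p q] a by metis+
        qed
        moreover have "\<exists>a b c. (a, b, c) \<in> pos T \<and> (p = bary {a, b, c} \<or> q = bary {a, b, c})"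
          using a dual_chain_nonzero[of d p q] dual_chain_nonzero[of d q p] by metis
        ultimately show False by auto
      qed
      show "?X e \<noteq> 1 \<or> ?Y e \<noteq> 1" using *[of "fst e" "snd e"] by auto
      show "?X (a, b) \<noteq> 1 \<or> ?Y (b, a) \<noteq> 1" using *[of a b] by auto
    qed
    then show "distinct (concat (map arcs (cs @ ds)))"
      using cs(2,3) ds(2,3) by auto
    have "?X (a, b) = 1 \<Longrightarrow> ?X (b, a) \<noteq> 1" "?Y (a, b) = 1 \<Longrightarrow> ?Y (b, a) \<noteq> 1" for a b
      using antisym_chainD[OF antisym_sd_chain, of x b a] antisym_chainD[OF antisym_dual_chain, of d b a] by auto
    then show "(b, a) \<notin> set (concat (map arcs (cs @ ds)))" if "(a, b) \<in> set (concat (map arcs (cs @ ds)))" for a b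
    proof -
      have su: "set (concat (map arcs (cs @ ds))) = {e. ?X e = 1} \<union> {e. ?Y e = 1}"
        by (simp only: map_append concat_append set_append cs(3) ds(3))
      show ?thesis
        using that XY[of a b] XY[of b a] \<open>\<And>b a. ?X (a, b) = 1 \<Longrightarrow> ?X (b, a) \<noteq> 1\<close>
          \<open>\<And>b a. ?Y (a, b) = 1 \<Longrightarrow> ?Y (b, a) \<noteq> 1\<close> unfolding su by blast
    qed
  qed
  have "?X (bary {a}, bary {a, b}) \<noteq> 0" if "x (a, b) \<noteq> 0" for a b
    using sd_chain_vm(1)[OF asx ed[OF that]] that by simp
  then have "cs \<noteq> []" using x0 cs(1) by (auto simp: curve_chain_def fun_eq_iff)
  moreover have "ds \<noteq> []"
  proof -
    obtain a b where ab: "d (a, b) \<noteq> 0" using d0 by auto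
    then obtain c where "(a, b, c) \<in> pos T" using d unfolding cocycle_def by blast
    then have "?Y (bary {a, b, c}, bary {a, b}) \<noteq> 0" using dual_chain_zm ab by simp
    then show ?thesis using ds(1) by (auto simp: curve_chain_def fun_eq_iff)
  qed
  moreover have "normal_curve (sd T) (cs @ ds)"
    unfolding normal_curve_def
  proof (intro conjI allI)
    show "cs @ ds \<noteq> []" using \<open>cs \<noteq> []\<close> by simp
    show "\<forall>c\<in>set (cs @ ds). c \<noteq> []" using cs(4) ds(4) by auto
    show "\<forall>c\<in>set (cs @ ds). \<forall>(u, v)\<in>set (arcs c). {u, v} \<in> edges (sd T)"
    proof (intro ballI)
      fix c e assume c: "c \<in> set (cs @ ds)" and e: "e \<in> set (arcs c)"
      then have "e \<in> set (concat (map arcs cs)) \<union> set (concat (map arcs ds))" by auto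
      then have "?X e = 1 \<or> ?Y e = 1" unfolding cs(3) ds(3) by auto
      then show "case e of (u, v) \<Rightarrow> {u, v} \<in> edges (sd T)"
        using eX[of "fst e" "snd e"] eY[of "fst e" "snd e"] by (cases e) auto
    qed
    show "distinct (map (\<lambda>(u, v). {u, v}) (concat (map arcs (cs @ ds))))" by (rule distc)
    show "card {s \<in> strands (cs @ ds). mid s = v} \<le> 2" for v
    proof -
      have fin: "finite {s \<in> strands es. mid s = v}" for es using finite_strands[of es] by simp
      have "card {s \<in> strands cs. mid s = v} \<le> Suc 0"
        unfolding card_le_Suc0_iff_eq[OF fin] by (intro ballI uX) simp_all
      moreover have "card {s \<in> strands ds. mid s = v} \<le> Suc 0"
        unfolding card_le_Suc0_iff_eq[OF fin] by (intro ballI uY) simp_all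
      moreover have eq: "{s \<in> strands (cs @ ds). mid s = v} = {s \<in> strands cs. mid s = v} \<union> {s \<in> strands ds. mid s = v}"
        by (auto simp: strands_append)
      ultimately show ?thesis
        unfolding eq using card_Un_le[of "{s \<in> strands cs. mid s = v}" "{s \<in> strands ds. mid s = v}"] by linarith
    qed
    show "\<forall>s\<in>strands (cs @ ds). \<forall>t\<in>strands (cs @ ds). s \<noteq> t \<and> mid s = mid t \<longrightarrow>
        interior_vertex (sd T) (mid s) \<and> (crossed_lr (sd T) s t \<or> crossed_lr (sd T) t s)"
    proof (intro ballI impI)
      fix s t assume st: "s \<in> strands (cs @ ds)" "t \<in> strands (cs @ ds)" "s \<noteq> t \<and> mid s = mid t"
      obtain p v q p' q' where s: "s = (p, v, q)" "t = (p', v, q')"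
        using st(3) by (cases s; cases t) auto
      consider "s \<in> strands cs" "t \<in> strands ds" | "t \<in> strands cs" "s \<in> strands ds"
        using st uX uY unfolding strands_append by blast
      then show "interior_vertex (sd T) (mid s) \<and> (crossed_lr (sd T) s t \<or> crossed_lr (sd T) t s)"
      proof cases
        case 1
        then show ?thesis using mixed[of p v q p' q'] s by simp
      next
        case 2
        then show ?thesis using mixed[of p' v q' p q] s by auto
      qed
    qed
  qed
  ultimately show ?thesis using transverseI cs(1) ds(1) by blast
qed

end

lemma transverse_exists:
  assumes S: "oriented_surface S" and z: "z \<in> cycles1 S" and z': "z' \<in> cycles1 S"
  shows "\<exists>m cs ds. transverse ((sd ^^ m) S) cs ds \<and>
    homologous ((sd ^^ m) S) (sd_chain_iter S m z) (curve_chain cs) \<and>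
    homologous ((sd ^^ m) S) (sd_chain_iter S m z') (curve_chain ds)"
proof -
  interpret tri_surf S by (rule tri_surf_of_oriented[OF S])
  have "faces S \<noteq> {}" using S unfolding oriented_surface_def two_manifold_def by blast
  then have ne: "pos S \<noteq> {}" unfolding faces_pos by auto
  have as: "antisym_chain z" "antisym_chain z'"
    using z z' unfolding cycles1_def antisym_chain_def by blast+
  obtain F F' where F: "potential S F z" "potential S F' z'"
    using potential_exists[OF S z] potential_exists[OF S z'] by blast
  obtain k where k: "\<forall>j\<ge>k. \<exists>d. dual_rep S z j d \<and> (\<forall>e. \<bar>d e\<bar> \<le> 1) \<and> (\<exists>e. d e \<noteq> 0)"
    using dual_rep_exists[OF F(1) as(1) ne] by blast
  obtain k' where k': "\<forall>j\<ge>k'. \<exists>d. dual_rep S z' j d \<and> (\<forall>e. \<bar>d e\<bar> \<le> 1) \<and> (\<exists>e. d e \<noteq> 0)"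
    using dual_rep_exists[OF F(2) as(2) ne] by blast
  define K where "K = max k k'"
  obtain d where d: "dual_rep S z K d" "\<forall>e. \<bar>d e\<bar> \<le> 1" "\<exists>e. d e \<noteq> 0"
  proof -
    have "K \<ge> k" by (simp add: K_def)
    then show ?thesis using k that by blast
  qed
  have "Suc K \<ge> k'" by (simp add: K_def)
  then obtain d' where d': "dual_rep S z' (Suc K) d'" "\<forall>e. \<bar>d' e\<bar> \<le> 1" "\<exists>e. d' e \<noteq> 0"
    using k' by blast
  interpret U: tri_surf "(sd ^^ K) S" by (rule tri_surf_iter)
  interpret V: tri_surf "sd ((sd ^^ K) S)" by (rule U.tri_surf_sd)
  let ?x = "dual_chain ((sd ^^ K) S) d"
  have cd: "cocycle ((sd ^^ K) S) d" and hd: "homologous (sd ((sd ^^ K) S)) ?x (sd_chain_iter S (Suc K) z)"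
    using d(1) unfolding dual_rep_def by simp_all
  have cd': "cocycle (sd ((sd ^^ K) S)) d'"
    and hd': "homologous ((sd ^^ Suc (Suc K)) S) (dual_chain (sd ((sd ^^ K) S)) d') (sd_chain_iter S (Suc (Suc K)) z')"
    using d'(1) unfolding dual_rep_def by simp_all
  obtain a b where ab: "d (a, b) \<noteq> 0" using d(3) by auto
  then obtain c where "(a, b, c) \<in> pos ((sd ^^ K) S)" using cd unfolding cocycle_def by blast
  then have x0: "\<exists>e. ?x e \<noteq> 0" using U.dual_chain_zm(1)[of a b c d] ab by metis
  obtain cs ds where c: "transverse (sd (sd ((sd ^^ K) S))) cs ds"
    "curve_chain cs = sd_chain (sd ((sd ^^ K) S)) ?x" "curve_chain ds = dual_chain (sd ((sd ^^ K) S)) d'"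
  proof -
    have "\<And>e. \<bar>d e\<bar> \<le> 1" "\<And>e. \<bar>d' e\<bar> \<le> 1" using d(2) d'(2) by blast+
    from V.transverse_sd[OF U.simple_dual[OF cd this(1)] _ x0 cd' this(2) d'(3)]
    show ?thesis using U.dual_chain_edges that by blast
  qed
  have "homologous ((sd ^^ Suc (Suc K)) S) (sd_chain_iter S (Suc (Suc K)) z) (curve_chain cs)"
    using V.homologous_sd[OF hd] c(2) homologous_sym by simp
  moreover have "homologous ((sd ^^ Suc (Suc K)) S) (sd_chain_iter S (Suc (Suc K)) z') (curve_chain ds)"
    using hd' c(3) homologous_sym by simp
  ultimately show ?thesis using c(1) by (intro exI[of _ "Suc (Suc K)"] exI[of _ cs] exI[of _ ds]) simp
qed


section \<open>Intersection numbers as pairings\<close>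

lemma arcs_strand_list: "arcs c = map snd (strand_list c)"
  unfolding arcs_nth strand_list_nth by simp

lemma sum_arcs_rotate:
  "(\<Sum>(p, q)\<leftarrow>arcs c. f p q) = (\<Sum>(x, v, y)\<leftarrow>strand_list c. f x v)"
  for f :: "nat \<Rightarrow> nat \<Rightarrow> 'a :: comm_monoid_add"
proof -
  have "(\<Sum>k\<in>{..<length c}. f (c ! k) (c ! (Suc k mod length c))) =
      (\<Sum>k\<in>{..<length c}. f (c ! ((k + length c - 1) mod length c)) (c ! k))"
    by (rule sum.reindex_bij_witness[of _ "\<lambda>k. (k + length c - 1) mod length c" "\<lambda>k. Suc k mod length c"])
      (auto simp: mod_pred_Suc intro!: mod_less_divisor simp del: One_nat_def)
  then show ?thesis
    unfolding arcs_nth strand_list_nth by (simp add: o_def interv_sum_list_conv_sum_set_nat atLeast0LessThan)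
qed

lemma distinct_concat_strands:
  assumes "distinct (concat (map arcs cs))"
  shows "distinct (concat (map strand_list cs))"
proof -
  have "concat (map arcs cs) = map snd (concat (map strand_list cs))"
    by (induction cs) (simp_all add: arcs_strand_list)
  then show ?thesis using assms by (metis distinct_map)
qed

lemma sum_concat_map: "(\<Sum>a\<leftarrow>concat (map f cs). g a) = (\<Sum>c\<leftarrow>cs. \<Sum>a\<leftarrow>f c. g a)"
  for g :: "'a \<Rightarrow> 'b :: comm_monoid_add"
  by (induction cs) simp_all

lemma arc_chain_at: "arc_chain e (v, u) = of_bool (fst e = v \<and> snd e = u) - of_bool (snd e = v \<and> fst e = u)"
  by (cases e; cases "fst e = v"; cases "snd e = u"; cases "snd e = v"; cases "fst e = u") (simp_all add: arc_chain_def)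

lemma curve_chain_strands:
  assumes "distinct (concat (map arcs cs))"
  shows "curve_chain cs (v, u) =
    (\<Sum>s\<in>strands cs. of_bool (mid s = v) * (of_bool (u = snd (snd s)) - of_bool (u = fst s)))"
proof -
  have "(\<Sum>a\<leftarrow>arcs c. arc_chain a (v, u)) =
      (\<Sum>s\<leftarrow>strand_list c. of_bool (mid s = v) * (of_bool (u = snd (snd s)) - of_bool (u = fst s)))" for c
  proof -
    have "(\<Sum>a\<leftarrow>arcs c. arc_chain a (v, u)) =
        (\<Sum>(p, q)\<leftarrow>arcs c. of_bool (p = v \<and> q = u)) - (\<Sum>(p, q)\<leftarrow>arcs c. of_bool (q = v \<and> p = u))"
      unfolding sum_list_subtractf[symmetric]
      by (simp add: split_def arc_chain_at)
    also have "(\<Sum>(p, q)\<leftarrow>arcs c. of_bool (q = v \<and> p = u)) = (\<Sum>(x, w, y)\<leftarrow>strand_list c. of_bool (w = v \<and> x = u) :: int)"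
      by (rule sum_arcs_rotate)
    also have "(\<Sum>(p, q)\<leftarrow>arcs c. of_bool (p = v \<and> q = u)) = (\<Sum>(x, w, y)\<leftarrow>strand_list c. of_bool (w = v \<and> y = u) :: int)"
      unfolding arcs_strand_list by (simp add: o_def split_def)
    finally show ?thesis
      unfolding sum_list_subtractf[symmetric]
      by (simp only: split_def) (rule arg_cong[where f = sum_list], rule map_cong[OF refl], auto)
  qed
  then have "curve_chain cs (v, u) = (\<Sum>s\<leftarrow>concat (map strand_list cs). of_bool (mid s = v) * (of_bool (u = snd (snd s)) - of_bool (u = fst s)))"
    unfolding curve_chain_def sum_concat_map by simp
  also have "\<dots> = (\<Sum>s\<in>set (concat (map strand_list cs)). of_bool (mid s = v) * (of_bool (u = snd (snd s)) - of_bool (u = fst s)))"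
    by (rule sum_list_distinct_conv_sum_set[OF distinct_concat_strands[OF assms]])
  also have "set (concat (map strand_list cs)) = strands cs" by (simp add: strands_def)
  finally show ?thesis .
qed

lemma antisym_curve_chain: "antisym_chain (curve_chain cs)"
  unfolding antisym_chain_def curve_chain_def
proof (intro allI)
  fix a b
  have "arc_chain p (b, a) = - arc_chain p (a, b)" for p by (rule arc_chain_swap)
  then show "(\<Sum>p\<leftarrow>concat (map arcs cs). arc_chain p (b, a)) = - (\<Sum>p\<leftarrow>concat (map arcs cs). arc_chain p (a, b))"
    by (simp add: uminus_sum_list_map o_def)
qed

lemma normal_curve_distinct:
  "normal_curve S cs \<Longrightarrow> distinct (concat (map arcs cs))"
  unfolding normal_curve_def distinct_map by blast

lemma normal_curve_edges:
  "normal_curve S cs \<Longrightarrow> (p, q) \<in> set (concat (map arcs cs)) \<Longrightarrow> {p, q} \<in> edges S"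
  unfolding normal_curve_def by fastforce

lemma normal_curve_undirected:
  assumes "normal_curve S cs" "(p, q) \<in> set (concat (map arcs cs))" "(p', q') \<in> set (concat (map arcs cs))"
    "{p, q} = {p', q'}"
  shows "p = p' \<and> q = q'"
proof -
  have "inj_on (\<lambda>(u, v). {u, v}) (set (concat (map arcs cs)))"
    using assms(1) unfolding normal_curve_def distinct_map by blast
  from inj_onD[OF this _ assms(2,3)] assms(4) show ?thesis by simp
qed

definition corners_at :: "surf \<Rightarrow> (nat \<Rightarrow> nat set \<Rightarrow> int) \<Rightarrow> nat \<Rightarrow> nat \<Rightarrow> int" where
  "corners_at T G v u = after T G v u + before T G v u"

context tri_surf
begin

lemma strand_neq:
  assumes n: "normal_curve T cs" and s: "(p, v, q) \<in> strands cs"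
  shows "{v, p} \<in> edges T" "{v, q} \<in> edges T" "p \<noteq> q" "p \<noteq> v" "q \<noteq> v"
proof -
  note a = strands_arcs[OF s]
  show e: "{v, p} \<in> edges T" "{v, q} \<in> edges T"
    using normal_curve_edges[OF n a(1)] normal_curve_edges[OF n a(2)] by (simp_all add: insert_commute)
  show "p \<noteq> v" "q \<noteq> v" using edge_neq[OF e(1)] edge_neq[OF e(2)] by auto
  then show "p \<noteq> q" using normal_curve_undirected[OF n a] by auto
qed

lemma pairing_at_sum:
  assumes "finite A" "\<And>u. x (v, u) = (\<Sum>s\<in>A. of_bool (u = g s) - of_bool (u = f s))"
  shows "pairing_at T G x v = (\<Sum>s\<in>A. corners_at T G v (g s) - corners_at T G v (f s))"
proof -
  let ?h = "\<lambda>u a b c. of_bool (a = v) * (G a {a, b, c} * (of_bool (b = u) + of_bool (c = u)))"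
  have c: "corners_at T G v u = (\<Sum>(a, b, c)\<in>pos T. ?h u a b c)" for u
    unfolding corners_at_def after_def before_def sum_triples_add[symmetric]
    by (rule sum_triples_cong) auto
  have "pairing_at T G x v = (\<Sum>(a, b, c)\<in>pos T. \<Sum>s\<in>A. ?h (g s) a b c - ?h (f s) a b c)"
    unfolding pairing_at_def
  proof (rule sum_triples_cong)
    fix a b c
    show "of_bool (a = v) * (G a {a, b, c} * (x (a, b) + x (a, c))) = (\<Sum>s\<in>A. ?h (g s) a b c - ?h (f s) a b c)"
    proof (cases "a = v")
      case True
      then show ?thesis
        by (simp add: assms(2) sum.distrib[symmetric] sum_distrib_left algebra_simps)
    qed simp
  qed
  also have "\<dots> = (\<Sum>s\<in>A. \<Sum>(a, b, c)\<in>pos T. ?h (g s) a b c - ?h (f s) a b c)"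
    unfolding split_def by (rule sum.swap)
  finally show ?thesis unfolding c sum_triples_diff .
qed

lemma pairing_at_zero: "(\<And>u. x (v, u) = 0) \<Longrightarrow> pairing_at T G x v = 0"
  using pairing_at_sum[of "{}" x v] by simp

lemma ccw_pos: "interior_vertex T v \<Longrightarrow> {v, u} \<in> edges T \<Longrightarrow> (v, u, ccw T v u) \<in> pos T"
  using interior_after(1)[of v u] ccw_eq by metis

lemma ccw_iter_edge: "interior_vertex T v \<Longrightarrow> {v, u} \<in> edges T \<Longrightarrow> {v, (ccw T v ^^ k) u} \<in> edges T"
proof (induction k)
  case (Suc k)
  from tri_edges[OF ccw_pos[OF Suc(2) Suc(1)[OF Suc(2,3)]]] show ?case by simp
qed simp

lemma ccw_return:
  assumes v: "interior_vertex T v" and u: "{v, u} \<in> edges T"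
  shows "\<exists>d>0. (ccw T v ^^ d) u = u"
proof (rule funpow_return)
  let ?N = "{u. {v, u} \<in> edges T}"
  show "finite ?N" by (rule finite_subset[OF _ finite_verts]) (use edge_verts in auto)
  show "inj_on (ccw T v) ?N"
  proof (rule inj_onI)
    fix x y assume "x \<in> ?N" "y \<in> ?N" "ccw T v x = ccw T v y"
    then show "x = y" using ccw_pos[OF v, of x] ccw_pos[OF v, of y] uniq_prev by auto
  qed
  show "ccw T v ` ?N \<subseteq> ?N" using ccw_iter_edge[OF v, of _ 1] by auto
qed (use u in simp)

lemma ccw_walk:
  assumes v: "interior_vertex T v" and a: "{v, a} \<in> edges T" and F: "potential T F x"
    and k: "k > 0" and z: "\<And>l. 0 < l \<Longrightarrow> l < k \<Longrightarrow> x (v, (ccw T v ^^ l) a) = 0"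
  shows "before T F v ((ccw T v ^^ k) a) = after T F v a"
  using k z
proof (induction k)
  case (Suc k)
  let ?u = "(ccw T v ^^ k) a"
  have p: "(v, ?u, ccw T v ?u) \<in> pos T" by (rule ccw_pos[OF v ccw_iter_edge[OF v a]])
  have "before T F v (ccw T v ?u) = after T F v ?u" using after_eq[OF p] before_eq[OF p] by simp
  also have "\<dots> = after T F v a"
  proof (cases "k = 0")
    case False
    then have "before T F v ?u = after T F v a" using Suc by simp
    moreover have "x (v, ?u) = 0" using Suc(3)[of k] False by simp
    ultimately show ?thesis using F by (simp add: potential_def)
  qed simp
  finally show ?case by simp
qed simp

lemma ccw_reach:
  assumes v: "interior_vertex T v" and a: "{v, a} \<in> edges T" and F: "potential T F x"
    and xa: "x (v, a) \<noteq> 0" and z: "\<And>u. u \<noteq> a \<Longrightarrow> u \<noteq> b \<Longrightarrow> x (v, u) = 0"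
  shows "\<exists>k. (ccw T v ^^ k) a = b"
proof (rule ccontr)
  assume no: "\<nexists>k. (ccw T v ^^ k) a = b"
  define d where "d = (LEAST d. d > 0 \<and> (ccw T v ^^ d) a = a)"
  have d: "d > 0" "(ccw T v ^^ d) a = a"
    using LeastI_ex[OF ccw_return[OF v a]] unfolding d_def by auto
  have "x (v, (ccw T v ^^ l) a) = 0" if "0 < l" "l < d" for l
    using not_less_Least[of l "\<lambda>d. d > 0 \<and> (ccw T v ^^ d) a = a"] that no z unfolding d_def by blast
  from ccw_walk[OF v a F d(1) this] have "before T F v a = after T F v a" using d(2) by simp
  then show False using xa F by (simp add: potential_def)
qed

lemma ccw_arc_const:
  assumes v: "interior_vertex T v" and a: "{v, a} \<in> edges T" and F: "potential T F x"
    and xa: "x (v, a) \<noteq> 0" and z: "\<And>u. u \<noteq> a \<Longrightarrow> u \<noteq> b \<Longrightarrow> x (v, u) = 0" and ab: "a \<noteq> b"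
  shows "before T F v b = after T F v a"
    and "u \<in> set (ccw_arc T v a b) - {a, b} \<Longrightarrow> corners_at T F v u = 2 * after T F v a"
proof -
  define K where "K = (LEAST k. (ccw T v ^^ k) a = b)"
  have K: "(ccw T v ^^ K) a = b" unfolding K_def using ccw_reach[OF v a F xa z] by (rule LeastI_ex)
  have least: "(ccw T v ^^ k) a \<noteq> b" if "k < K" for k using not_less_Least that unfolding K_def by blast
  have K0: "K > 0" using K ab by (cases K) auto
  have na: "(ccw T v ^^ l) a \<noteq> a" if l: "0 < l" "l < K" for l
  proof
    assume *: "(ccw T v ^^ l) a = a"
    have "b = (ccw T v ^^ (K - l + l)) a" using K l by simp
    also have "\<dots> = (ccw T v ^^ (K - l)) a" unfolding funpow_add comp_apply * ..
    finally have "(ccw T v ^^ (K - l)) a = b" by simp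
    moreover have "(ccw T v ^^ (K - l)) a \<noteq> b" by (rule least) (use l in linarith)
    ultimately show False by contradiction
  qed
  have x0: "x (v, (ccw T v ^^ l) a) = 0" if "0 < l" "l < K" for l
    by (rule z[OF na[OF that] least[OF that(2)]])
  show "before T F v b = after T F v a" using ccw_walk[OF v a F K0 x0] K by simp
  assume "u \<in> set (ccw_arc T v a b) - {a, b}"
  then obtain k where k: "k \<le> K" "u = (ccw T v ^^ k) a" "u \<noteq> a" "u \<noteq> b"
    unfolding ccw_arc_def K_def[symmetric] by (auto simp: less_Suc_eq_le simp del: upt_Suc)
  then have k': "0 < k" "k < K" using K by (cases k; cases "k = K"; auto)+
  have "before T F v u = after T F v a"
    unfolding k(2) by (rule ccw_walk[OF v a F k'(1)]) (use x0 k' in auto)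
  moreover have "x (v, u) = 0" using z k by blast
  ultimately show "corners_at T F v u = 2 * after T F v a"
    using F by (simp add: potential_def corners_at_def)
qed

text \<open>The potential of a strand drops by one from the left of the strand to its right.\<close>

lemma strand_sides:
  assumes v: "interior_vertex T v" and e: "{v, p} \<in> edges T" "{v, q} \<in> edges T" "p \<noteq> q"
    and F: "potential T F x" and x: "\<And>u. x (v, u) = of_bool (u = q) - of_bool (u = p)"
  obtains R where "corners_at T F v p = 2 * R + 1" "corners_at T F v q = 2 * R + 1"
    "\<And>u. u \<in> left_side T (p, v, q) \<Longrightarrow> corners_at T F v u = 2 * R + 2"
    "\<And>u. u \<in> right_side T (p, v, q) \<Longrightarrow> corners_at T F v u = 2 * R"
proof -
  have xp: "x (v, p) = - 1" and xq: "x (v, q) = 1" using x e(3) by auto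
  have L: "before T F v p = after T F v q"
    "\<And>u. u \<in> set (ccw_arc T v q p) - {q, p} \<Longrightarrow> corners_at T F v u = 2 * after T F v q"
    using ccw_arc_const[OF v e(2) F, of p] x xq e(3) by auto
  have R: "before T F v q = after T F v p"
    "\<And>u. u \<in> set (ccw_arc T v p q) - {p, q} \<Longrightarrow> corners_at T F v u = 2 * after T F v p"
    using ccw_arc_const[OF v e(1) F, of q] x xp e(3) by auto
  have "after T F v q - before T F v q = 1" using F xq by (simp add: potential_def)
  then show ?thesis
    using that[of "after T F v p"] L R by (auto simp: corners_at_def insert_commute)
qed

lemma crossing_pairing:
  assumes v: "interior_vertex T v" and e: "{v, p} \<in> edges T" "{v, q} \<in> edges T" "p \<noteq> q"
    and F: "potential T F x" and x: "\<And>u. x (v, u) = of_bool (u = q) - of_bool (u = p)"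
    and c: "crossed_lr T (p, v, q) (p', v, q')"
  shows "corners_at T F v q' - corners_at T F v p' = - 2"
    and "corners_at T F v p - corners_at T F v p' = - 1"
    and "corners_at T F v q - corners_at T F v p' = - 1"
proof -
  obtain R where R: "corners_at T F v p = 2 * R + 1" "corners_at T F v q = 2 * R + 1"
    "\<And>u. u \<in> left_side T (p, v, q) \<Longrightarrow> corners_at T F v u = 2 * R + 2"
    "\<And>u. u \<in> right_side T (p, v, q) \<Longrightarrow> corners_at T F v u = 2 * R"
    using strand_sides[OF v e F x] by blast
  have "p' \<in> left_side T (p, v, q)" "q' \<in> right_side T (p, v, q)"
    using c unfolding crossed_lr_def fst_conv snd_conv by blast+
  then show "corners_at T F v q' - corners_at T F v p' = - 2"
    "corners_at T F v p - corners_at T F v p' = - 1" "corners_at T F v q - corners_at T F v p' = - 1"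
    using R by auto
qed

lemma intersection_number_pairing:
  assumes tr: "transverse T cs ds" and F: "potential T F (curve_chain cs)" and G: "potential T G (curve_chain ds)"
  shows "pairing T G (curve_chain cs) = 2 * intersection_number T cs ds"
proof -
  let ?x = "curve_chain cs" and ?y = "curve_chain ds"
  have n: "normal_curve T cs" "normal_curve T ds" "normal_curve T (cs @ ds)"
    using tr unfolding transverse_def by auto
  have loc: "curve_chain es (v, u) = (\<Sum>s\<in>{s \<in> strands es. mid s = v}. of_bool (u = snd (snd s)) - of_bool (u = fst s))"
    if "normal_curve T es" for es v u
    unfolding curve_chain_strands[OF normal_curve_distinct[OF that]]
    by (rule sum.mono_neutral_cong_right) (use finite_strands in auto)
  let ?I = "{(s, t). s \<in> strands cs \<and> t \<in> strands ds \<and> mid s = mid t}"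
  let ?e = "\<lambda>(s, t). if crossed_lr T s t then 1 else - 1 :: int"
  have disj: "strands cs \<inter> strands ds = {}"
  proof (rule ccontr)
    assume "strands cs \<inter> strands ds \<noteq> {}"
    then obtain p v q where s: "(p, v, q) \<in> strands cs" "(p, v, q) \<in> strands ds" by auto
    have "distinct (concat (map arcs cs) @ concat (map arcs ds))"
      using normal_curve_distinct[OF n(3)] by simp
    then show False using strands_arcs(1)[OF s(1)] strands_arcs(1)[OF s(2)]
      unfolding distinct_append by blast
  qed
  have at: "pairing_at T G ?x v = 2 * (\<Sum>i\<in>{i \<in> ?I. mid (fst i) = v}. ?e i)" for v
  proof -
    let ?A = "{s \<in> strands cs. mid s = v}" and ?B = "{s \<in> strands ds. mid s = v}"
    have fin: "finite ?A" "finite ?B" using finite_strands by auto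
    have I: "{i \<in> ?I. mid (fst i) = v} = ?A \<times> ?B" by auto
    consider "?A = {}" | "?B = {}" | s t where "s \<in> ?A" "t \<in> ?B" by blast
    then show ?thesis
    proof cases
      case 1
      have "pairing_at T G ?x v = 0" by (rule pairing_at_zero) (simp only: loc[OF n(1)] 1 sum.empty)
      then show ?thesis by (simp only: I 1 Sigma_empty1 sum.empty)
    next
      case 2
      have "pairing_at T F ?y v = 0" by (rule pairing_at_zero) (simp only: loc[OF n(2)] 2 sum.empty)
      then have "pairing_at T G ?x v = 0" using pairing_at_antisym[OF F G, of v] by simp
      then show ?thesis by (simp only: I 2 Times_empty sum.empty) simp
    next
      case (3 s t)
      have AB: "?A \<union> ?B = {s \<in> strands (cs @ ds). mid s = v}" by (auto simp: strands_append)
      have "card ?A + card ?B = card (?A \<union> ?B)"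
        using disj fin by (intro card_Un_disjoint[symmetric]) auto
      also have "\<dots> \<le> 2" unfolding AB using n(3) unfolding normal_curve_def by blast
      finally have "card ?A + card ?B \<le> 2" .
      moreover have "card ?A \<noteq> 0" unfolding card_0_eq[OF fin(1)] using 3(1) by blast
      moreover have "card ?B \<noteq> 0" unfolding card_0_eq[OF fin(2)] using 3(2) by blast
      ultimately have "card ?A = 1" "card ?B = 1" by linarith+
      then obtain s' t' where st': "?A = {s'}" "?B = {t'}" by (elim card_1_singletonE)
      have "s = s'" "t = t'" using 3 unfolding st' by simp_all
      then have sing: "?A = {s}" "?B = {t}" using st' by simp_all
      obtain p q where s: "s = (p, v, q)" using 3(1) by (cases s) auto
      obtain p' q' where t: "t = (p', v, q')" using 3(2) by (cases t) auto
      have xs: "?x (v, u) = of_bool (u = q) - of_bool (u = p)" for u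
        unfolding loc[OF n(1)] sing by (simp add: s)
      have yt: "?y (v, u) = of_bool (u = q') - of_bool (u = p')" for u
        unfolding loc[OF n(2)] sing by (simp add: t)
      have st: "s \<in> strands (cs @ ds)" "t \<in> strands (cs @ ds)" "mid s = mid t"
        using 3 by (simp_all add: strands_append)
      moreover have "s \<noteq> t" using 3 disj by blast
      moreover have "\<forall>s\<in>strands (cs @ ds). \<forall>t\<in>strands (cs @ ds). s \<noteq> t \<and> mid s = mid t \<longrightarrow>
          interior_vertex T (mid s) \<and> (crossed_lr T s t \<or> crossed_lr T t s)"
        using n(3) unfolding normal_curve_def by blast
      ultimately have "interior_vertex T (mid s) \<and> (crossed_lr T s t \<or> crossed_lr T t s)" by blast
      then have cr: "interior_vertex T v" "crossed_lr T s t \<or> crossed_lr T t s"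
        using 3(1) by simp_all
      have se: "{v, p} \<in> edges T" "{v, q} \<in> edges T" "p \<noteq> q"
        using strand_neq[OF n(1), of p v q] 3(1) s by auto
      have te: "{v, p'} \<in> edges T" "{v, q'} \<in> edges T" "p' \<noteq> q'"
        using strand_neq[OF n(2), of p' v q'] 3(2) t by auto
      have Gx: "pairing_at T G ?x v = corners_at T G v q - corners_at T G v p"
        using pairing_at_sum[of "{()}" ?x v "\<lambda>_. q" "\<lambda>_. p" G] xs by simp
      have Fy: "pairing_at T F ?y v = corners_at T F v q' - corners_at T F v p'"
        using pairing_at_sum[of "{()}" ?y v "\<lambda>_. q'" "\<lambda>_. p'" F] yt by simp
      have st2: "pairing_at T G ?x v = 2" if "crossed_lr T s t"
        using crossing_pairing(1)[OF cr(1) se F xs that[unfolded s t]] Fy pairing_at_antisym[OF F G, of v] by simp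
      have ts2: "pairing_at T G ?x v = - 2" if "crossed_lr T t s"
        using crossing_pairing(1)[OF cr(1) te G yt that[unfolded s t]] Gx by simp
      have "(\<Sum>i\<in>{i \<in> ?I. mid (fst i) = v}. ?e i) = (if crossed_lr T s t then 1 else - 1)"
        unfolding I sing by simp
      then show ?thesis using st2 ts2 cr(2) by auto
    qed
  qed
  have fI: "finite ?I"
    by (rule finite_subset[of _ "strands cs \<times> strands ds"]) (use finite_strands in auto)
  have "(\<lambda>i. mid (fst i)) ` ?I \<subseteq> verts T"
  proof clarify
    fix p v q t assume "(p, v, q) \<in> strands cs"
    from edge_verts[OF strand_neq(1)[OF n(1) this]] show "mid (fst ((p, v, q), t)) \<in> verts T" by simp
  qed
  from sum.group[OF fI finite_verts this, of ?e]
  have "intersection_number T cs ds = (\<Sum>v\<in>verts T. \<Sum>i\<in>{i \<in> ?I. mid (fst i) = v}. ?e i)"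
    unfolding intersection_number_def by (simp add: split_def)
  then show ?thesis unfolding pairing_sum at sum_distrib_left[symmetric] by simp
qed

lemma set_ccw_arc: "set (ccw_arc T v a b) = {(ccw T v ^^ k) a | k. k \<le> (LEAST k. (ccw T v ^^ k) a = b)}"
  unfolding ccw_arc_def by (auto simp: less_Suc_eq_le simp del: upt_Suc)

lemma ccw_arc_rotate:
  assumes K: "(ccw T v ^^ K) a = b" "K = (LEAST k. (ccw T v ^^ k) a = b)"
    and i: "i \<le> K" "x = (ccw T v ^^ i) a" and r: "\<exists>l. (ccw T v ^^ l) b = y" and y: "y \<notin> set (ccw_arc T v a b)"
  shows "b \<in> set (ccw_arc T v x y)"
proof -
  have add: "(ccw T v ^^ l) x = (ccw T v ^^ (l + i)) a" for l
    unfolding i(2) by (simp add: funpow_add)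
  have b: "(ccw T v ^^ (K - i)) x = b" unfolding add using i(1) K(1) by simp
  have ny: "(ccw T v ^^ l) x \<noteq> y" if "l \<le> K - i" for l
  proof -
    have "(ccw T v ^^ (l + i)) a \<in> set (ccw_arc T v a b)"
      unfolding set_ccw_arc K(2)[symmetric] using that i(1) by (intro CollectI exI[of _ "l + i"]) simp
    then show ?thesis unfolding add using y by blast
  qed
  obtain l where "(ccw T v ^^ l) b = y" using r by blast
  then have "(ccw T v ^^ (l + (K - i))) x = y" unfolding funpow_add comp_apply b .
  then have "(ccw T v ^^ (LEAST k. (ccw T v ^^ k) x = y)) x = y" by (rule LeastI)
  then have "K - i \<le> (LEAST k. (ccw T v ^^ k) x = y)" using ny by (meson linear)
  then show ?thesis unfolding set_ccw_arc using b by blast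
qed

lemma crossed_rotate:
  assumes v: "interior_vertex T v" and e: "{v, w} \<in> edges T" "{v, e} \<in> edges T" "w \<noteq> e"
    and F: "potential T F x" and x: "\<And>u. x (v, u) = of_bool (u = e) - of_bool (u = w)"
    and c: "crossed_lr T (w, v, e) (n, v, s)"
  shows "crossed_lr T (n, v, s) (e, v, w)"
proof -
  define K where "K = (LEAST k. (ccw T v ^^ k) e = w)"
  define K' where "K' = (LEAST k. (ccw T v ^^ k) w = e)"
  have "\<exists>k. (ccw T v ^^ k) e = w" by (rule ccw_reach[OF v e(2) F]) (use x e(3) in auto)
  then have K: "(ccw T v ^^ K) e = w" unfolding K_def by (rule LeastI_ex)
  have "\<exists>k. (ccw T v ^^ k) w = e" by (rule ccw_reach[OF v e(1) F]) (use x e(3) in auto)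
  then have K': "(ccw T v ^^ K') w = e" unfolding K'_def by (rule LeastI_ex)
  have nl: "n \<in> set (ccw_arc T v e w)" "n \<noteq> w" "n \<noteq> e" "n \<in> left_side T (w, v, e)"
    and sr: "s \<in> set (ccw_arc T v w e)" "s \<noteq> w" "s \<noteq> e" "s \<in> right_side T (w, v, e)"
    using c unfolding crossed_lr_def by auto
  obtain i where i: "i \<le> K" "n = (ccw T v ^^ i) e" using nl(1) unfolding set_ccw_arc K_def by blast
  obtain j where j: "j \<le> K'" "s = (ccw T v ^^ j) w" using sr(1) unfolding set_ccw_arc K'_def by blast
  obtain R where R: "\<And>u. u \<in> left_side T (w, v, e) \<Longrightarrow> corners_at T F v u = 2 * R + 2"
    "\<And>u. u \<in> right_side T (w, v, e) \<Longrightarrow> corners_at T F v u = 2 * R"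
    using strand_sides[OF v e F x] by metis
  have "n \<notin> set (ccw_arc T v w e)" using nl R(1)[OF nl(4)] R(2)[of n] by auto
  then have 1: "e \<in> set (ccw_arc T v s n)"
    using ccw_arc_rotate[OF K' K'_def j _] i(2) by blast
  have "s \<notin> set (ccw_arc T v e w)" using sr R(2)[OF sr(4)] R(1)[of s] by auto
  then have 2: "w \<in> set (ccw_arc T v n s)"
    using ccw_arc_rotate[OF K K_def i _] j(2) by blast
  show ?thesis unfolding crossed_lr_def using 1 2 nl sr by auto
qed

lemma pairing_at_linear:
  assumes "\<And>u. x (v, u) = k1 * x1 (v, u) + k2 * x2 (v, u) + k3 * x3 (v, u)"
  shows "pairing_at T G x v = k1 * pairing_at T G x1 v + k2 * pairing_at T G x2 v + k3 * pairing_at T G x3 v"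
proof -
  have "k1 * pairing_at T G x1 v + k2 * pairing_at T G x2 v + k3 * pairing_at T G x3 v =
    (\<Sum>(a, b, c)\<in>pos T. k1 * (of_bool (a = v) * (G a {a, b, c} * (x1 (a, b) + x1 (a, c)))) +
      k2 * (of_bool (a = v) * (G a {a, b, c} * (x2 (a, b) + x2 (a, c)))) +
      k3 * (of_bool (a = v) * (G a {a, b, c} * (x3 (a, b) + x3 (a, c)))))"
    unfolding pairing_at_def sum_triples_add by (simp add: sum_distrib_left split_def)
  also have "\<dots> = pairing_at T G x v"
    unfolding pairing_at_def
  proof (rule sum_triples_cong)
    fix a b c
    show "k1 * (of_bool (a = v) * (G a {a, b, c} * (x1 (a, b) + x1 (a, c)))) +
      k2 * (of_bool (a = v) * (G a {a, b, c} * (x2 (a, b) + x2 (a, c)))) +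
      k3 * (of_bool (a = v) * (G a {a, b, c} * (x3 (a, b) + x3 (a, c)))) =
      of_bool (a = v) * (G a {a, b, c} * (x (a, b) + x (a, c)))"
      by (cases "a = v") (simp_all add: assms algebra_simps)
  qed
  finally show ?thesis by simp
qed

lemma pairing_at_strand:
  assumes "\<And>u. x (v, u) = of_bool (u = q) - of_bool (u = p)"
  shows "pairing_at T G x v = corners_at T G v q - corners_at T G v p"
  using pairing_at_sum[of "{()}" x v "\<lambda>_. q" "\<lambda>_. p" G] assms by simp

lemma pairing_at_self:
  assumes F: "potential T F x" and "potential T G y" "\<And>u. x (v, u) = y (v, u)"
  shows "pairing_at T G x v = 0"
proof -
  have "pairing_at T G x v = pairing_at T G y v"
    using pairing_at_linear[of x v 1 y 0 y 0 y G] assms(3) by simp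
  moreover have "pairing_at T G y v = - pairing_at T G y v"
    by (rule pairing_at_antisym[OF assms(2,2)])
  ultimately show ?thesis by simp
qed

end

lemma strand_flow_exists:
  assumes S: "oriented_surface S" and e: "{v, x} \<in> edges S" "{v, y} \<in> edges S"
  obtains F c where "potential S F c" "\<And>u. c (v, u) = of_bool (u = x) - of_bool (u = y)"
proof -
  interpret tri_surf S by (rule tri_surf_of_oriented[OF S])
  have "(x, y) \<in> {(a, b). {v, a, b} \<in> triangles S}\<^sup>*"
    using S e unfolding oriented_surface_def two_manifold_def by blast
  from local_flows_path[OF this]
  obtain f where f: "\<forall>u. of_bool (u = x) - of_bool (u = y) = after S (\<lambda>_. f) v u - before S (\<lambda>_. f) v u"
    unfolding local_flows_def by blast
  define c where "c = (\<lambda>(a, b). after S (\<lambda>_. f) a b - before S (\<lambda>_. f) a b)"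
  have "potential S (\<lambda>_. f) c" by (simp add: potential_def c_def)
  moreover have "c (v, u) = of_bool (u = x) - of_bool (u = y)" for u using f by (simp add: c_def)
  ultimately show ?thesis by (rule that)
qed

text \<open>Besides the two strands through a crossing, the flows considered here may contain the corner that
  a smoothing produces, from the incoming end of the negative strand to the outgoing end of the positive one.\<close>

lemma crossing_bilinear:
  assumes S: "oriented_surface S" and v: "interior_vertex S v"
    and e: "{v, w} \<in> edges S" "{v, e} \<in> edges S" "w \<noteq> e"
    and n: "{v, n} \<in> edges S" "{v, s} \<in> edges S" "n \<noteq> s"
    and c: "crossed_lr S (w, v, e) (n, v, s)"
    and F: "potential S F x" and G: "potential S G y"
    and x: "\<And>u. x (v, u) = \<alpha>1 * (of_bool (u = e) - of_bool (u = w)) +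
      \<alpha>2 * (of_bool (u = s) - of_bool (u = n)) + \<alpha>3 * (of_bool (u = e) - of_bool (u = n))"
    and y: "\<And>u. y (v, u) = \<beta>1 * (of_bool (u = e) - of_bool (u = w)) +
      \<beta>2 * (of_bool (u = s) - of_bool (u = n)) + \<beta>3 * (of_bool (u = e) - of_bool (u = n))"
  shows "pairing_at S G x v = 2 * (\<alpha>1 * \<beta>2 - \<alpha>2 * \<beta>1) + (\<alpha>1 - \<alpha>2) * \<beta>3 + \<alpha>3 * (\<beta>2 - \<beta>1)"
proof -
  interpret tri_surf S by (rule tri_surf_of_oriented[OF S])
  obtain FP p where P: "potential S FP p" "\<And>u. p (v, u) = of_bool (u = e) - of_bool (u = w)"
    using strand_flow_exists[OF S e(2,1)] by blast
  obtain FN m where N: "potential S FN m" "\<And>u. m (v, u) = of_bool (u = s) - of_bool (u = n)"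
    using strand_flow_exists[OF S n(2,1)] by blast
  obtain FC k where C: "potential S FC k" "\<And>u. k (v, u) = of_bool (u = e) - of_bool (u = n)"
    using strand_flow_exists[OF S e(2) n(1)] by blast
  have c': "crossed_lr S (n, v, s) (e, v, w)" by (rule crossed_rotate[OF v e P c])
  note cP = crossing_pairing[OF v e P c] and cN = crossing_pairing[OF v n N c']
  have PN: "pairing_at S FP m v = - 2" using cP(1) pairing_at_strand[of m v s n FP, OF N(2)] by simp
  have PC: "pairing_at S FP k v = - 1" using cP(3) pairing_at_strand[of k v e n FP, OF C(2)] by simp
  have NP: "pairing_at S FN p v = 2" using cN(1) pairing_at_strand[of p v e w FN, OF P(2)] by simp
  have NC: "pairing_at S FN k v = 1" using cN(2) pairing_at_strand[of k v e n FN, OF C(2)] by simp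
  have self: "pairing_at S FP p v = 0" "pairing_at S FN m v = 0" "pairing_at S FC k v = 0"
    by (rule pairing_at_self[OF P(1) P(1)] pairing_at_self[OF N(1) N(1)] pairing_at_self[OF C(1) C(1)], rule refl)+
  have CP: "pairing_at S FC p v = 1" "pairing_at S FC m v = - 1"
    using pairing_at_antisym[OF P(1) C(1), of v] pairing_at_antisym[OF N(1) C(1), of v] PC NC by simp_all
  have lin: "pairing_at S H y v = \<beta>1 * pairing_at S H p v + \<beta>2 * pairing_at S H m v + \<beta>3 * pairing_at S H k v" for H
    by (rule pairing_at_linear) (simp only: y P(2) N(2) C(2))
  have "pairing_at S G x v = \<alpha>1 * pairing_at S G p v + \<alpha>2 * pairing_at S G m v + \<alpha>3 * pairing_at S G k v"
    by (rule pairing_at_linear) (simp only: x P(2) N(2) C(2))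
  moreover have "pairing_at S G p v = 2 * \<beta>2 + \<beta>3"
    using pairing_at_antisym[OF P(1) G, of v] lin[of FP] self PN PC by simp
  moreover have "pairing_at S G m v = - 2 * \<beta>1 - \<beta>3"
    using pairing_at_antisym[OF N(1) G, of v] lin[of FN] self NP NC by simp
  moreover have "pairing_at S G k v = \<beta>2 - \<beta>1"
    using pairing_at_antisym[OF C(1) G, of v] lin[of FC] self CP by simp
  ultimately show ?thesis by (simp add: algebra_simps)
qed


lemma cycles1_antisym: "z \<in> cycles1 S \<Longrightarrow> antisym_chain z"
  unfolding cycles1_def antisym_chain_def by blast

lemma intersection_form_eq:
  assumes S: "oriented_surface S" and z: "z \<in> cycles1 S" "z' \<in> cycles1 S"
    and G: "potential S G z'" and N: "pairing S G z = 2 * N"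
  shows "intersection_form S (hclass S z) (hclass S z') = N"
proof -
  interpret tri_surf S by (rule tri_surf_of_oriented[OF S])
  obtain F where F: "potential S F z" using potential_exists[OF S z(1)] by blast
  have uni: "intersection_number ((sd ^^ m) S) cs ds = N"
    if tr: "transverse ((sd ^^ m) S) cs ds" and r: "represents S m cs (hclass S z)" "represents S m ds (hclass S z')" for m cs ds
  proof -
    interpret U: tri_surf "(sd ^^ m) S" by (rule tri_surf_iter)
    obtain y where y: "y \<in> cycles1 S" "homologous S z y" "homologous ((sd ^^ m) S) (sd_chain_iter S m y) (curve_chain cs)"
      using r(1) unfolding represents_def hclass_iff by blast
    obtain y' where y': "y' \<in> cycles1 S" "homologous S z' y'" "homologous ((sd ^^ m) S) (sd_chain_iter S m y') (curve_chain ds)"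
      using r(2) unfolding represents_def hclass_iff by blast
    obtain E where E: "potential S E y" using potential_exists[OF S y(1)] by blast
    obtain E' where E': "potential S E' y'" using potential_exists[OF S y'(1)] by blast
    note as = cycles1_antisym[OF y(1)] cycles1_antisym[OF y'(1)]
    note Em = potential_sd_iter[OF E as(1)] potential_sd_iter[OF E' as(2)]
    obtain H where H: "potential ((sd ^^ m) S) H (curve_chain cs)"
      using U.potential_homologous[OF homologous_sym[OF y(3)] Em(1)] by blast
    obtain H' where H': "potential ((sd ^^ m) S) H' (curve_chain ds)"
      using U.potential_homologous[OF homologous_sym[OF y'(3)] Em(2)] by blast
    have "2 * intersection_number ((sd ^^ m) S) cs ds = pairing ((sd ^^ m) S) H' (curve_chain cs)"
      using U.intersection_number_pairing[OF tr H H'] by simp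
    also have "\<dots> = pairing ((sd ^^ m) S) ((sd_potential ^^ m) E') (sd_chain_iter S m y)"
      by (rule U.pairing_homologous[OF homologous_sym[OF y(3)] homologous_sym[OF y'(3)] H Em(1) H' Em(2)
            antisym_sd_chain_iter[OF as(1)] antisym_curve_chain])
    also have "\<dots> = pairing S E' y" by (rule pairing_sd_iter[OF as(1)])
    also have "\<dots> = pairing S G z"
      by (rule pairing_homologous[OF homologous_sym[OF y(2)] homologous_sym[OF y'(2)] E F E' G
            cycles1_antisym[OF z(1)] as(2)])
    finally show ?thesis using N by simp
  qed
  obtain m cs ds where m: "transverse ((sd ^^ m) S) cs ds"
    "homologous ((sd ^^ m) S) (sd_chain_iter S m z) (curve_chain cs)"
    "homologous ((sd ^^ m) S) (sd_chain_iter S m z') (curve_chain ds)"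
    using transverse_exists[OF S z] by blast
  then have rep: "represents S m cs (hclass S z)" "represents S m ds (hclass S z')"
    unfolding represents_def hclass_iff using z homologous_refl by blast+
  show ?thesis
    unfolding intersection_form_def
  proof (rule the_equality)
    show "\<exists>m cs ds. transverse ((sd ^^ m) S) cs ds \<and> represents S m cs (hclass S z) \<and>
        represents S m ds (hclass S z') \<and> N = intersection_number ((sd ^^ m) S) cs ds"
      using m(1) rep uni[OF m(1) rep] by (intro exI[of _ m] exI[of _ cs] exI[of _ ds]) simp
    show "k = N" if "\<exists>m cs ds. transverse ((sd ^^ m) S) cs ds \<and> represents S m cs (hclass S z) \<and>
        represents S m ds (hclass S z') \<and> k = intersection_number ((sd ^^ m) S) cs ds" for k
      using that uni by blast
  qed
qed

lemma intersection_form_sd: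
  assumes S: "oriented_surface S" and z: "z \<in> cycles1 S" "z' \<in> cycles1 S" and L: "L \<in> cycles1 S" "L' \<in> cycles1 S"
    and h: "homologous (sd S) (sd_chain S z) (sd_chain S L)" "homologous (sd S) (sd_chain S z') (sd_chain S L')"
    and G: "potential S G L'" and N: "pairing S G L = 2 * N"
  shows "intersection_form S (hclass S z) (hclass S z') = N"
proof -
  interpret tri_surf S by (rule tri_surf_of_oriented[OF S])
  interpret U: tri_surf "sd S" by (rule tri_surf_sd)
  note as = cycles1_antisym[OF z(1)] cycles1_antisym[OF z(2)] cycles1_antisym[OF L(1)] cycles1_antisym[OF L(2)]
  obtain F F' E where F: "potential S F z" "potential S F' z'" "potential S E L"
    using potential_exists[OF S] z L by metis
  have "pairing S F' z = pairing (sd S) (sd_potential F') (sd_chain S z)"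
    using pairing_sd[OF as(1)] by simp
  also have "\<dots> = pairing (sd S) (sd_potential G) (sd_chain S L)"
    by (rule U.pairing_homologous[OF h potential_sd[OF F(1) as(1)] potential_sd[OF F(3) as(3)]
          potential_sd[OF F(2) as(2)] potential_sd[OF G as(4)] antisym_sd_chain antisym_sd_chain])
  also have "\<dots> = pairing S G L" by (rule pairing_sd[OF as(3)])
  finally show ?thesis using intersection_form_eq[OF S z F(2)] N by simp
qed

section \<open>Smoothing a crossing\<close>

fun path_chain :: "nat list \<Rightarrow> nat \<times> nat \<Rightarrow> int" where
  "path_chain [] e = 0"
| "path_chain [x] e = 0"
| "path_chain (x # y # zs) e = arc_chain (x, y) e + path_chain (y # zs) e"

lemma path_chain_join:
  "xs \<noteq> [] \<Longrightarrow> ys \<noteq> [] \<Longrightarrow> path_chain (xs @ ys) e = path_chain xs e + arc_chain (last xs, hd ys) e + path_chain ys e"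
proof (induction xs)
  case (Cons x xs)
  show ?case
  proof (cases xs)
    case Nil
    then show ?thesis using Cons.prems by (cases ys) auto
  next
    case (Cons x' xs')
    then show ?thesis using Cons.IH Cons.prems by simp
  qed
qed simp

lemma path_chain_rev: "path_chain (rev xs) e = - path_chain xs e"
proof (induction xs)
  case (Cons x xs)
  show ?case
  proof (cases xs)
    case (Cons y ys)
    have "path_chain (rev xs @ [x]) e = path_chain (rev xs) e + arc_chain (y, x) e"
      using path_chain_join[of "rev xs" "[x]" e] Cons by (simp add: last_rev)
    then show ?thesis using Cons.IH \<open>xs = y # ys\<close> by (simp add: arc_chain_rev[of y x])
  qed simp
qed simp

lemma curve_chain_path: "c \<noteq> [] \<Longrightarrow> curve_chain [c] e = path_chain (c @ [hd c]) e"
proof -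
  have *: "(\<Sum>a\<leftarrow>zip (y # ys) (ys @ [x]). arc_chain a e) = path_chain (y # ys @ [x]) e" for y ys x
    by (induction ys arbitrary: y) simp_all
  assume "c \<noteq> []"
  then obtain x xs where "c = x # xs" by (cases c) auto
  then show ?thesis using *[of x xs x] by (simp add: curve_chain_def arcs_def)
qed

lemma sd_path_snoc: "p \<noteq> [] \<Longrightarrow> sd_path (p @ [v]) = sd_path p @ [bary {last p, v}, bary {v}]"
  by (induction p rule: sd_path.induct) auto

lemma sd_path_ends:
  assumes "p \<noteq> []"
  shows "sd_path p \<noteq> []" "hd (sd_path p) = bary {hd p}" "last (sd_path p) = bary {last p}"
  using assms by (induction p rule: sd_path.induct) (auto split: if_splits)

lemma curve_cycles1:
  assumes S: "tri_surf S" and d: "distinct (concat (map arcs cs))"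
    and e: "\<And>p q. (p, q) \<in> set (concat (map arcs cs)) \<Longrightarrow> {p, q} \<in> edges S"
  shows "curve_chain cs \<in> cycles1 S"
proof -
  interpret tri_surf S by (rule S)
  have off: "curve_chain cs (a, b) = 0" if "{a, b} \<notin> edges S" for a b
  proof -
    have "arc_chain x (a, b) = 0" if x: "x \<in> set (concat (map arcs cs))" for x
    proof -
      obtain p q where "x = (p, q)" by (cases x)
      then have "{p, q} \<in> edges S" using e x by simp
      then show ?thesis using \<open>{a, b} \<notin> edges S\<close> \<open>x = (p, q)\<close> by (auto simp: arc_chain_at insert_commute)
    qed
    then have "map (\<lambda>x. arc_chain x (a, b)) (concat (map arcs cs)) = map (\<lambda>x. 0) (concat (map arcs cs))"
      by (intro map_cong refl)
    then show ?thesis unfolding curve_chain_def by (simp only: sum_list_0)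
  qed
  have cyc: "(\<Sum>u\<in>verts S. curve_chain cs (u, v)) = 0" for v
  proof -
    have "(\<Sum>u\<in>verts S. curve_chain cs (u, v)) = (\<Sum>u\<in>verts S. - curve_chain cs (v, u))"
      by (rule sum.cong[OF refl]) (rule antisym_chainD[OF antisym_curve_chain])
    also have "\<dots> = - (\<Sum>s\<in>strands cs. \<Sum>u\<in>verts S. of_bool (mid s = v) * (of_bool (u = snd (snd s)) - of_bool (u = fst s)))"
      unfolding curve_chain_strands[OF d] sum_negf by (subst sum.swap) simp
    also have "\<dots> = 0"
    proof -
      have "(\<Sum>u\<in>verts S. of_bool (mid s = v) * (of_bool (u = snd (snd s)) - of_bool (u = fst s)) :: int) = 0"
        if s: "s \<in> strands cs" for s
      proof -
        obtain p w q where pq: "s = (p, w, q)" by (cases s)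
        have "p \<in> verts S" "q \<in> verts S"
          using strands_arcs[of p w q cs] s pq edge_verts[OF e] by auto
        then have "(\<Sum>u\<in>verts S. of_bool (u = q)) = (1 :: int)" "(\<Sum>u\<in>verts S. of_bool (u = p)) = (1 :: int)"
          using finite_verts by (simp_all add: of_bool_def)
        then show ?thesis unfolding pq by (simp add: sum_distrib_left[symmetric] sum_subtractf)
      qed
      then show ?thesis by simp
    qed
    finally show ?thesis .
  qed
  show ?thesis unfolding cycles1_def using off cyc antisym_chainD[OF antisym_curve_chain] by blast
qed

context tri_surf
begin

lemma sd_chain_arc:
  assumes e: "{u, v} \<in> edges T"
  shows "sd_chain T (arc_chain (u, v)) x = arc_chain (bary {u}, bary {u, v}) x + arc_chain (bary {u, v}, bary {v}) x"
proof -
  let ?K = "\<lambda>(a, b). arc_chain (bary {a}, bary {a, b}) x + arc_chain (bary {a, b}, bary {b}) x"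
  let ?U = "{(a, b). a < b \<and> {a, b} \<in> edges T}"
  have fin: "finite ?U" by (rule finite_subset[OF _ finite_edge_pairs]) auto
  have uv: "u \<noteq> v" by (rule edge_neq[OF e])
  let ?w = "(min u v, max u v)"
  have w: "?w \<in> ?U" using uv e by (auto simp: min_def max_def insert_commute)
  have z: "arc_chain (u, v) y * ?K y = 0" if "y \<in> ?U - {?w}" for y
    using that uv by (cases y) (auto simp: arc_chain_at min_def max_def split: if_splits)
  have "sd_chain T (arc_chain (u, v)) x = (\<Sum>y\<in>?U. arc_chain (u, v) y * ?K y)"
    unfolding sd_chain_def by (rule sum.cong) auto
  also have "\<dots> = arc_chain (u, v) ?w * ?K ?w"
    using sum.remove[OF fin w, of "\<lambda>y. arc_chain (u, v) y * ?K y"] z by simp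
  also have "\<dots> = ?K (u, v)"
    using uv by (cases "u < v")
      (auto simp: arc_chain_at min_def max_def insert_commute arc_chain_rev[of "bary {v}"] arc_chain_rev[of "bary {u}"])
  finally show ?thesis by simp
qed

lemma sd_chain_path:
  "(\<And>x y. (x, y) \<in> set (zip xs (tl xs)) \<Longrightarrow> {x, y} \<in> edges T) \<Longrightarrow> sd_chain T (path_chain xs) e = path_chain (sd_path xs) e"
proof (induction xs rule: sd_path.induct)
  case 1
  show ?case by (simp add: sd_chain_def)
next
  case (2 a)
  show ?case by (simp add: sd_chain_def)
next
  case (3 a b p)
  have ab: "{a, b} \<in> edges T" by (rule 3(2)) simp
  have "path_chain (a # b # p) = (\<lambda>e. arc_chain (a, b) e + path_chain (b # p) e)" by (rule ext) simp
  then have 1: "sd_chain T (path_chain (a # b # p)) e = sd_chain T (arc_chain (a, b)) e + sd_chain T (path_chain (b # p)) e"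
    by (simp only: sd_chain_add)
  have 2: "sd_chain T (path_chain (b # p)) e = path_chain (sd_path (b # p)) e"
    by (rule 3(1)) (rule 3(2), cases p, auto)
  obtain q where "sd_path (b # p) = bary {b} # q" by (cases p) auto
  then have "path_chain (sd_path (a # b # p)) e = arc_chain (bary {a}, bary {a, b}) e +
      arc_chain (bary {a, b}, bary {b}) e + path_chain (sd_path (b # p)) e" by simp
  then show ?case using 1 2 sd_chain_arc[OF ab, of e] by linarith
qed

lemma triangle_boundary:
  assumes p: "(x, y, z) \<in> pos T"
  shows "boundary2 T (\<lambda>t. of_bool (t = {x, y, z})) e = arc_chain (x, y) e + arc_chain (y, z) e + arc_chain (z, x) e"
proof -
  have "boundary2 T (\<lambda>t. of_bool (t = {x, y, z})) e = (\<Sum>(a, b, c)\<in>{(x, y, z), (y, z, x), (z, x, y)}. arc_chain (a, b) e)"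
    unfolding boundary2_sum
  proof (rule sum.mono_neutral_cong_right[OF finite_pos])
    show "{(x, y, z), (y, z, x), (z, x, y)} \<subseteq> pos T" using p rot[OF p] rot2[OF p] by simp
    show "\<forall>i\<in>pos T - {(x, y, z), (y, z, x), (z, x, y)}.
        (case i of (a, b, c) \<Rightarrow> of_bool ({a, b, c} = {x, y, z}) * arc_chain (a, b) e) = 0"
    proof
      fix i assume i: "i \<in> pos T - {(x, y, z), (y, z, x), (z, x, y)}"
      obtain a b c where abc: "i = (a, b, c)" by (cases i)
      then have "{x, y, z} \<noteq> {a, b, c}" using i pos_eq_of_set[OF p, of a b c] by auto
      then have "{a, b, c} \<noteq> {x, y, z}" by (rule not_sym)
      then show "(case i of (a, b, c) \<Rightarrow> of_bool ({a, b, c} = {x, y, z}) * arc_chain (a, b) e) = 0"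
        unfolding abc by simp
    qed
  qed (auto simp: insert_commute)
  also have "\<dots> = arc_chain (x, y) e + arc_chain (y, z) e + arc_chain (z, x) e"
    using pos_distinct[OF p] by simp
  finally show ?thesis .
qed

lemma fan_boundary:
  assumes "A \<noteq> []" "\<And>x y. (x, y) \<in> set (zip A (tl A)) \<Longrightarrow> (v, x, y) \<in> pos T"
  shows "\<exists>f. \<forall>e. arc_chain (v, hd A) e + path_chain A e + arc_chain (last A, v) e = boundary2 T f e"
  using assms
proof (induction A rule: sd_path.induct)
  case (2 a)
  show ?case by (intro exI[of _ "\<lambda>t. 0"]) (simp add: boundary2_zero arc_chain_rev[of a v])
next
  case (3 a b A)
  have "\<exists>f. \<forall>e. arc_chain (v, hd (b # A)) e + path_chain (b # A) e + arc_chain (last (b # A), v) e = boundary2 T f e"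
    by (rule 3(1)) (simp, rule 3(3), cases A, auto)
  then obtain f where f: "\<forall>e. arc_chain (v, b) e + path_chain (b # A) e + arc_chain (last (b # A), v) e = boundary2 T f e"
    by auto
  have p: "(v, a, b) \<in> pos T" by (rule 3(3)) simp
  show ?case
    by (rule exI[of _ "\<lambda>t. of_bool (t = {v, a, b}) + f t"])
      (simp add: boundary2_add triangle_boundary[OF p] f[rule_format, symmetric] arc_chain_rev[of b v])
qed simp

lemma ccw_arc_path:
  assumes v: "interior_vertex T v" and a: "{v, a} \<in> edges T" and k: "\<exists>k. (ccw T v ^^ k) a = b"
  shows "ccw_arc T v a b \<noteq> []" "hd (ccw_arc T v a b) = a" "last (ccw_arc T v a b) = b"
    "\<And>x y. (x, y) \<in> set (zip (ccw_arc T v a b) (tl (ccw_arc T v a b))) \<Longrightarrow> (v, x, y) \<in> pos T"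
proof -
  define K where "K = (LEAST k. (ccw T v ^^ k) a = b)"
  have K: "(ccw T v ^^ K) a = b" unfolding K_def using k by (rule LeastI_ex)
  have A: "ccw_arc T v a b = map (\<lambda>k. (ccw T v ^^ k) a) [0..<Suc K]"
    by (simp add: ccw_arc_def K_def)
  show ne: "ccw_arc T v a b \<noteq> []" by (simp add: A)
  show "hd (ccw_arc T v a b) = a" unfolding A by (simp add: hd_map upt_rec)
  show "last (ccw_arc T v a b) = b" unfolding A using K by simp
  fix x y assume "(x, y) \<in> set (zip (ccw_arc T v a b) (tl (ccw_arc T v a b)))"
  then obtain i where i: "i < K" "x = ccw_arc T v a b ! i" "y = ccw_arc T v a b ! Suc i"
    by (auto simp: set_zip nth_tl A simp del: upt_Suc)
  then have "x = (ccw T v ^^ i) a" "y = ccw T v x" unfolding A by (simp_all del: upt_Suc)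
  then show "(v, x, y) \<in> pos T" using ccw_pos[OF v ccw_iter_edge[OF v a]] by simp
qed

lemma interior_sd_vertex:
  assumes v: "interior_vertex T v"
  shows "interior_vertex (sd T) (bary {v})"
proof (rule tri_surf.interiorI[OF tri_surf_sd])
  obtain b c where "(v, b, c) \<in> pos T" using v verts_pos unfolding interior_vertex_def by blast
  then show "bary {v} \<in> verts (sd T)"
    using tri_surf.pos_verts[OF tri_surf_sd sd_posI(1)] by blast
  fix x y assume xy: "(bary {v}, x, y) \<in> pos (sd T)"
  have nb: "\<exists>c. (v, u, c) \<in> pos T" "\<exists>c. (v, c, u) \<in> pos T" if "{v, u} \<in> edges T" for u
    using interior_after[OF v that] .
  show "(\<exists>c. (bary {v}, y, c) \<in> pos (sd T)) \<and> (\<exists>c. (bary {v}, c, x) \<in> pos (sd T))"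
    using xy
  proof (cases rule: sd_pos_cases)
    case (1 a b c)
    then have va: "v = a" by simp
    obtain d where d: "(v, d, b) \<in> pos T" using nb(2) tri_edges[OF 1(1)] va by blast
    have "(bary {v}, bary {b, v, d}, bary {b, v}) \<in> pos (sd T)" using sd_posI(4)[OF rot2[OF d]] .
    moreover have "(bary {v}, y, bary {a, c}) \<in> pos (sd T)" using sd_pos_vz[OF 1(1)] 1 va by simp
    ultimately show ?thesis using 1 va by (metis insert_commute)
  next
    case (4 a b c)
    then have vb: "v = b" by simp
    have "{v, a} \<in> edges T" using tri_edges[OF 4(1)] vb by (simp add: insert_commute)
    then obtain d where d: "(v, a, d) \<in> pos T" using nb(1) by blast
    have "(bary {v}, bary {v, a}, bary {v, a, d}) \<in> pos (sd T)" using sd_posI(1)[OF d] .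
    moreover have "(bary {v}, bary {b, c}, bary {b, c, a}) \<in> pos (sd T)" using sd_posI(1)[OF rot[OF 4(1)]] vb by simp
    ultimately show ?thesis using 4 vb by (metis insert_commute)
  qed (auto dest: pos_distinct)
qed

lemma ccw_sd:
  assumes p: "(v, u, w) \<in> pos T"
  shows "(ccw (sd T) (bary {v}) ^^ 2) (bary {v, u}) = bary {v, w}"
proof -
  have "(bary {v}, bary {v, u, w}, bary {v, w}) \<in> pos (sd T)" using sd_pos_vz[OF p] by simp
  then show ?thesis
    using tri_surf.ccw_eq[OF tri_surf_sd sd_posI(1)[OF p]] tri_surf.ccw_eq[OF tri_surf_sd] by (simp add: numeral_2_eq_2)
qed

lemma ccw_back:
  assumes v: "interior_vertex T v" and y: "{v, y} \<in> edges T" and k: "(ccw T v ^^ k) y = x"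
  shows "\<exists>l. (ccw T v ^^ l) x = y"
proof -
  obtain d where d: "d > 0" "(ccw T v ^^ d) y = y" using ccw_return[OF v y] by blast
  have "(ccw T v ^^ (j * d)) y = y" for j
    by (induction j) (simp_all add: funpow_add d(2))
  moreover have "k * d = (k * d - k) + k" using d(1) by simp
  ultimately have "(ccw T v ^^ ((k * d - k) + k)) y = y" by metis
  then have "(ccw T v ^^ (k * d - k)) x = y" unfolding funpow_add comp_apply k .
  then show ?thesis by blast
qed

end

lemma ccw_sd_reach:
  assumes S: "oriented_surface S" and v: "interior_vertex S v" and e: "{v, x} \<in> edges S" "{v, y} \<in> edges S"
  shows "\<exists>k. (ccw (sd S) (bary {v}) ^^ k) (bary {v, x}) = bary {v, y}"
proof -
  interpret tri_surf S by (rule tri_surf_of_oriented[OF S])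
  interpret U: tri_surf "sd S" by (rule tri_surf_sd)
  have "(x, y) \<in> {(a, b). {v, a, b} \<in> triangles S}\<^sup>*"
    using S e unfolding oriented_surface_def two_manifold_def by blast
  then show ?thesis
  proof (induction rule: rtrancl_induct)
    case base
    show ?case by (intro exI[of _ 0]) simp
  next
    case (step u w)
    have "\<exists>l. (ccw (sd S) (bary {v}) ^^ l) (bary {v, u}) = bary {v, w}"
    proof (cases "(v, u, w) \<in> pos S")
      case True
      then show ?thesis using ccw_sd by blast
    next
      case False
      then have p: "(v, w, u) \<in> pos S" using step(2) triangle_pos[of v u w] by simp
      have "{bary {v}, bary {v, w}} \<in> edges (sd S)" using half_edge tri_edges[OF p] by blast
      from U.ccw_back[OF interior_sd_vertex[OF v] this ccw_sd[OF p]] show ?thesis .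
    qed
    moreover obtain k where "(ccw (sd S) (bary {v}) ^^ k) (bary {v, x}) = bary {v, u}" using step(3) by blast
    ultimately obtain l where "(ccw (sd S) (bary {v}) ^^ l) ((ccw (sd S) (bary {v}) ^^ k) (bary {v, x})) = bary {v, w}"
      by metis
    then have "(ccw (sd S) (bary {v}) ^^ (l + k)) (bary {v, x}) = bary {v, w}" by (simp add: funpow_add)
    then show ?case by blast
  qed
qed

lemma smoothing_homologous:
  assumes S: "oriented_surface S" and v: "interior_vertex S v" and p: "p \<noteq> []"
    and e: "\<And>x y. (x, y) \<in> set (arcs (v # p)) \<Longrightarrow> {x, y} \<in> edges S"
  shows "homologous (sd S) (sd_chain S (curve_chain [v # p]))
    (curve_chain [sd_path p @ rev (ccw_arc (sd S) (bary {v}) (bary {v, hd p}) (bary {v, last p}))])"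
proof -
  interpret tri_surf S by (rule tri_surf_of_oriented[OF S])
  interpret U: tri_surf "sd S" by (rule tri_surf_sd)
  have zp: "zip (v # p @ [v]) (tl (v # p @ [v])) = arcs (v # p)"
  proof -
    have "zip ((v # p) @ [v]) (p @ [v]) = zip (v # p) (p @ [v])" by (subst zip_append1) simp
    then show ?thesis by (simp add: arcs_def)
  qed
  obtain y ys where py: "p = y # ys" using p by (cases p) auto
  have hp: "{v, hd p} \<in> edges S" by (rule e) (simp add: py arcs_def)
  have "(last p, v) \<in> set (arcs (v # p))"
  proof -
    have "(v # p) ! length p = last p" using p by (simp add: last_conv_nth nth_Cons')
    then show ?thesis unfolding set_arcs by (intro CollectI exI[of _ "length p"]) simp
  qed
  from e[OF this] have lp: "{v, last p} \<in> edges S" by (simp add: insert_commute)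
  let ?V = "bary {v}" and ?a = "bary {v, hd p}" and ?b = "bary {v, last p}"
  let ?A = "ccw_arc (sd S) ?V ?a ?b"
  note A = U.ccw_arc_path[OF interior_sd_vertex[OF v] half_edge[OF hp] ccw_sd_reach[OF S v hp lp]]
  note X = sd_path_ends[OF p]
  obtain f where f: "\<And>x. arc_chain (?V, hd ?A) x + path_chain ?A x + arc_chain (last ?A, ?V) x = boundary2 (sd S) f x"
    using U.fan_boundary[OF A(1,4)] by blast
  have "sd_chain S (curve_chain [v # p]) x =
      curve_chain [sd_path p @ rev ?A] x + boundary2 (sd S) f x" for x
  proof -
    have "curve_chain [v # p] = path_chain (v # p @ [v])" by (rule ext) (simp add: curve_chain_path)
    then have "sd_chain S (curve_chain [v # p]) x = path_chain (sd_path (v # p @ [v])) x"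
      using sd_chain_path[of "v # p @ [v]"] e zp by simp
    also have "sd_path (v # p @ [v]) = [?V, ?a] @ sd_path p @ [?b, ?V]"
      using sd_path_snoc[OF p, of v] py by (simp add: insert_commute)
    also have "path_chain \<dots> x = arc_chain (?V, ?a) x + arc_chain (?a, bary {hd p}) x + path_chain (sd_path p) x
        + arc_chain (bary {last p}, ?b) x + arc_chain (?b, ?V) x"
      using X by (simp add: path_chain_join del: append_Cons append_Nil)
    finally have 1: "sd_chain S (curve_chain [v # p]) x = arc_chain (?V, ?a) x + arc_chain (?a, bary {hd p}) x
        + path_chain (sd_path p) x + arc_chain (bary {last p}, ?b) x + arc_chain (?b, ?V) x" .
    have "curve_chain [sd_path p @ rev ?A] x = path_chain (sd_path p @ rev ?A @ [bary {hd p}]) x"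
      using X by (simp add: curve_chain_path)
    also have "\<dots> = path_chain (sd_path p) x + arc_chain (bary {last p}, ?b) x + path_chain (rev ?A) x + arc_chain (?a, bary {hd p}) x"
      using X A(1-3) by (simp add: path_chain_join hd_rev last_rev)
    finally show ?thesis using 1 f[of x] A(2,3) by (simp add: path_chain_rev)
  qed
  then show ?thesis unfolding homologous_def by blast
qed


section \<open>Gauss words\<close>

fun passages :: "'a list \<Rightarrow> ('a \<times> 'a \<times> 'a) list" where
  "passages (x # y # z # r) = (x, y, z) # passages (y # z # r)"
| "passages _ = []"

lemma passages_zip: "passages xs = zip xs (zip (tl xs) (tl (tl xs)))"
  by (induction xs rule: passages.induct) auto

lemma passages_append: "passages (xs @ y # z # ys) = passages (xs @ [y, z]) @ passages (y # z # ys)"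
  by (induction xs rule: passages.induct) auto

lemma strand_list_passages:
  assumes "c \<noteq> []"
  shows "strand_list c = passages (last c # c @ [hd c])"
proof -
  obtain x r where c: "c = x # r" using assms by (cases c) auto
  have 1: "zip (c @ [hd c]) (rotate1 c) = zip c (rotate1 c)"
    by (subst zip_append1) simp
  have eq: "last c # c @ [hd c] = (last c # butlast c) @ [last c, hd c]"
    using assms by simp
  have "passages (last c # c @ [hd c]) = zip (last c # c @ [hd c]) (zip c (rotate1 c))"
    unfolding passages_zip using 1 c by simp
  also have "\<dots> = zip (last c # butlast c) (zip c (rotate1 c))"
    unfolding eq using assms by (subst zip_append1) simp
  finally show ?thesis by (simp add: strand_list_def)
qed

lemma strand_list_loop:
  "p \<noteq> [] \<Longrightarrow> strand_list (v # p) = (last p, v, hd p) # passages (v # p @ [v])"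
  by (cases p) (simp_all add: strand_list_passages)

lemma strand_list_split:
  assumes "p \<noteq> []" "q \<noteq> []"
  shows "strand_list (v # p @ v # q) =
    (last q, v, hd p) # passages (v # p @ [v]) @ (last p, v, hd q) # passages (v # q @ [v])"
proof -
  obtain y ys h hs where pq: "p = y # ys" "q = h # hs" using assms by (cases p; cases q) auto
  have p: "p = butlast p @ [last p]" using assms by simp
  have "strand_list (v # p @ v # q) = (last q, v, hd p) # passages (v # p @ v # q @ [v])"
    using assms pq by (simp add: strand_list_passages)
  also have "v # p @ v # q @ [v] = (v # butlast p) @ last p # v # q @ [v]"
    by (subst p) simp
  also have "passages \<dots> = passages ((v # butlast p) @ [last p, v]) @ passages (last p # v # q @ [v])"
    by (rule passages_append)
  also have "(v # butlast p) @ [last p, v] = v # p @ [v]"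
    by (subst (3) p) simp
  also have "passages (last p # v # q @ [v]) = (last p, v, hd q) # passages (v # q @ [v])"
    using pq by simp
  finally show ?thesis .
qed

lemma zip_rotate1: "length xs = length ys \<Longrightarrow> zip (rotate1 xs) (rotate1 ys) = rotate1 (zip xs ys)"
  by (cases xs; cases ys) auto

lemma strand_list_rotate: "strand_list (rotate k c) = rotate k (strand_list c)"
proof (induction k)
  case (Suc k)
  have *: "strand_list (rotate1 c) = rotate1 (strand_list c)" for c :: "nat list"
  proof (cases "c = []")
    case False
    have r: "last (rotate1 c) # butlast (rotate1 c) = rotate1 (last c # butlast c)"
      using False by (cases c) auto
    have "strand_list (rotate1 c) = zip (rotate1 (last c # butlast c)) (rotate1 (zip c (rotate1 c)))"
      unfolding strand_list_def r by (simp only: zip_rotate1 length_rotate1)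
    also have "\<dots> = rotate1 (strand_list c)"
      unfolding strand_list_def by (rule zip_rotate1) (use False in simp)
    finally show ?thesis .
  qed (simp add: strand_list_def)
  show ?case using Suc * by simp
qed simp

lemma arcs_rotate: "arcs (rotate k c) = rotate k (arcs c)"
  unfolding arcs_strand_list strand_list_rotate by (simp add: rotate_map)

lemma strands_rotate: "strands [rotate k c] = strands [c]"
  by (simp add: strands_def strand_list_rotate)

lemma travel_sign_strands: "strands [c] = strands [c'] \<Longrightarrow> travel_sign S [c] = travel_sign S [c']"
  by (rule ext) (simp add: travel_sign_def)

lemma normal_curve_rotate: "normal_curve S [c] \<Longrightarrow> normal_curve S [rotate k c]"
  unfolding normal_curve_def strands_rotate by (simp add: arcs_rotate rotate_map[symmetric])

lemma filter_rotate: "\<exists>m. filter P (rotate k xs) = rotate m (filter P xs)"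
proof -
  let ?j = "k mod length xs"
  have "filter P (rotate k xs) = filter P (drop ?j xs) @ filter P (take ?j xs)"
    by (simp add: rotate_drop_take)
  also have "\<dots> = rotate (length (filter P (take ?j xs))) (filter P (take ?j xs) @ filter P (drop ?j xs))"
    by (simp add: rotate_append)
  also have "filter P (take ?j xs) @ filter P (drop ?j xs) = filter P xs"
    by (metis append_take_drop_id filter_append)
  finally show ?thesis by blast
qed

locale crossing_loop = tri_surf T for T :: surf +
  fixes v :: nat and p q :: "nat list"
  assumes p_ne: "p \<noteq> []" and q_ne: "q \<noteq> []"
    and normal: "normal_curve T [v # p @ v # q]"
    and positive: "travel_sign T [v # p @ v # q] (last q, v, hd p) = 1"
begin

abbreviation "trail \<equiv> v # p @ v # q"
abbreviation "inner \<equiv> passages (v # p @ [v])"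
abbreviation "pos_strand \<equiv> (last q, v, hd p)"
abbreviation "neg_strand \<equiv> (last p, v, hd q)"
abbreviation "corner \<equiv> (last p, v, hd p)"

lemma strand_list_trail: "strand_list trail = pos_strand # inner @ neg_strand # passages (v # q @ [v])"
  by (rule strand_list_split[OF p_ne q_ne])

lemma strands_trail: "strands [trail] = set (strand_list trail)"
  by (simp add: strands_def)

lemma distinct_trail: "distinct (strand_list trail)"
  using distinct_concat_strands[OF normal_curve_distinct[OF normal]] by simp

lemma strands_mem: "pos_strand \<in> strands [trail]" "neg_strand \<in> strands [trail]" "set inner \<subseteq> strands [trail]"
  unfolding strands_trail strand_list_trail by auto

lemma strand_distinct: "pos_strand \<noteq> neg_strand" "pos_strand \<notin> set inner" "neg_strand \<notin> set inner"
  using distinct_trail unfolding strand_list_trail by auto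

lemma at_crossing:
  assumes s: "s \<in> strands [trail]" "mid s = v"
  shows "s = pos_strand \<or> s = neg_strand"
proof (rule ccontr)
  assume "\<not> (s = pos_strand \<or> s = neg_strand)"
  then have "card {pos_strand, neg_strand, s} = 3" using strand_distinct(1) by auto
  moreover have "card {pos_strand, neg_strand, s} \<le> card {s \<in> strands [trail]. mid s = v}"
    by (rule card_mono) (use finite_strands strands_mem s in auto)
  moreover have "card {s \<in> strands [trail]. mid s = v} \<le> 2"
    using normal unfolding normal_curve_def by blast
  ultimately show False by linarith
qed

lemma interior_crossing: "interior_vertex T v"
proof -
  have "\<forall>s\<in>strands [trail]. \<forall>t\<in>strands [trail]. s \<noteq> t \<and> mid s = mid t \<longrightarrow> interior_vertex T (mid s)"
    using normal unfolding normal_curve_def by blast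
  from this[rule_format, OF strands_mem(1,2)] show ?thesis using strand_distinct(1) by simp
qed

lemma crossed: "crossed_lr T pos_strand neg_strand"
proof -
  obtain t where t: "t \<in> strands [trail]" "t \<noteq> pos_strand" "mid t = v" "crossed_lr T pos_strand t"
    using positive unfolding travel_sign_def by (auto split: if_splits)
  then show ?thesis using at_crossing[OF t(1,3)] by simp
qed

lemma inner_mid: "s \<in> set inner \<Longrightarrow> mid s \<noteq> v"
proof
  assume s: "s \<in> set inner" "mid s = v"
  then have "s = pos_strand \<or> s = neg_strand" using at_crossing[of s] strands_mem(3) by blast
  then show False using s(1) strand_distinct(2,3) by metis
qed

lemma loop_arcs: "distinct (arcs (v # p))" "set (arcs (v # p)) \<subseteq> set (arcs trail)"
proof -
  have "arcs (v # p) = (v, hd p) # map snd inner"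
    unfolding arcs_strand_list strand_list_loop[OF p_ne] by simp
  moreover have "arcs trail = (v, hd p) # map snd inner @ (v, hd q) # map snd (passages (v # q @ [v]))"
    unfolding arcs_strand_list strand_list_trail by simp
  moreover have "distinct (arcs trail)" using normal_curve_distinct[OF normal] by simp
  ultimately show "distinct (arcs (v # p))" "set (arcs (v # p)) \<subseteq> set (arcs trail)" by auto
qed

lemma loop_edges: "(x, y) \<in> set (arcs (v # p)) \<Longrightarrow> {x, y} \<in> edges T"
  using normal_curve_edges[OF normal, of x y] loop_arcs(2) by auto

lemma loop_cycle: "curve_chain [v # p] \<in> cycles1 T"
  by (rule curve_cycles1[OF tri_surf_axioms]) (use loop_arcs(1) loop_edges in auto)

lemma ends:
  "{v, last q} \<in> edges T" "{v, hd p} \<in> edges T" "last q \<noteq> hd p"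
  "{v, last p} \<in> edges T" "{v, hd q} \<in> edges T" "last p \<noteq> hd q"
  using strand_neq[OF normal strands_mem(1)] strand_neq[OF normal strands_mem(2)] by auto

lemma loop_flow:
  "curve_chain [v # p] (x, u) = (if x = v then of_bool (u = hd p) - of_bool (u = last p) else
    (\<Sum>s\<in>{s \<in> set inner. mid s = x}. of_bool (u = snd (snd s)) - of_bool (u = fst s)))"
proof -
  let ?f = "\<lambda>s. of_bool (u = snd (snd s)) - of_bool (u = fst s) :: int"
  have nc: "corner \<notin> set inner" using inner_mid[of corner] by auto
  have "strands [v # p] = insert corner (set inner)"
    by (simp add: strands_def strand_list_loop[OF p_ne])
  moreover have "distinct (concat (map arcs [v # p]))" using loop_arcs(1) by simp
  note curve_chain_strands[OF this, of x u]
  ultimately have "curve_chain [v # p] (x, u) = of_bool (v = x) * ?f corner + (\<Sum>s\<in>set inner. of_bool (mid s = x) * ?f s)"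
    using sum.insert[OF finite_set nc, of "\<lambda>s. of_bool (mid s = x) * ?f s"] by (simp only: fst_conv snd_conv)
  also have "(\<Sum>s\<in>set inner. of_bool (mid s = x) * ?f s) = (\<Sum>s\<in>{s \<in> set inner. mid s = x}. ?f s)"
    by (rule sum.mono_neutral_cong_right) auto
  also have "x = v \<Longrightarrow> (\<Sum>s\<in>{s \<in> set inner. mid s = x}. ?f s) = 0"
  proof -
    assume "x = v"
    then have "{s \<in> set inner. mid s = x} = {}" using inner_mid by blast
    then show ?thesis by (simp only: sum.empty)
  qed
  then have "of_bool (v = x) * ?f corner + (\<Sum>s\<in>{s \<in> set inner. mid s = x}. ?f s) =
      (if x = v then of_bool (u = hd p) - of_bool (u = last p) else (\<Sum>s\<in>{s \<in> set inner. mid s = x}. ?f s))"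
    by (cases "x = v") simp_all
  finally show ?thesis .
qed

end

lemma loop_symbols_eq:
  assumes d: "distinct w" and k: "rotate k w = (i, 1) # u @ (i, - 1) # u'"
  shows "loop_symbols w i = set u"
proof -
  have "set u2 = set u" if k2: "rotate k2 w = (i, 1) # u2 @ (i, - 1) # u2'" for k2 u2 u2'
  proof -
    let ?n = "length w"
    have n0: "w \<noteq> []" using k by auto
    have "w ! (k mod ?n) = (i, 1)" "w ! (k2 mod ?n) = (i, 1)"
      using hd_rotate_conv_nth[OF n0, of k] hd_rotate_conv_nth[OF n0, of k2] k k2 by simp_all
    then have "k mod ?n = k2 mod ?n"
      using nth_eq_iff_index_eq[OF d, of "k mod ?n" "k2 mod ?n"] n0 by simp
    then have "rotate k w = rotate k2 w" by (metis rotate_conv_mod)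
    then have eq: "u @ (i, - 1) # u' = u2 @ (i, - 1) # u2'" using k k2 by simp
    have "distinct (rotate k w)" "distinct (rotate k2 w)" using d by simp_all
    then have "(i, - 1) \<notin> set u" "(i, - 1) \<notin> set u'" unfolding k k2 by auto
    then have "u = u2" using eq append_Cons_eq_iff[of "(i, - 1)" u u' u2 u2'] by simp
    then show ?thesis by simp
  qed
  then show ?thesis unfolding loop_symbols_def using k by blast
qed

lemma loop_symbols_shift:
  assumes d: "distinct w" and k: "rotate k w = xs @ ys" and e: "ys @ xs = (i, 1) # u @ (i, - 1) # u'"
  shows "loop_symbols w i = set u"
proof (rule loop_symbols_eq[OF d])
  have "rotate (length xs + k) w = ys @ xs" by (simp add: rotate_rotate[symmetric] k rotate_append)
  then show "rotate (length xs + k) w = (i, 1) # u @ (i, - 1) # u'" using e by simp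
qed

text \<open>Chords of a circle: the arc of \<open>i\<close> separates the ends of \<open>j\<close> iff that of \<open>j\<close> separates those of \<open>i\<close>.\<close>

lemma loop_symbols_linked:
  assumes w: "signed_gauss_word n w" and k: "rotate k w = (i, 1) # u @ (i, - 1) # u'"
    and j: "j \<in> {1..n}" "i \<noteq> j"
  shows "of_bool ((j, 1) \<in> loop_symbols w i) - of_bool ((j, - 1) \<in> loop_symbols w i) =
    (of_bool ((i, - 1) \<in> loop_symbols w j) - of_bool ((i, 1) \<in> loop_symbols w j) :: int)"
proof -
  have d: "distinct w" and sw: "set w = {1..n} \<times> {1, - 1}"
    using w unfolding signed_gauss_word_def by auto
  have dr: "distinct ((i, 1) # u @ (i, - 1) # u')" using d unfolding k[symmetric] by simp
  have "set ((i, 1) # u @ (i, - 1) # u') = {1..n} \<times> {1, - 1}" using sw unfolding k[symmetric] by simp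
  then have mem: "(j, 1) \<in> set u \<or> (j, 1) \<in> set u'" "(j, - 1) \<in> set u \<or> (j, - 1) \<in> set u'"
    using j by auto
  have Li: "loop_symbols w i = set u" by (rule loop_symbols_eq[OF d k])
  show ?thesis
  proof (cases "(j, 1) \<in> set u")
    case True
    then obtain u1 u2 where u: "u = u1 @ (j, 1) # u2" by (meson split_list)
    consider "(j, - 1) \<in> set u1" | "(j, - 1) \<in> set u2" | "(j, - 1) \<in> set u'" using mem(2) u by auto
    then show ?thesis
    proof cases
      case 1
      then obtain y z where y: "u1 = y @ (j, - 1) # z" by (meson split_list)
      have "loop_symbols w j = set (u2 @ (i, - 1) # u' @ (i, 1) # y)"
        by (rule loop_symbols_shift[OF d, of k "(i, 1) # u1" "(j, 1) # u2 @ (i, - 1) # u'" _ _ z]) (simp_all add: k u y)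
      then show ?thesis using dr u y Li by auto
    next
      case 2
      then obtain y z where y: "u2 = y @ (j, - 1) # z" by (meson split_list)
      have "loop_symbols w j = set y"
        by (rule loop_symbols_shift[OF d, of k "(i, 1) # u1" "(j, 1) # u2 @ (i, - 1) # u'" _ _ "z @ (i, - 1) # u' @ (i, 1) # u1"]) (simp_all add: k u y)
      then show ?thesis using dr u y Li by auto
    next
      case 3
      then obtain y z where y: "u' = y @ (j, - 1) # z" by (meson split_list)
      have "loop_symbols w j = set (u2 @ (i, - 1) # y)"
        by (rule loop_symbols_shift[OF d, of k "(i, 1) # u1" "(j, 1) # u2 @ (i, - 1) # u'" _ _ "z @ (i, 1) # u1"]) (simp_all add: k u y)
      then show ?thesis using dr u y Li by auto
    qed
  next
    case False
    then obtain u1 u2 where u: "u' = u1 @ (j, 1) # u2" using mem(1) by (meson split_list)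
    consider "(j, - 1) \<in> set u" | "(j, - 1) \<in> set u1" | "(j, - 1) \<in> set u2" using mem(2) u by auto
    then show ?thesis
    proof cases
      case 1
      then obtain y z where y: "u = y @ (j, - 1) # z" by (meson split_list)
      have "loop_symbols w j = set (u2 @ (i, 1) # y)"
        by (rule loop_symbols_shift[OF d, of k "(i, 1) # u @ (i, - 1) # u1" "(j, 1) # u2" _ _ "z @ (i, - 1) # u1"]) (simp_all add: k u y)
      then show ?thesis using dr u y Li by auto
    next
      case 2
      then obtain y z where y: "u1 = y @ (j, - 1) # z" by (meson split_list)
      have "loop_symbols w j = set (u2 @ (i, 1) # u @ (i, - 1) # y)"
        by (rule loop_symbols_shift[OF d, of k "(i, 1) # u @ (i, - 1) # u1" "(j, 1) # u2" _ _ z]) (simp_all add: k u y)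
      then show ?thesis using dr u y Li by auto
    next
      case 3
      then obtain y z where y: "u2 = y @ (j, - 1) # z" by (meson split_list)
      have "loop_symbols w j = set y"
        by (rule loop_symbols_shift[OF d, of k "(i, 1) # u @ (i, - 1) # u1" "(j, 1) # u2" _ _ "z @ (i, 1) # u @ (i, - 1) # u1"]) (simp_all add: k u y)
      then show ?thesis using dr u y Li by auto
    qed
  qed
qed

lemma splitting_loop:
  assumes S: "tri_surf S" and n: "normal_curve S [c]" and sp: "splitting S c v c1 c2"
  obtains k p q where "rotate k c = v # p @ v # q" "crossing_loop S v p q"
    "c1 = sd_path p @ rev (ccw_arc (sd S) (bary {v}) (bary {v, hd p}) (bary {v, last p}))"
proof -
  interpret tri_surf S by (rule S)
  obtain k p q where k: "rotate k c = v # p @ v # q" and t: "travel_sign S [c] (last q, v, hd p) = 1"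
    and c1: "c1 = sd_path p @ rev (ccw_arc (sd S) (bary {v}) (bary {v, hd p}) (bary {v, last p}))"
    using sp unfolding splitting_def by blast
  have nk: "normal_curve S [v # p @ v # q]" using normal_curve_rotate[OF n, of k] k by simp
  have loopfree: "(v, v) \<notin> set (arcs (v # p @ v # q))"
    using normal_curve_edges[OF nk, of v v] edge_neq[of v v] by auto
  have "p \<noteq> []"
  proof
    assume "p = []"
    then have "(v, v) \<in> set (arcs (v # p @ v # q))"
      unfolding set_arcs by (intro CollectI exI[of _ 0]) (simp add: mod_Suc)
    then show False using loopfree by blast
  qed
  moreover have "q \<noteq> []"
  proof
    assume "q = []"
    then have "(v, v) \<in> set (arcs (v # p @ v # q))"
      unfolding set_arcs by (intro CollectI exI[of _ "Suc (length p)"]) (simp add: nth_append)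
    then show False using loopfree by blast
  qed
  moreover have "travel_sign S [v # p @ v # q] = travel_sign S [c]"
    by (rule travel_sign_strands) (metis k strands_rotate)
  ultimately have "crossing_loop S v p q"
    using nk t by unfold_locales simp_all
  then show ?thesis using that k c1 by blast
qed

lemma loop_symbols_strands:
  assumes w: "signed_gauss_word n w" and lab: "inj_on lab {1..n}" "lab ` {1..n} = crossings [c]"
    and g: "map (\<lambda>(i, p). (lab i, p)) (rotate k0 w) = gauss_code S c"
    and k: "rotate k c = v # p @ v # q" and cl: "crossing_loop S v p q" and i: "i \<in> {1..n}" "v = lab i"
  obtains m u u' where "rotate m w = (i, 1) # u @ (i, - 1) # u'"
    and "travel_sign S [c] (last p, v, hd q) = - 1"
    and "\<And>a e. a \<in> {1..n} \<Longrightarrow> (a, e) \<in> loop_symbols w i \<longleftrightarrow>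
      (\<exists>s\<in>set (passages (v # p @ [v])). mid s = lab a \<and> travel_sign S [c] s = e)"
proof -
  interpret crossing_loop S v p q by (rule cl)
  have d: "distinct w" and sw: "set w = {1..n} \<times> {1, - 1}"
    using w unfolding signed_gauss_word_def by auto
  let ?cd = "\<lambda>s. (mid s, travel_sign S [c] s)" and ?Q = "\<lambda>s. mid s \<in> crossings [c]" and ?g = "\<lambda>(i, p). (lab i, p :: int)"
  have st: "strands [trail] = strands [c]" by (metis k strands_rotate)
  have vc: "v \<in> crossings [c]" using lab(2) i by blast
  have tp: "travel_sign S [c] pos_strand = 1" using positive travel_sign_strands[OF st] by metis
  obtain m where m: "filter ?Q (strand_list trail) = rotate m (filter ?Q (strand_list c))"
    using filter_rotate[of ?Q k "strand_list c"] unfolding strand_list_rotate[symmetric] k by blast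
  have "map ?cd (filter ?Q (strand_list trail)) = rotate m (gauss_code S c)"
    unfolding gauss_code_def m by (simp add: rotate_map)
  also have "\<dots> = map ?g (rotate (m + k0) w)"
    unfolding g[symmetric] by (simp add: rotate_map rotate_rotate)
  finally have eq: "map ?g (rotate (m + k0) w) = (v, 1) # map ?cd (filter ?Q inner) @
      (v, travel_sign S [c] neg_strand) # map ?cd (filter ?Q (passages (v # q @ [v])))"
    unfolding strand_list_trail using vc tp by simp
  then obtain x xs where x: "rotate (m + k0) w = x # xs" "?g x = (v, 1)"
    "map ?g xs = map ?cd (filter ?Q inner) @ (v, travel_sign S [c] neg_strand) # map ?cd (filter ?Q (passages (v # q @ [v])))"
    by (auto simp: Cons_eq_map_conv map_eq_Cons_conv)
  from x(3) obtain u y u' where u: "xs = u @ y # u'" "map ?g u = map ?cd (filter ?Q inner)"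
    "?g y = (v, travel_sign S [c] neg_strand)"
    by (auto simp: map_eq_append_conv map_eq_Cons_conv)
  have xy: "x \<in> {1..n} \<times> {1, - 1}" "y \<in> {1..n} \<times> {1, - 1}" "set u \<subseteq> {1..n} \<times> {1, - 1}"
    using x(1) u(1) sw set_rotate[of "m + k0" w] by auto
  have "x \<noteq> y" using d distinct_rotate[of "m + k0" w] x(1) u(1) by auto
  obtain a e b f where ab: "x = (a, e)" "y = (b, f)" by (cases x; cases y)
  have "lab a = lab i" "lab b = lab i" "e = 1" "f = travel_sign S [c] neg_strand"
    using x(2) u(3) i(2) ab by auto
  then have xi: "x = (i, 1)" and "b = i" using inj_onD[OF lab(1)] xy ab i(1) by auto
  then have "f = - 1" using \<open>x \<noteq> y\<close> xy(2) ab by auto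
  then have yi: "y = (i, - 1)" using ab \<open>b = i\<close> by simp
  have rot: "rotate (m + k0) w = (i, 1) # u @ (i, - 1) # u'" using x(1) u(1) xi yi by simp
  have L: "loop_symbols w i = set u" by (rule loop_symbols_eq[OF d rot])
  have mem: "(a, e) \<in> set u \<longleftrightarrow> (\<exists>s\<in>set inner. mid s = lab a \<and> travel_sign S [c] s = e)" if a: "a \<in> {1..n}" for a e
  proof -
    have "(a, e) \<in> set u \<longleftrightarrow> (lab a, e) \<in> ?g ` set u"
    proof
      assume "(lab a, e) \<in> ?g ` set u"
      then obtain b where "(b, e) \<in> set u" "lab b = lab a" by auto
      then show "(a, e) \<in> set u" using inj_onD[OF lab(1)] xy(3) a by (metis mem_Sigma_iff subsetD)
    qed force
    also have "?g ` set u = ?cd ` {s \<in> set inner. ?Q s}"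
      using arg_cong[OF u(2), of set] by simp
    also have "(lab a, e) \<in> \<dots> \<longleftrightarrow> (\<exists>s\<in>set inner. mid s = lab a \<and> travel_sign S [c] s = e)"
    proof -
      have "lab a \<in> crossings [c]" using lab(2) a by blast
      then show ?thesis unfolding image_iff by (metis (mono_tags, lifting) mem_Collect_eq prod.inject)
    qed
    finally show ?thesis .
  qed
  have "travel_sign S [c] neg_strand = - 1"
    using \<open>f = - 1\<close> \<open>f = travel_sign S [c] neg_strand\<close> by simp
  then show ?thesis by (rule that[OF rot]) (simp only: L mem)
qed


theorem proposition3:
  fixes n i j :: nat and w :: "(nat \<times> int) list"
    and S :: surf and \<gamma> :: "nat list" and lab :: "nat \<Rightarrow> nat"
    and c1 c2 :: "nat \<Rightarrow> nat list"
    and \<phi> :: "nat \<Rightarrow> (nat \<times> nat \<Rightarrow> int) set"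
  assumes "signed_gauss_word n w"
    and "minimal_realization n w S \<gamma>"
    and "realizes_with n w S \<gamma> lab"
    and "\<And>k. k \<in> {1..n} \<Longrightarrow> splitting S \<gamma> (lab k) (c1 k) (c2 k)"
    and "\<And>k. k \<in> {1..n} \<Longrightarrow> \<phi> k \<in> carrier (H1 S) \<and> represents S 1 [c1 k] (\<phi> k)"
    and "i \<in> {1..n}" and "j \<in> {1..n}"
  shows "intersection_form S (\<phi> i) (\<phi> j) =
    (\<Sum>(a, e)\<in>loop_symbols_bar w i \<inter> loop_symbols_inv w j. e)"
proof -
  have S: "oriented_surface S" and normal: "normal_curve S [\<gamma>]" and lab: "inj_on lab {1..n}" "lab ` {1..n} = crossings [\<gamma>]"
    using assms(3) unfolding realizes_with_def connected_surface_def bij_betw_def by blast+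
  obtain k0 where code: "map (\<lambda>(i, p). (lab i, p)) (rotate k0 w) = gauss_code S \<gamma>"
    using assms(3) unfolding realizes_with_def by blast
  have sw: "set w = {1..n} \<times> {1, - 1}" using assms(1) unfolding signed_gauss_word_def by blast
  interpret tri_surf S by (rule tri_surf_of_oriented[OF S])
  let ?smooth = "\<lambda>k p q. (\<exists>r. rotate r \<gamma> = lab k # p @ lab k # q) \<and> crossing_loop S (lab k) p q \<and>
      c1 k = sd_path p @ rev (ccw_arc (sd S) (bary {lab k}) (bary {lab k, hd p}) (bary {lab k, last p}))"
  have "\<exists>p q. ?smooth k p q" if "k \<in> {1..n}" for k
    using splitting_loop[OF tri_surf_axioms normal assms(4)[OF that]] by metis
  then obtain P Q where PQ: "\<forall>k\<in>{1..n}. ?smooth k (P k) (Q k)" by metis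
  have rot: "\<exists>r. rotate r \<gamma> = lab k # P k @ lab k # Q k" and cl: "crossing_loop S (lab k) (P k) (Q k)"
    and c1: "c1 k = sd_path (P k) @ rev (ccw_arc (sd S) (bary {lab k}) (bary {lab k, hd (P k)}) (bary {lab k, last (P k)}))"
    if "k \<in> {1..n}" for k
    using PQ that by blast+
  let ?inner = "\<lambda>k. set (passages (lab k # P k @ [lab k]))"
  let ?pos = "\<lambda>a. (last (Q a), lab a, hd (P a))" and ?neg = "\<lambda>a. (last (P a), lab a, hd (Q a))"
  define L where "L k = curve_chain [lab k # P k]" for k
  define A :: "nat \<Rightarrow> nat \<Rightarrow> int \<Rightarrow> int" where "A k a e = of_bool ((a, e) \<in> loop_symbols w k)" for k a e
  have strands: "strands [lab k # P k @ lab k # Q k] = strands [\<gamma>]" if "k \<in> {1..n}" for k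
    using rot[OF that] strands_rotate by metis
  have sign_pos: "travel_sign S [\<gamma>] (?pos k) = 1" if "k \<in> {1..n}" for k
    using crossing_loop.positive[OF cl[OF that]] travel_sign_strands[OF strands[OF that]] by metis
  have word: "(\<exists>m u u'. rotate m w = (k, 1) # u @ (k, - 1) # u') \<and> travel_sign S [\<gamma>] (?neg k) = - 1 \<and>
      (\<forall>a\<in>{1..n}. \<forall>e. (a, e) \<in> loop_symbols w k \<longleftrightarrow> (\<exists>s\<in>?inner k. mid s = lab a \<and> travel_sign S [\<gamma>] s = e))"
    if k: "k \<in> {1..n}" for k
  proof -
    obtain r where "rotate r \<gamma> = lab k # P k @ lab k # Q k" using rot[OF k] by blast
    from loop_symbols_strands[OF assms(1) lab code this cl[OF k] k refl] show ?thesis by metis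
  qed
  have at_lab: "s = ?pos a \<or> s = ?neg a" if "a \<in> {1..n}" "s \<in> strands [\<gamma>]" "mid s = lab a" for s a
    using crossing_loop.at_crossing[OF cl[OF that(1)], of s] strands[OF that(1)] that(2,3) by simp
  have inner: "?inner k \<subseteq> strands [\<gamma>]" if "k \<in> {1..n}" for k
    using crossing_loop.strands_mem(3)[OF cl[OF that]] strands[OF that] by simp
  have sym_pos: "(a, 1) \<in> loop_symbols w k \<longleftrightarrow> ?pos a \<in> ?inner k"
    and sym_neg: "(a, - 1) \<in> loop_symbols w k \<longleftrightarrow> ?neg a \<in> ?inner k" if k: "k \<in> {1..n}" and a: "a \<in> {1..n}" for k a
  proof -
    have iff: "(a, e) \<in> loop_symbols w k \<longleftrightarrow> (\<exists>s\<in>?inner k. mid s = lab a \<and> travel_sign S [\<gamma>] s = e)" for e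
      using word[OF k] a by blast
    have neg: "travel_sign S [\<gamma>] (?neg a) = - 1" using word[OF a] by blast
    have cases: "s = ?pos a \<or> s = ?neg a" if "s \<in> ?inner k" "mid s = lab a" for s
      using at_lab[OF a] inner[OF k] that by blast
    show "(a, 1) \<in> loop_symbols w k \<longleftrightarrow> ?pos a \<in> ?inner k"
    proof
      assume "(a, 1) \<in> loop_symbols w k"
      then obtain s where s: "s \<in> ?inner k" "mid s = lab a" "travel_sign S [\<gamma>] s = 1" using iff by blast
      then have "s \<noteq> ?neg a" using neg by auto
      then show "?pos a \<in> ?inner k" using cases[OF s(1,2)] s(1) by auto
    next
      assume "?pos a \<in> ?inner k"
      then show "(a, 1) \<in> loop_symbols w k" unfolding iff using sign_pos[OF a] by (intro bexI[of _ "?pos a"]) simp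
    qed
    show "(a, - 1) \<in> loop_symbols w k \<longleftrightarrow> ?neg a \<in> ?inner k"
    proof
      assume "(a, - 1) \<in> loop_symbols w k"
      then obtain s where s: "s \<in> ?inner k" "mid s = lab a" "travel_sign S [\<gamma>] s = - 1" using iff by blast
      then have "s \<noteq> ?pos a" using sign_pos[OF a] by auto
      then show "?neg a \<in> ?inner k" using cases[OF s(1,2)] s(1) by auto
    next
      assume "?neg a \<in> ?inner k"
      then show "(a, - 1) \<in> loop_symbols w k" unfolding iff using neg by (intro bexI[of _ "?neg a"]) simp
    qed
  qed
  have own: "A k k 1 = 0" "A k k (- 1) = 0" if k: "k \<in> {1..n}" for k
    using sym_pos[OF k k] sym_neg[OF k k] crossing_loop.inner_mid[OF cl[OF k]] unfolding A_def by fastforce+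
  have flow: "L k (lab a, u) = A k a 1 * (of_bool (u = hd (P a)) - of_bool (u = last (Q a))) +
      A k a (- 1) * (of_bool (u = hd (Q a)) - of_bool (u = last (P a))) +
      of_bool (a = k) * (of_bool (u = hd (P a)) - of_bool (u = last (P a)))"
    if k: "k \<in> {1..n}" and a: "a \<in> {1..n}" for k a u
  proof (cases "a = k")
    case True
    then show ?thesis
      using crossing_loop.loop_flow[OF cl[OF k], of "lab k" u] own[OF k] by (simp add: L_def)
  next
    case False
    then have ne: "lab a \<noteq> lab k" using inj_onD[OF lab(1)] k a by blast
    let ?fl = "\<lambda>s. of_bool (u = snd (snd s)) - of_bool (u = fst s) :: int"
    have pn: "?pos a \<noteq> ?neg a" by (rule crossing_loop.strand_distinct(1)[OF cl[OF a]])
    have "{s \<in> ?inner k. mid s = lab a} = {s \<in> {?pos a, ?neg a}. s \<in> ?inner k}"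
      using at_lab[OF a] inner[OF k] by auto
    then have "(\<Sum>s\<in>{s \<in> ?inner k. mid s = lab a}. ?fl s) = (\<Sum>s\<in>{?pos a, ?neg a}. of_bool (s \<in> ?inner k) * ?fl s)"
      by (simp only:) (rule sum.mono_neutral_cong_left, auto)
    also have "\<dots> = of_bool (?pos a \<in> ?inner k) * ?fl (?pos a) + of_bool (?neg a \<in> ?inner k) * ?fl (?neg a)"
      by (subst sum.insert) (use pn in \<open>simp_all del: prod.inject\<close>)
    finally show ?thesis
      using crossing_loop.loop_flow[OF cl[OF k], of "lab a" u] ne False
      unfolding A_def sym_pos[OF k a] sym_neg[OF k a] L_def by simp
  qed
  have cycle: "L k \<in> cycles1 S" if "k \<in> {1..n}" for k
    unfolding L_def by (rule crossing_loop.loop_cycle[OF cl[OF that]])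
  obtain F where F: "potential S F (L i)" using potential_exists[OF S cycle[OF assms(6)]] by blast
  obtain G where G: "potential S G (L j)" using potential_exists[OF S cycle[OF assms(7)]] by blast
  have at: "pairing_at S G (L i) (lab a) = 2 * (A i a 1 * A j a (- 1) - A i a (- 1) * A j a 1) +
      (A i a 1 - A i a (- 1)) * of_bool (a = j) + of_bool (a = i) * (A j a (- 1) - A j a 1)" if a: "a \<in> {1..n}" for a
  proof -
    interpret C: crossing_loop S "lab a" "P a" "Q a" by (rule cl[OF a])
    show ?thesis
      by (rule crossing_bilinear[OF S C.interior_crossing C.ends C.crossed F G flow[OF assms(6) a] flow[OF assms(7) a]])
  qed
  have off: "pairing_at S G (L i) v = 0" if v: "v \<notin> crossings [\<gamma>]" for v
  proof -
    have fl: "L k (v, u) = (\<Sum>s\<in>{s \<in> ?inner k. mid s = v}. of_bool (u = snd (snd s)) - of_bool (u = fst s))"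
      if k: "k \<in> {1..n}" for k u
    proof -
      have "v \<noteq> lab k" using v k lab(2) by blast
      then show ?thesis using crossing_loop.loop_flow[OF cl[OF k], of v u] by (simp add: L_def)
    qed
    have one: "s = t" if "s \<in> strands [\<gamma>]" "t \<in> strands [\<gamma>]" "mid s = v" "mid t = v" for s t
      using v that unfolding crossings_def by blast
    let ?B = "\<lambda>k. {s \<in> ?inner k. mid s = v}"
    consider "?B i = {}" | "?B j = {}" | s t where "s \<in> ?B i" "t \<in> ?B j" by blast
    then show ?thesis
    proof cases
      case 1
      show ?thesis by (rule pairing_at_zero) (simp only: fl[OF assms(6)] 1 sum.empty)
    next
      case 2
      have "pairing_at S F (L j) v = 0" by (rule pairing_at_zero) (simp only: fl[OF assms(7)] 2 sum.empty)
      then show ?thesis using pairing_at_antisym[OF F G, of v] by simp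
    next
      case (3 s t)
      have "?B i = {s}" "?B j = {s}"
        using 3 one inner[OF assms(6)] inner[OF assms(7)] by blast+
      then have "L i (v, u) = L j (v, u)" for u unfolding fl[OF assms(6)] fl[OF assms(7)] by simp
      then show ?thesis by (rule pairing_at_self[OF F G])
    qed
  qed
  have "crossings [\<gamma>] \<subseteq> verts S"
  proof
    fix v assume "v \<in> crossings [\<gamma>]"
    then obtain a where "a \<in> {1..n}" "v = lab a" using lab(2) by blast
    then show "v \<in> verts S" using crossing_loop.interior_crossing[OF cl] unfolding interior_vertex_def by blast
  qed
  then have "pairing S G (L i) = (\<Sum>v\<in>crossings [\<gamma>]. pairing_at S G (L i) v)"
    unfolding pairing_sum by (intro sum.mono_neutral_right finite_verts) (use off in auto)
  also have "\<dots> = (\<Sum>a\<in>{1..n}. pairing_at S G (L i) (lab a))"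
    unfolding lab(2)[symmetric] by (rule sum.reindex[OF lab(1), unfolded o_def])
  also have "\<dots> = (\<Sum>a\<in>{1..n}. 2 * (A i a 1 * A j a (- 1) - A i a (- 1) * A j a 1)) +
      (\<Sum>a\<in>{1..n}. (A i a 1 - A i a (- 1)) * of_bool (a = j)) + (\<Sum>a\<in>{1..n}. of_bool (a = i) * (A j a (- 1) - A j a 1))"
    unfolding sum.distrib[symmetric] by (rule sum.cong[OF refl]) (rule at)
  also have "(\<Sum>a\<in>{1..n}. (A i a 1 - A i a (- 1)) * of_bool (a = j)) = A i j 1 - A i j (- 1)"
    using assms(7) by (simp add: of_bool_def if_distrib[of "\<lambda>t. _ * t"] cong: if_cong)
  also have "\<dots> = A j i (- 1) - A j i 1"
  proof (cases "i = j")
    case True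
    then show ?thesis using own[OF assms(6)] by simp
  next
    case False
    obtain m u u' where "rotate m w = (i, 1) # u @ (i, - 1) # u'" using word[OF assms(6)] by blast
    from loop_symbols_linked[OF assms(1) this assms(7) False] show ?thesis unfolding A_def .
  qed
  also have single: "(\<Sum>a\<in>{1..n}. of_bool (a = i) * (A j a (- 1) - A j a 1)) = A j i (- 1) - A j i 1"
    using assms(6) by (simp add: of_bool_def if_distrib[of "\<lambda>t. t * _"] cong: if_cong)
  finally have pairing: "pairing S G (L i) =
      2 * ((\<Sum>a\<in>{1..n}. A i a 1 * A j a (- 1) - A i a (- 1) * A j a 1) + (A j i (- 1) - A j i 1))"
    by (simp add: sum_distrib_left)
  have loops: "loop_symbols w k \<subseteq> {1..n} \<times> {1, - 1}" for k
  proof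
    fix s assume "s \<in> loop_symbols w k"
    then obtain m u u' where "rotate m w = (k, 1) # u @ (k, - 1) # u'" "s \<in> set u"
      unfolding loop_symbols_def by blast
    then have "s \<in> set (rotate m w)" by simp
    then show "s \<in> {1..n} \<times> {1, - 1}" using sw by simp
  qed
  have inv: "(a, e) \<in> loop_symbols_inv w j \<longleftrightarrow> (a, - e) \<in> loop_symbols w j" for a e
    unfolding loop_symbols_inv_def by force
  have bar: "of_bool ((a, e) \<in> loop_symbols_bar w i) = A i a e + of_bool (a = i)" if "e \<in> {1, - 1}" for a e
    using own[OF assms(6)] that unfolding loop_symbols_bar_def A_def by auto
  let ?M = "loop_symbols_bar w i \<inter> loop_symbols_inv w j"
  have "?M \<subseteq> {1..n} \<times> {1, - 1}"
    using loops[of i] assms(6) unfolding loop_symbols_bar_def by auto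
  then have "(\<Sum>(a, e)\<in>?M. e) = (\<Sum>(a, e)\<in>{1..n} \<times> {1, - 1}. of_bool ((a, e) \<in> ?M) * e)"
    by (intro sum.mono_neutral_cong_left) auto
  also have "\<dots> = (\<Sum>a\<in>{1..n}. \<Sum>e\<in>{1, - 1}. of_bool ((a, e) \<in> ?M) * e)"
    by (rule sum.cartesian_product[symmetric])
  also have "\<dots> = (\<Sum>a\<in>{1..n}. A i a 1 * A j a (- 1) - A i a (- 1) * A j a 1 + of_bool (a = i) * (A j a (- 1) - A j a 1))"
  proof (rule sum.cong[OF refl])
    fix a
    have "of_bool ((a, e) \<in> ?M) = (A i a e + of_bool (a = i)) * A j a (- e)" if "e \<in> {1, - 1}" for e
      using bar[OF that, of a] by (simp only: A_def Int_iff of_bool_conj inv)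
    then show "(\<Sum>e\<in>{1, - 1}. of_bool ((a, e) \<in> ?M) * e) =
        A i a 1 * A j a (- 1) - A i a (- 1) * A j a 1 + of_bool (a = i) * (A j a (- 1) - A j a 1)"
      by (simp add: algebra_simps)
  qed
  also have "\<dots> = (\<Sum>a\<in>{1..n}. A i a 1 * A j a (- 1) - A i a (- 1) * A j a 1) + (A j i (- 1) - A j i 1)"
    unfolding sum.distrib single ..
  finally have rhs: "pairing S G (L i) = 2 * (\<Sum>(a, e)\<in>?M. e)" using pairing by simp
  have rep: "\<exists>z\<in>cycles1 S. \<phi> k = hclass S z \<and> homologous (sd S) (sd_chain S z) (sd_chain S (L k))" if k: "k \<in> {1..n}" for k
  proof -
    interpret C: crossing_loop S "lab k" "P k" "Q k" by (rule cl[OF k])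
    obtain z where z: "z \<in> cycles1 S" "\<phi> k = hclass S z" "homologous (sd S) (sd_chain S z) (curve_chain [c1 k])"
      using assms(5)[OF k] unfolding represents_def hclass_iff by auto
    have "homologous (sd S) (sd_chain S (L k)) (curve_chain [c1 k])"
      unfolding L_def c1[OF k] by (rule smoothing_homologous[OF S C.interior_crossing C.p_ne C.loop_edges])
    then show ?thesis using z homologous_trans[OF z(3) homologous_sym] by blast
  qed
  obtain z where z: "z \<in> cycles1 S" "\<phi> i = hclass S z" "homologous (sd S) (sd_chain S z) (sd_chain S (L i))"
    using rep[OF assms(6)] by blast
  obtain z' where z': "z' \<in> cycles1 S" "\<phi> j = hclass S z'" "homologous (sd S) (sd_chain S z') (sd_chain S (L j))"
    using rep[OF assms(7)] by blast
  show ?thesis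
    unfolding z(2) z'(2)
    by (rule intersection_form_sd[OF S z(1) z'(1) cycle[OF assms(6)] cycle[OF assms(7)] z(3) z'(3) G rhs])
qed

end
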